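(* Let $m\ge 1$ be an integer, let $\beta>0$ and let $p,q$ be real numbers with $\min(p,q) > (m-1)+\frac{1}{\beta}$. Set $k_0=\beta(p-q)/2$, $k_1=\beta(q-(m-1))-1$, $k_2=\beta/2$. Then for every initial condition $\phi(0)$ with $0\le\phi_m(0)\le\cdots\le\phi_1(0)\le\pi/2$, the stochastic differential equation $$d\phi_i(t) = d\nu_i(t) + \Big[k_0\cot \phi_i(t) + k_1\cot 2\phi_i(t) + k_2\sum_{j\neq i}\big(\cot(\phi_i(t)+\phi_j(t))+\cot(\phi_i(t)-\phi_j(t))\big)\Big]dt,\qquad 1\le i\le m,$$ has a unique strong solution $\phi=(\phi_1,\dots,\phi_m)$, defined for all $t> 0$.
   Context: $\nu=(\nu_1,\dots,\nu_m)$ is a standard $m$-dimensional Brownian motion (independent real Brownian motions). Solutions are continuous adapted processes with values in the closed set $\{\phi\in\mathbb{R}^m:\ 0\le\phi_m\le\cdots\le\phi_1\le\pi/2\}$, which is $\pi$ times the closure of the principal Weyl alcove $A_\circ=\{x\in\mathbb{R}^m: 0<x_m<\cdots<x_1<1/2\}$ of the root system of type $BC_m$. The equation is obtained from the $\beta$-Jacobi equation $$d\lambda_i = 2\sqrt{\lambda_i(1-\lambda_i)}\,d\nu_i+\beta\Big[p-(p+q)\lambda_i+\sum_{j\ne i}\frac{\lambda_i(1-\lambda_j)+\lambda_j(1-\lambda_i)}{\lambda_i-\lambda_j}\Big]dt$$ through $\phi_i=\arcsin\sqrt{\lambda_i}$. *)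

theory Defs
  imports "HOL-Probability.Probability"
begin

text \<open>
  The coordinates of a point of \<open>\<real>\<^sup>m\<close> are indexed by a finite linearly ordered type, so that
  \<open>m\<close> is its cardinality and \<open>i < j\<close> is the usual order of the indices \<open>1, \<dots>, m\<close>.
\<close>

definition alcove :: "(real ^ 'm::{finite,linorder}) set" where
  "alcove = {x. (\<forall>i. 0 < x $ i \<and> x $ i < 1 / 2) \<and> (\<forall>i j. i < j \<longrightarrow> x $ j < x $ i)}"

definition closed_chamber :: "(real ^ 'm::{finite,linorder}) set" where
  "closed_chamber =
     {x. (\<forall>i. 0 \<le> x $ i \<and> x $ i \<le> pi / 2) \<and> (\<forall>i j. i < j \<longrightarrow> x $ j \<le> x $ i)}"

definition drift :: "real \<Rightarrow> real \<Rightarrow> real \<Rightarrow> real ^ 'm::finite \<Rightarrow> real ^ 'm" where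
  "drift k0 k1 k2 x =
     (\<chi> i. k0 * cot (x $ i) + k1 * cot (2 * x $ i)
         + k2 * (\<Sum>j\<in>UNIV - {i}. cot (x $ i + x $ j) + cot (x $ i - x $ j)))"

text \<open>
  Time is a real number and only times \<open>t \<ge> 0\<close> are ever used. The library's filtrations are indexed
  by a whole type; a filtration on \<open>[0, \<infinity>)\<close> is extended to negative times by its value at \<open>0\<close>.
\<close>

definition filtered_prob_space :: "'a measure \<Rightarrow> (real \<Rightarrow> 'a measure) \<Rightarrow> bool" where
  "filtered_prob_space M F \<longleftrightarrow>
     prob_space M \<and> filtration (space M) F \<and> (\<forall>t. subalgebra M (F t))"

text \<open>
  The product density below says that the increment over \<open>[s, t]\<close> has independent coordinates, each
  centred Gaussian of variance \<open>t - s\<close> (\<^const>\<open>normal_density\<close> takes the standard deviation).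
\<close>

definition brownian_motion ::
    "'a measure \<Rightarrow> (real \<Rightarrow> 'a measure) \<Rightarrow> (real \<Rightarrow> 'a \<Rightarrow> real ^ 'm::finite) \<Rightarrow> bool" where
  "brownian_motion M F \<nu> \<longleftrightarrow>
     (\<forall>t\<ge>0. \<nu> t \<in> borel_measurable (F t)) \<and>
     (AE \<omega> in M. \<nu> 0 \<omega> = 0 \<and> continuous_on {0..} (\<lambda>t. \<nu> t \<omega>)) \<and>
     (\<forall>s t. 0 \<le> s \<longrightarrow> s < t \<longrightarrow>
        distributed M lborel (\<lambda>\<omega>. \<nu> t \<omega> - \<nu> s \<omega>)
          (\<lambda>x. ennreal (\<Prod>i\<in>UNIV. normal_density 0 (sqrt (t - s)) (x $ i))) \<and>
        prob_space.indep_set M (sets (F s))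
          (sets (vimage_algebra (space M) (\<lambda>\<omega>. \<nu> t \<omega> - \<nu> s \<omega>) borel)))"

definition augment :: "'a measure \<Rightarrow> 'a measure \<Rightarrow> 'a measure" where
  "augment M G = sigma (space M) (sets G \<union> null_sets (completion M))"

text \<open>The information carried by the initial condition and the noise up to time \<open>t\<close>.\<close>

definition generated_filtration ::
    "'a measure \<Rightarrow> (real \<Rightarrow> 'a \<Rightarrow> real ^ 'm::finite) \<Rightarrow> ('a \<Rightarrow> real ^ 'm) \<Rightarrow> real \<Rightarrow> 'a measure" where
  "generated_filtration M \<nu> \<xi> t =
     sigma (space M)
       ({\<xi> -` B \<inter> space M | B. B \<in> sets borel} \<union>
        {\<nu> s -` B \<inter> space M | s B. 0 \<le> s \<and> s \<le> t \<and> B \<in> sets borel})"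

text \<open>
  Solutions of \<open>d\<phi> = d\<nu> + b(\<phi>) dt\<close>, \<open>\<phi>(0) = \<xi>\<close>, in integral form; the noise is additive, so no
  stochastic integral occurs. On the closed chamber all cotangents in the drift are defined exactly
  at the points of \<open>\<pi> A\<^sub>\<circ>\<close>, the interior of the chamber. The library's \<^const>\<open>cot\<close> is \<open>0\<close> at its
  poles, so the condition that the integrand be defined for almost every time is made explicit.
\<close>

definition sde_solution ::
    "'a measure \<Rightarrow> (real \<Rightarrow> 'a measure) \<Rightarrow> (real ^ 'm::{finite,linorder} \<Rightarrow> (real, 'm) vec) \<Rightarrow>
     (real \<Rightarrow> 'a \<Rightarrow> (real, 'm) vec) \<Rightarrow> ('a \<Rightarrow> (real, 'm) vec) \<Rightarrow> (real \<Rightarrow> 'a \<Rightarrow> (real, 'm) vec) \<Rightarrow> bool" where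
  "sde_solution M F b \<nu> \<xi> \<phi> \<longleftrightarrow>
     (\<forall>t\<ge>0. \<phi> t \<in> borel_measurable (F t)) \<and>
     (AE \<omega> in M.
        continuous_on {0..} (\<lambda>t. \<phi> t \<omega>) \<and>
        (\<forall>t\<ge>0. \<phi> t \<omega> \<in> closed_chamber) \<and>
        (AE s in lborel. 0 \<le> s \<longrightarrow> \<phi> s \<omega> \<in> (*\<^sub>R) pi ` alcove) \<and>
        (\<forall>t\<ge>0. set_integrable lborel {0..t} (\<lambda>s. b (\<phi> s \<omega>)) \<and>
           \<phi> t \<omega> = \<xi> \<omega> + \<nu> t \<omega> + (LINT s:{0..t}|lborel. b (\<phi> s \<omega>))))"

text \<open>
  Strong existence: some solution is adapted to the augmented filtration of \<open>(\<xi>, \<nu>)\<close>. Pathwise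
  uniqueness: every solution adapted to the (possibly larger) augmentation of the given filtration
  is indistinguishable from it.
\<close>

definition unique_strong_solution ::
    "'a measure \<Rightarrow> (real \<Rightarrow> 'a measure) \<Rightarrow> (real ^ 'm::{finite,linorder} \<Rightarrow> (real, 'm) vec) \<Rightarrow>
     (real \<Rightarrow> 'a \<Rightarrow> (real, 'm) vec) \<Rightarrow> ('a \<Rightarrow> (real, 'm) vec) \<Rightarrow> bool" where
  "unique_strong_solution M F b \<nu> \<xi> \<longleftrightarrow>
     (\<exists>\<phi>. sde_solution M (\<lambda>t. augment M (generated_filtration M \<nu> \<xi> t)) b \<nu> \<xi> \<phi> \<and>
        (\<forall>\<psi>. sde_solution M (\<lambda>t. augment M (F t)) b \<nu> \<xi> \<psi> \<longrightarrow>
           (AE \<omega> in M. \<forall>t\<ge>0. \<psi> t \<omega> = \<phi> t \<omega>)))"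

end

theory Submission
  imports Defs
begin

text \<open>
  Inside the chamber the drift is a sum \<open>b = \<Sum>\<^sub>r k\<^sub>r cot (X\<^sub>r) a\<^sub>r\<close> over finitely many affine forms
  \<open>X\<^sub>r(x) = a\<^sub>r \<bullet> x + c\<^sub>r\<close>. The identity \<open>2 cot (2y) = cot y - cot (\<pi>/2 - y)\<close> makes it possible to
  choose all forms with values in \<open>[0, \<pi>/2]\<close> on the closed chamber, so that every cotangent is
  nonnegative and is singular only where its form vanishes (\<open>drift_eq_root_sum\<close>). The weights are then
  \<open>k\<^sub>0 + k\<^sub>1/2\<close>, \<open>k\<^sub>1/2\<close> and \<open>k\<^sub>2\<close>, and the bound on \<open>min(p, q)\<close> says that the first two are positive. The
  rest of the argument uses only this shape of the drift.

  Since the cotangent decreases, \<open>(b x - b y) \<bullet> (x - y) \<le> 0\<close>. The noise is additive, so the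
  difference of two solutions for the same path of the noise is absolutely continuous, and
  monotonicity keeps its norm from growing. This is uniqueness, path by path.

  For existence, fix a path \<open>w\<close> and solve the implicit Euler scheme
  \<open>y\<^sub>n\<^sub>+\<^sub>1 = y\<^sub>n + (w(t\<^sub>n\<^sub>+\<^sub>1) - w(t\<^sub>n)) + h b(y\<^sub>n\<^sub>+\<^sub>1)\<close>. Each step maximises a concave function that is \<open>-\<infinity>\<close> on
  the boundary, so the scheme stays in the open chamber. The repulsion pays for itself: the drift
  is coercive, whence the time integrals of \<open>|b|\<close> along the scheme are bounded uniformly in \<open>h\<close>
  (\<open>drift_sum_bounded\<close>), and the uniqueness computation applied to two step sizes shows that the schemes
  converge uniformly on bounded time intervals (\<open>interp_Cauchy\<close>). The limit is adapted, lies in the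
  open chamber at almost every time, and \<open>b\<close> is integrable along it (\<open>limit_path_interior\<close>).

  What is left is that the integrals of the drift along the scheme converge to the integral of the
  drift along the limit: part of the drift might concentrate on the boundary and survive as a
  singular push. Here the Brownian motion enters. Truncate the cotangents at a level \<open>L\<close>; it
  suffices that the expected truncation error tends to \<open>0\<close> as \<open>L \<rightarrow> \<infinity>\<close>, uniformly in small \<open>h\<close>
  (\<open>limit_path_equation\<close>, \<open>AE_truncation_error\<close>), hence that the repulsion collects little mass close to
  any face of the chamber (\<open>near_face_estimate\<close>). On a face where the forms in \<open>S\<close> vanish, choose a
  vector \<open>v = \<Sum>\<^sub>S q\<^sub>i a\<^sub>i\<close>, \<open>q\<^sub>i > 0\<close>, with \<open>v \<bullet> a\<^sub>j > 0\<close> on \<open>S\<close>, and let \<open>l = \<Sum>\<^sub>S q\<^sub>i X\<^sub>i\<close>. Testing the scheme with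
  \<open>exp (-\<lambda> l)\<close> bounds the mean of \<open>\<integral> exp (-\<lambda> l) (v \<bullet> b)\<close> by \<open>1/\<lambda>\<close> plus the second-order term
  \<open>\<lambda> |v|\<^sup>2\<close> times the mean of \<open>\<integral> exp (-\<lambda> l)\<close>. The second-order term is bounded, but not small. Averaging over
  \<open>\<lambda> = m, ..., n\<close> with weights proportional to \<open>1/\<lambda>\<close> turns it into a multiple of
  \<open>(1/H) \<Sum> exp (-\<lambda> l) \<le> 1/(H l)\<close> with \<open>H = 1/m + ... + 1/n\<close>; as \<open>1/l\<close> has bounded mean and the harmonic
  series diverges, it becomes small (\<open>test_function\<close>). The forms outside \<open>S\<close> contribute to \<open>v \<bullet> b\<close> with an unknown
  sign, but their cotangents are large only close to further walls, thus near a smaller face, which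
  a downward induction over the faces has already dealt with.
\<close>

section \<open>Cotangents on the first quadrant\<close>

lemma cot_nonneg: "0 < x \<Longrightarrow> x \<le> pi / 2 \<Longrightarrow> 0 \<le> cot (x::real)"
  unfolding cot_def by (intro divide_nonneg_pos cos_ge_zero sin_gt_zero) (auto intro: order_less_le_trans)

lemma cot_antimono:
  fixes x y :: real
  assumes "0 < x" "x \<le> y" "y < pi"
  shows "cot y \<le> cot x"
proof -
  have s: "0 < sin x" "0 < sin y" using assms by (auto intro: sin_gt_zero)
  have "0 \<le> sin (y - x)" using assms by (intro sin_ge_zero) auto
  then have "cos y * sin x \<le> cos x * sin y" by (simp add: sin_diff algebra_simps)
  then show ?thesis using s by (simp add: cot_def field_simps)
qed

text \<open>
  This and the next two lemmas make \<open>1/x\<close> a two-sided substitute for the cotangent near its pole.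
\<close>

lemma mult_cos_le_sin:
  fixes x :: real
  assumes "0 \<le> x" "x \<le> pi"
  shows "x * cos x \<le> sin x"
proof -
  let ?f = "\<lambda>x::real. sin x - x * cos x"
  have "?f 0 \<le> ?f x"
  proof (rule DERIV_nonneg_imp_nondecreasing[OF assms(1)])
    fix t :: real assume t: "0 \<le> t" "t \<le> x"
    have "(?f has_real_derivative t * sin t) (at t)"
      by (auto intro!: derivative_eq_intros)
    moreover have "0 \<le> t * sin t" using t assms by (intro mult_nonneg_nonneg sin_ge_zero) auto
    ultimately show "\<exists>y. (?f has_real_derivative y) (at t) \<and> 0 \<le> y" by blast
  qed
  then show ?thesis by simp
qed

lemma cot_le_inverse:
  fixes x :: real
  assumes "0 < x" "x < pi"
  shows "cot x \<le> 1 / x"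
  using mult_cos_le_sin[of x] sin_gt_zero[of x] assms by (simp add: cot_def field_simps)

lemma inverse_le_cot_plus_one:
  fixes x :: real
  assumes "0 < x" "x \<le> pi / 2"
  shows "1 / x \<le> cot x + 1"
proof (cases "x < 1")
  case False
  then have "1 / x \<le> 1" by simp
  then show ?thesis using cot_nonneg[OF assms] by linarith
next
  case True
  have s: "0 < sin x" using assms by (intro sin_gt_zero) (use pi_gt_zero in linarith)+
  have "sin x \<le> x" using assms by (intro sin_x_le_x) auto
  have c: "1 - x \<le> cos x"
  proof -
    have "sin (x/2) \<ge> 0" using assms by (intro sin_ge_zero) auto
    moreover have "sin (x/2) \<le> x/2" using assms by (intro sin_x_le_x) auto
    ultimately have "(sin (x/2))\<^sup>2 \<le> (x/2)\<^sup>2" by (intro power_mono) auto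
    moreover have "cos x = 1 - 2 * (sin (x/2))\<^sup>2" using cos_double_sin[of "x/2"] by simp
    moreover have "x^2 \<le> x" using True assms by (simp add: power2_eq_square mult_left_le)
    moreover have "(x/2)\<^sup>2 = x\<^sup>2/4" by (simp add: power_divide)
    ultimately show ?thesis using assms by linarith
  qed
  have "(1 - x) * sin x \<le> cos x * x"
    using c True s \<open>sin x \<le> x\<close> by (intro mult_mono) auto
  then have "(1 - x) / x \<le> cot x"
    using s assms by (simp add: cot_def field_simps)
  moreover have "(1 - x) / x = 1 / x - 1" using assms by (simp add: field_simps)
  ultimately show ?thesis by simp
qed

section \<open>Drifts that are sums of cotangents of affine forms\<close>

text \<open>
  A bounded polytope with nonempty interior, cut out by affine forms that are at most \<open>\<pi>/2\<close> on it.
  This upper bound makes the cotangents nonnegative, decreasing, and singular exactly on the walls.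
  Several forms may share a wall, and a form need not vanish anywhere.
\<close>

locale cot_chamber =
  fixes I :: "'i set" and a :: "'i \<Rightarrow> 'v::euclidean_space" and c k :: "'i \<Rightarrow> real" and x0 :: 'v
  assumes finite_I: "finite I"
    and k_pos: "i \<in> I \<Longrightarrow> 0 < k i"
    and x0_pos: "i \<in> I \<Longrightarrow> 0 < a i \<bullet> x0 + c i"
    and bounded_forms: "bounded {x. \<forall>i\<in>I. 0 \<le> a i \<bullet> x + c i}"
    and forms_le: "(\<And>i. i \<in> I \<Longrightarrow> 0 \<le> a i \<bullet> x + c i) \<Longrightarrow> i \<in> I \<Longrightarrow> a i \<bullet> x + c i \<le> pi / 2"
begin

definition X :: "'i \<Rightarrow> 'v \<Rightarrow> real" where "X i x = a i \<bullet> x + c i"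
definition D :: "'v set" where "D = {x. \<forall>i\<in>I. 0 < X i x}"
definition Dc :: "'v set" where "Dc = {x. \<forall>i\<in>I. 0 \<le> X i x}"
definition b :: "'v \<Rightarrow> 'v" where "b x = (\<Sum>i\<in>I. (k i * cot (X i x)) *\<^sub>R a i)"

text \<open>
  The strength of the repulsion, which dominates the drift up to a constant because all cotangents are
  nonnegative on the chamber.
\<close>

definition g :: "'v \<Rightarrow> real" where "g x = (\<Sum>i\<in>I. k i * cot (X i x))"

lemma X_diff: "X i x - X i y = a i \<bullet> (x - y)"
  by (simp add: X_def inner_diff_right)

lemma continuous_on_X [continuous_intros]:
  "continuous_on S f \<Longrightarrow> continuous_on S (\<lambda>x. X i (f x))"
  unfolding X_def by (intro continuous_intros)

lemma tendsto_X [tendsto_intros]: "(f \<longlongrightarrow> l) F \<Longrightarrow> ((\<lambda>x. X i (f x)) \<longlongrightarrow> X i l) F"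
  unfolding X_def by (intro tendsto_intros)

lemma D_subset_Dc: "D \<subseteq> Dc" by (auto simp: D_def Dc_def less_imp_le)

lemma x0_in_D: "x0 \<in> D" using x0_pos by (auto simp: D_def X_def)

lemma X_le: "x \<in> Dc \<Longrightarrow> i \<in> I \<Longrightarrow> X i x \<le> pi / 2"
  using forms_le[of x i] by (auto simp: Dc_def X_def)

lemma D_X: assumes "x \<in> D" "i \<in> I" shows "0 < X i x" "X i x \<le> pi / 2" "X i x < pi"
proof -
  show "0 < X i x" using assms by (auto simp: D_def)
  show "X i x \<le> pi / 2" using X_le D_subset_Dc assms by auto
  then show "X i x < pi" using pi_gt_zero by linarith
qed

lemma open_D: "open D"
proof -
  have "D = (\<Inter>i\<in>I. {x. 0 < X i x})" by (auto simp: D_def)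
  moreover have "open {x. 0 < X i x}" for i
    by (intro open_Collect_less continuous_intros)
  ultimately show ?thesis using finite_I by auto
qed

lemma closed_Dc: "closed Dc"
proof -
  have "Dc = (\<Inter>i\<in>I. {x. 0 \<le> X i x})" by (auto simp: Dc_def)
  moreover have "closed {x. 0 \<le> X i x}" for i
    by (intro closed_Collect_le continuous_intros)
  ultimately show ?thesis by auto
qed

lemma compact_Dc: "compact Dc"
  using closed_Dc bounded_forms by (simp add: compact_eq_bounded_closed Dc_def X_def)

lemma cot_X_nonneg: "x \<in> D \<Longrightarrow> i \<in> I \<Longrightarrow> 0 \<le> cot (X i x)"
  using D_X[of x i] by (intro cot_nonneg)

lemma g_term_nonneg: "x \<in> D \<Longrightarrow> i \<in> I \<Longrightarrow> 0 \<le> k i * cot (X i x)"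
  using cot_X_nonneg[of x i] k_pos[of i] by simp

lemma g_nonneg: "x \<in> D \<Longrightarrow> 0 \<le> g x"
  unfolding g_def by (intro sum_nonneg g_term_nonneg)

lemma g_term_le: "x \<in> D \<Longrightarrow> i \<in> I \<Longrightarrow> k i * cot (X i x) \<le> g x"
  unfolding g_def using finite_I g_term_nonneg by (intro member_le_sum) auto

lemma inner_b: "b x \<bullet> u = (\<Sum>i\<in>I. k i * cot (X i x) * (a i \<bullet> u))"
  by (simp add: b_def inner_sum_left)

lemma b_monotone:
  assumes "x \<in> D" "y \<in> D"
  shows "(b x - b y) \<bullet> (x - y) \<le> 0"
proof -
  have "(b x - b y) \<bullet> (x - y) = (\<Sum>i\<in>I. k i * ((cot (X i x) - cot (X i y)) * (X i x - X i y)))"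
    by (simp add: inner_diff_left inner_b X_diff sum_subtractf[symmetric] algebra_simps)
  also have "\<dots> \<le> 0"
  proof (intro sum_nonpos)
    fix i assume i: "i \<in> I"
    have "(cot (X i x) - cot (X i y)) * (X i x - X i y) \<le> 0"
      using cot_antimono[of "X i x" "X i y"] cot_antimono[of "X i y" "X i x"] D_X[OF assms(1) i] D_X[OF assms(2) i]
      by (cases "X i x \<le> X i y") (simp_all add: mult_nonneg_nonpos mult_nonpos_nonneg)
    then show "k i * ((cot (X i x) - cot (X i y)) * (X i x - X i y)) \<le> 0"
      by (rule mult_nonneg_nonpos[OF less_imp_le[OF k_pos[OF i]]])
  qed
  finally show ?thesis .
qed

text \<open>
  Moving towards \<open>x0\<close> increases a form that is small at \<open>x\<close> by a fixed amount. So near a wall the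
  repulsion has a component towards \<open>x0\<close> proportional to its strength, and away from the wall the
  cotangent is bounded.
\<close>

lemma b_coercive:
  obtains \<delta> C where "0 < \<delta>" "0 \<le> C" "\<And>x. x \<in> D \<Longrightarrow> b x \<bullet> (x - x0) \<le> C - \<delta> * g x"
proof -
  define \<delta> where "\<delta> = Min (insert 1 ((\<lambda>i. X i x0 / 2) ` I))"
  have fin: "finite (insert 1 ((\<lambda>i. X i x0 / 2) ` I))" using finite_I by auto
  have \<delta>: "0 < \<delta>" unfolding \<delta>_def using fin x0_in_D by (subst Min_gr_iff) (auto simp: D_def)
  have \<delta>le: "\<delta> \<le> X i x0 / 2" if "i \<in> I" for i
    unfolding \<delta>_def using fin that by (intro Min_le) auto
  define C where "C = (\<Sum>i\<in>I. k i * (cot \<delta> * (pi / 2)))"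
  have \<delta>2: "0 \<le> cot \<delta>" if "i \<in> I" for i
    using \<delta> \<delta>le[OF that] D_X[OF x0_in_D that] by (intro cot_nonneg) auto
  show ?thesis
  proof (rule that[of \<delta> C])
    show "0 \<le> C" unfolding C_def using k_pos \<delta>2 by (intro sum_nonneg mult_nonneg_nonneg) (auto intro: less_imp_le)
    fix x assume x: "x \<in> D"
    have "b x \<bullet> (x - x0) + \<delta> * g x = (\<Sum>i\<in>I. k i * (cot (X i x) * (X i x - X i x0 + \<delta>)))"
      by (simp add: inner_b g_def sum_distrib_left X_diff sum.distrib[symmetric] algebra_simps)
    also have "\<dots> \<le> C"
      unfolding C_def
    proof (intro sum_mono mult_left_mono)
      fix i assume i: "i \<in> I"
      show "0 \<le> k i" using k_pos[OF i] by simp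
      show "cot (X i x) * (X i x - X i x0 + \<delta>) \<le> cot \<delta> * (pi / 2)"
      proof (cases "X i x \<le> \<delta>")
        case True
        then have "X i x - X i x0 + \<delta> \<le> 0" using \<delta>le[OF i] by linarith
        then have "cot (X i x) * (X i x - X i x0 + \<delta>) \<le> 0"
          using cot_X_nonneg[OF x i] by (simp add: mult_nonneg_nonpos)
        also have "0 \<le> cot \<delta> * (pi / 2)" using \<delta>2[OF i] by simp
        finally show ?thesis .
      next
        case False
        have "cot (X i x) * (X i x - X i x0 + \<delta>) \<le> cot (X i x) * (pi / 2)"
          using D_X[OF x i] \<delta>le[OF i] D_X[OF x0_in_D i] cot_X_nonneg[OF x i]
          by (intro mult_left_mono) auto
        also have "\<dots> \<le> cot \<delta> * (pi / 2)"
          using False \<delta> D_X[OF x i] by (intro mult_right_mono cot_antimono) auto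
        finally show ?thesis .
      qed
    qed
    finally show "b x \<bullet> (x - x0) \<le> C - \<delta> * g x" by simp
  qed (use \<delta> in auto)
qed

text \<open>
  The added \<open>1\<close> keeps the constant positive when there are no forms, so that it can be divided by.
\<close>

definition A :: real where "A = 1 + (\<Sum>i\<in>I. norm (a i))"

lemma A_ge_1: "1 \<le> A" unfolding A_def by (simp add: sum_nonneg)
lemma A_pos: "0 < A" using A_ge_1 by linarith

lemma norm_a_le: "i \<in> I \<Longrightarrow> norm (a i) \<le> A"
  using member_le_sum[of i I "\<lambda>i. norm (a i)"] finite_I unfolding A_def by auto

lemma norm_b_le:
  assumes "x \<in> D"
  shows "norm (b x) \<le> A * g x"
  unfolding b_def g_def sum_distrib_left
proof (rule sum_norm_le)
  fix i assume i: "i \<in> I"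
  have "k i * cot (X i x) * norm (a i) \<le> k i * cot (X i x) * A"
    using norm_a_le[OF i] g_term_nonneg[OF assms i] by (rule mult_left_mono)
  then show "norm ((k i * cot (X i x)) *\<^sub>R a i) \<le> A * (k i * cot (X i x))"
    using g_term_nonneg[OF assms i] by (simp add: mult.commute)
qed

lemma sin_X_pos: "x \<in> D \<Longrightarrow> i \<in> I \<Longrightarrow> 0 < sin (X i x)"
  using D_X[of x i] by (intro sin_gt_zero)

lemma D_convex_towards_x0:
  assumes "x \<in> Dc" "0 < t" "t \<le> 1"
  shows "x + t *\<^sub>R (x0 - x) \<in> D" "\<And>i. i \<in> I \<Longrightarrow> t * X i x0 \<le> X i (x + t *\<^sub>R (x0 - x))"
proof -
  have e: "X i (x + t *\<^sub>R (x0 - x)) = (1 - t) * X i x + t * X i x0" for i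
    unfolding X_def inner_add_right inner_diff_right inner_scaleR_right by (simp add: algebra_simps)
  have n: "0 \<le> (1 - t) * X i x" if "i \<in> I" for i using assms that by (auto simp: Dc_def)
  show "t * X i x0 \<le> X i (x + t *\<^sub>R (x0 - x))" if "i \<in> I" for i unfolding e using n[OF that] by simp
  moreover have "0 < t * X i x0" if "i \<in> I" for i using assms D_X(1)[OF x0_in_D that] by simp
  ultimately show "x + t *\<^sub>R (x0 - x) \<in> D"
    unfolding D_def by (auto intro: less_le_trans)
qed

text \<open>
  The equation says that \<open>y\<close> is a critical point of
  \<open>L u = h \<Sum> k\<^sub>i ln (sin (X\<^sub>i u)) - |u - z|\<^sup>2/2\<close>, because \<open>ln \<circ> sin\<close> has derivative \<open>cot\<close>. The function \<open>L\<close> tends to \<open>-\<infinity>\<close>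
  at the walls, so its maximum is attained inside. To apply compactness of the closed chamber,
  maximise \<open>P = exp L\<close>, which extends continuously by \<open>0\<close> to the walls.
\<close>

lemma resolvent_exists:
  assumes h: "0 < h"
  shows "\<exists>y\<in>D. y = z + h *\<^sub>R b y"
proof -
  \<comment> \<open>The exponents are positive, so \<open>P\<close> vanishes wherever a form does.\<close>
  define P where "P y = (\<Prod>i\<in>I. sin (X i y) powr (k i * h)) * exp (- ((y - z) \<bullet> (y - z)) / 2)" for y
  have sn: "0 \<le> sin (X i y)" if "y \<in> Dc" "i \<in> I" for y i
    using that X_le[OF that] pi_gt_zero by (intro sin_ge_zero) (auto simp: Dc_def)
  have "continuous_on Dc P"
    unfolding P_def using sn k_pos h
    by (intro continuous_intros continuous_on_powr') auto
  moreover have "Dc \<noteq> {}" using x0_in_D D_subset_Dc by auto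
  ultimately have "\<exists>y\<in>Dc. \<forall>u\<in>Dc. P u \<le> P y"
    by (intro continuous_attains_sup compact_Dc)
  then obtain y where y: "y \<in> Dc" "\<And>u. u \<in> Dc \<Longrightarrow> P u \<le> P y" by auto
  note sp = sin_X_pos
  have Ppos: "0 < P u" if "u \<in> D" for u
    unfolding P_def
  proof (intro mult_pos_pos prod_pos)
    show "0 < sin (X i u) powr (k i * h)" if "i \<in> I" for i using sp[OF \<open>u \<in> D\<close> that] by simp
  qed simp
  have "0 < P y" using Ppos[OF x0_in_D] y(2)[of x0] x0_in_D D_subset_Dc by force
  then have "(\<Prod>i\<in>I. sin (X i y) powr (k i * h)) \<noteq> 0" unfolding P_def by auto
  then have "X i y \<noteq> 0" if "i \<in> I" for i
    using that finite_I by (auto simp: prod_zero_iff)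
  then have yD: "y \<in> D" using y(1) unfolding D_def Dc_def by (auto simp: order_less_le)
  define L where "L u = (\<Sum>i\<in>I. k i * h * ln (sin (X i u))) - (u - z) \<bullet> (u - z) / 2" for u
  have lnP: "ln (P u) = L u" if "u \<in> D" for u
  proof -
    have p: "0 < sin (X i u) powr (k i * h)" if "i \<in> I" for i
      using sp[OF \<open>u \<in> D\<close> that] by simp
    have "ln (\<Prod>i\<in>I. sin (X i u) powr (k i * h)) = (\<Sum>i\<in>I. k i * h * ln (sin (X i u)))"
      using p by (subst ln_prod) (auto simp: finite_I ln_powr intro!: sum.cong)
    moreover have "0 < (\<Prod>i\<in>I. sin (X i u) powr (k i * h))" using p by (rule prod_pos)
    ultimately show ?thesis unfolding P_def L_def by (simp add: ln_mult_pos inner_minus_left)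
  qed
  have Lmax: "L u \<le> L y" if "u \<in> D" for u
    using lnP[OF that] lnP[OF yD] Ppos[OF that] Ppos[OF yD] y(2)[of u] that D_subset_Dc
    by (metis ln_le_cancel_iff subsetD)
  have "(y - z - h *\<^sub>R b y) \<bullet> u = 0" for u
  proof -
    \<comment> \<open>The directional derivative of \<open>L\<close> vanishes at the maximum.\<close>
    have der: "((\<lambda>t. L (y + t *\<^sub>R u)) has_real_derivative
        (\<Sum>i\<in>I. k i * h * (cot (X i y) * (a i \<bullet> u))) - (y - z) \<bullet> u) (at 0)"
      unfolding L_def X_def
      using sp[OF yD]
      by (auto intro!: derivative_eq_intros sum.cong
          simp: inner_add_right cot_def X_def algebra_simps inner_commute divide_simps)
    obtain e where e: "0 < e" "ball y e \<subseteq> D" using open_D yD openE by blast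
    have mx: "\<forall>t. \<bar>0 - t\<bar> < e / (norm u + 1) \<longrightarrow> L (y + t *\<^sub>R u) \<le> L (y + 0 *\<^sub>R u)"
    proof (intro allI impI)
      fix t assume t: "\<bar>0 - t\<bar> < e / (norm u + 1)"
      have "\<bar>t\<bar> * norm u \<le> \<bar>t\<bar> * (norm u + 1)" by (intro mult_left_mono) auto
      also have "\<dots> < e" using t by (simp add: field_simps add_pos_nonneg add_nonneg_pos)
      finally have "y + t *\<^sub>R u \<in> ball y e" by (simp add: dist_norm)
      then show "L (y + t *\<^sub>R u) \<le> L (y + 0 *\<^sub>R u)" using e Lmax by auto
    qed
    have "0 < e / (norm u + 1)" using e(1) by (simp add: add_nonneg_pos)
    from DERIV_local_max[OF der this mx]
    have "(\<Sum>i\<in>I. k i * h * (cot (X i y) * (a i \<bullet> u))) - (y - z) \<bullet> u = 0" .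
    then show ?thesis
      by (simp add: inner_diff_left inner_b sum_distrib_left algebra_simps)
  qed
  from this[of "y - z - h *\<^sub>R b y"] have "y - z - h *\<^sub>R b y = 0" by simp
  then have "y = z + h *\<^sub>R b y" by (simp add: algebra_simps)
  then show ?thesis using yD by blast
qed

lemma resolvent_contraction:
  assumes "0 < h" "y \<in> D" "y = z + h *\<^sub>R b y" "y' \<in> D" "y' = z' + h *\<^sub>R b y'"
  shows "norm (y - y') \<le> norm (z - z')"
proof -
  have e: "y - y' = (z - z') + h *\<^sub>R (b y - b y')"
  proof -
    have "y - y' = (z + h *\<^sub>R b y) - (z' + h *\<^sub>R b y')" using assms(3,5) by simp
    then show ?thesis by (simp add: algebra_simps)
  qed
  have "(norm (y - y'))\<^sup>2 = ((z - z') + h *\<^sub>R (b y - b y')) \<bullet> (y - y')"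
    using e by (simp add: power2_norm_eq_inner)
  also have "\<dots> = (z - z') \<bullet> (y - y') + h * ((b y - b y') \<bullet> (y - y'))"
    by (simp add: inner_add_left)
  also have "\<dots> \<le> (z - z') \<bullet> (y - y')"
    using b_monotone[OF assms(2,4)] assms(1) by (simp add: mult_nonneg_nonpos)
  also have "\<dots> \<le> norm (z - z') * norm (y - y')" by (rule norm_cauchy_schwarz)
  finally have "norm (y - y') * norm (y - y') \<le> norm (z - z') * norm (y - y')"
    by (simp add: power2_eq_square)
  then show ?thesis by (cases "y = y'") auto
qed

text \<open>
  The resolvent \<open>(id - h b)\<^sup>-\<^sup>1\<close> of the monotone drift. It is defined on the whole space, which the
  scheme needs: the noise may push a point out of the chamber before the drift acts.
\<close>

definition J :: "real \<Rightarrow> 'v \<Rightarrow> 'v" where "J h z = (SOME y. y \<in> D \<and> y = z + h *\<^sub>R b y)"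

lemma J: assumes "0 < h" shows "J h z \<in> D" "J h z = z + h *\<^sub>R b (J h z)"
  using someI_ex[of "\<lambda>y. y \<in> D \<and> y = z + h *\<^sub>R b y"] resolvent_exists[OF assms, of z]
  unfolding J_def by blast+

lemma J_nonexpansive: "0 < h \<Longrightarrow> norm (J h z - J h z') \<le> norm (z - z')"
  using J by (intro resolvent_contraction) auto

lemma J_eq: "0 < h \<Longrightarrow> y \<in> D \<Longrightarrow> J h (y - h *\<^sub>R b y) = y"
  using resolvent_contraction[of h "J h (y - h *\<^sub>R b y)" "y - h *\<^sub>R b y" y "y - h *\<^sub>R b y"] J[of h "y - h *\<^sub>R b y"]
  by simp

lemma continuous_on_J: "0 < h \<Longrightarrow> continuous_on S (J h)"
  by (intro lipschitz_on_continuous_on[of 1] lipschitz_onI)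
    (auto simp: dist_norm J_nonexpansive)

lemma J_close_on_D: "0 < h \<Longrightarrow> y \<in> D \<Longrightarrow> norm (J h y - y) \<le> h * norm (b y)"
  using J_nonexpansive[of h y "y - h *\<^sub>R b y"] by (simp add: J_eq)

text \<open>
  On the open chamber \<open>J h\<close> moves a point \<open>y\<close> by at most \<open>h |b y|\<close>, but \<open>b\<close> is unbounded. Shifting the
  point a fixed small distance towards \<open>x0\<close> gives a bound on \<open>b\<close>, and the shift costs little because
  \<open>J h\<close> is nonexpansive.
\<close>

lemma J_uniformly_close:
  assumes "0 < e"
  obtains h0 where "0 < h0" "\<And>h z. 0 < h \<Longrightarrow> h < h0 \<Longrightarrow> z \<in> Dc \<Longrightarrow> norm (J h z - z) \<le> e"
proof -
  obtain R where R: "0 < R" "\<And>x. x \<in> Dc \<Longrightarrow> norm x \<le> R"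
    using compact_imp_bounded[OF compact_Dc] bounded_pos by blast
  \<comment> \<open>The relative size of the shift towards \<open>x0\<close>. It moves a point by at most \<open>2 R t \<le> e/4\<close>, and this
    distance occurs twice in the final estimate.\<close>
  define t where "t = min 1 (e / (8 * R))"
  have t: "0 < t" "t \<le> 1" "t * (8 * R) \<le> e"
    using assms R by (auto simp: t_def min_def field_simps)
  define B where "B = A * (\<Sum>i\<in>I. k i * cot (t * X i x0)) + 1"
  have Bb: "norm (b (z + t *\<^sub>R (x0 - z))) \<le> B" if z: "z \<in> Dc" for z
  proof -
    note d = D_convex_towards_x0[OF z t(1,2)]
    have "g (z + t *\<^sub>R (x0 - z)) \<le> (\<Sum>i\<in>I. k i * cot (t * X i x0))"
      unfolding g_def
      using d(2) t x0_in_D D_X[OF d(1)] k_pos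
      by (intro sum_mono mult_left_mono cot_antimono) (auto intro: less_imp_le simp: D_def)
    then have "A * g (z + t *\<^sub>R (x0 - z)) \<le> B" unfolding B_def using A_pos by (simp add: add_increasing2)
    then show ?thesis using norm_b_le[OF d(1)] by linarith
  qed
  have Bpos: "0 < B"
  proof -
    have "0 \<le> (\<Sum>i\<in>I. k i * cot (t * X i x0))"
    proof (intro sum_nonneg mult_nonneg_nonneg cot_nonneg)
      fix i assume i: "i \<in> I"
      show "0 \<le> k i" using k_pos[OF i] by simp
      show "0 < t * X i x0" using t x0_in_D i by (auto simp: D_def)
      have "t * X i x0 \<le> 1 * X i x0" using t x0_in_D i by (intro mult_right_mono) (auto simp: D_def less_imp_le)
      then show "t * X i x0 \<le> pi / 2" using D_X[OF x0_in_D i] by linarith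
    qed
    then show ?thesis unfolding B_def using A_pos by (simp add: add_nonneg_pos)
  qed
  show ?thesis
  proof (rule that[of "e / (2 * B)"])
    show "0 < e / (2 * B)" using Bpos assms by simp
    fix h z assume h: "0 < h" "h < e / (2 * B)" and z: "z \<in> Dc"
    let ?u = "z + t *\<^sub>R (x0 - z)"
    have uz: "norm (?u - z) \<le> t * (2 * R)"
      using t R(2)[OF z] R(2)[of x0] x0_in_D D_subset_Dc norm_triangle_ineq4[of x0 z]
      by (auto intro!: mult_left_mono)
    have "norm (J h z - z) \<le> norm (J h z - J h ?u) + norm (J h ?u - ?u) + norm (?u - z)"
      using norm_triangle_ineq[of "J h z - J h ?u" "J h ?u - ?u"]
        norm_triangle_ineq[of "J h z - J h ?u + (J h ?u - ?u)" "?u - z"] by simp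
    also have "\<dots> \<le> norm (?u - z) + h * norm (b ?u) + norm (?u - z)"
      using J_nonexpansive[OF h(1), of z ?u] J_close_on_D[OF h(1) D_convex_towards_x0(1)[OF z t(1,2)]]
      by (simp add: norm_minus_commute)
    also have "\<dots> \<le> t * (2*R) + h * B + t * (2 * R)"
      using uz Bb[OF z] h by (intro add_mono mult_left_mono) auto
    also have "\<dots> \<le> e" using t(3) h Bpos by (simp add: field_simps)
    finally show "norm (J h z - z) \<le> e" .
  qed
qed

end

section \<open>Indefinite integrals and step functions\<close>

text \<open>
  The product rule for \<open>|F|\<^sup>2\<close>, where \<open>F\<close> is the indefinite integral of \<open>f\<close>. For integrable \<open>f\<close> it is
  Fubini's theorem: the square \<open>[0,t]\<^sup>2\<close> is the union of two triangles that carry the same integral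
  and meet in a null set.
\<close>

lemma square_norm_integral:
  fixes f :: "real \<Rightarrow> 'v::euclidean_space"
  assumes f: "set_integrable lborel {0..t} f"
  shows "set_integrable lborel {0..t} (\<lambda>s. f s \<bullet> (LINT r:{0..s}|lborel. f r))"
    and "(norm (LINT s:{0..t}|lborel. f s))\<^sup>2 = 2 * (LINT s:{0..t}|lborel. f s \<bullet> (LINT r:{0..s}|lborel. f r))"
proof -
  define F where "F = (\<lambda>s. indicator {0..t} s *\<^sub>R f s)"
  have F: "integrable lborel F" using f unfolding F_def set_integrable_def .
  have [measurable]: "F \<in> borel_measurable lborel" using F by (rule borel_measurable_integrable)
  let ?P = "lborel \<Otimes>\<^sub>M (lborel :: real measure)"
  have prod: "integrable ?P (\<lambda>(s, r). norm (F s) * norm (F r))"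
    by (rule lborel_pair.Fubini_integrable) (use F in auto)
  have bound: "integrable ?P (\<lambda>(s, r). h s r *\<^sub>R (F s \<bullet> F r))"
    if [measurable]: "case_prod h \<in> borel_measurable ?P" and "\<And>s r. \<bar>h s r\<bar> \<le> 1" for h :: "real \<Rightarrow> real \<Rightarrow> real"
  proof (rule Bochner_Integration.integrable_bound[OF prod])
    show "AE x in ?P. norm (case x of (s, r) \<Rightarrow> h s r *\<^sub>R (F s \<bullet> F r)) \<le> norm (case x of (s, r) \<Rightarrow> norm (F s) * norm (F r))"
    proof (intro AE_I2, clarsimp simp: abs_mult)
      fix s r
      have "\<bar>h s r\<bar> * \<bar>F s \<bullet> F r\<bar> \<le> 1 * (norm (F s) * norm (F r))"
        using that(2) Cauchy_Schwarz_ineq2 by (intro mult_mono) auto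
      then show "\<bar>h s r\<bar> * \<bar>F s \<bullet> F r\<bar> \<le> norm (F s) * norm (F r)" by simp
    qed
  qed measurable
  have [measurable]: "(\<lambda>x. indicator {..fst x} (snd x) :: real) \<in> borel_measurable ?P"
    unfolding indicator_def by (simp only: atMost_iff) measurable
  have [measurable]: "(\<lambda>x. indicator {..snd x} (fst x) :: real) \<in> borel_measurable ?P"
    unfolding indicator_def by (simp only: atMost_iff) measurable
  have m1: "(\<lambda>(s, r). indicator {..s} r :: real) \<in> borel_measurable ?P"
    and m2: "(\<lambda>(s, r). indicator {..r} s :: real) \<in> borel_measurable ?P"
    by (simp_all add: case_prod_beta')
  note b1 = bound[OF m1] and b2 = bound[OF m2]
  have inner: "(\<integral>r. indicator {..s} r *\<^sub>R (F s \<bullet> F r) \<partial>lborel) = indicator {0..t} s *\<^sub>R (f s \<bullet> (LINT r:{0..s}|lborel. f r))" for s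
  proof (cases "s \<in> {0..t}")
    case True
    have "(\<integral>r. indicator {..s} r *\<^sub>R (F s \<bullet> F r) \<partial>lborel) = (\<integral>r. F s \<bullet> (indicator {..s} r *\<^sub>R F r) \<partial>lborel)"
      by simp
    also have "\<dots> = F s \<bullet> (\<integral>r. indicator {..s} r *\<^sub>R F r \<partial>lborel)"
      using F by (intro integral_inner_right integrable_mult_indicator) auto
    also have "(\<integral>r. indicator {..s} r *\<^sub>R F r \<partial>lborel) = (LINT r:{0..s}|lborel. f r)"
      unfolding set_lebesgue_integral_def F_def using True
      by (intro Bochner_Integration.integral_cong) (auto simp: indicator_def)
    finally show ?thesis using True by (simp add: F_def)
  qed (simp add: F_def)
  have inner2: "(\<integral>s. indicator {..r} s *\<^sub>R (F s \<bullet> F r) \<partial>lborel) = indicator {0..t} r *\<^sub>R (f r \<bullet> (LINT s:{0..r}|lborel. f s))" for r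
    using inner[of r] by (simp add: inner_commute)
  have "integrable lborel (\<lambda>s. \<integral>r. indicator {..s} r *\<^sub>R (F s \<bullet> F r) \<partial>lborel)"
    using lborel_pair.integrable_fst[OF b1] by simp
  then show "set_integrable lborel {0..t} (\<lambda>s. f s \<bullet> (LINT r:{0..s}|lborel. f r))"
    unfolding inner set_integrable_def .
  have i1: "(\<integral>x. (case x of (s, r) \<Rightarrow> indicator {..s} r *\<^sub>R (F s \<bullet> F r)) \<partial>?P) = (LINT s:{0..t}|lborel. f s \<bullet> (LINT r:{0..s}|lborel. f r))"
    unfolding set_lebesgue_integral_def inner[symmetric, unfolded set_lebesgue_integral_def]
    by (subst lborel_pair.integral_fst'[symmetric]) (use b1 in auto)
  have i2: "(\<integral>x. (case x of (s, r) \<Rightarrow> indicator {..r} s *\<^sub>R (F s \<bullet> F r)) \<partial>?P) = (LINT s:{0..t}|lborel. f s \<bullet> (LINT r:{0..s}|lborel. f r))"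
    unfolding set_lebesgue_integral_def inner2[symmetric, unfolded set_lebesgue_integral_def]
    by (subst lborel_pair.integral_snd[symmetric]) (use b2 in auto)
  have b0: "integrable ?P (\<lambda>(s, r). F s \<bullet> F r)" using bound[of "\<lambda>_ _. 1"] by simp
  have "(norm (LINT s:{0..t}|lborel. f s))\<^sup>2 = (\<integral>s. F s \<partial>lborel) \<bullet> (\<integral>r. F r \<partial>lborel)"
    by (simp add: power2_norm_eq_inner F_def set_lebesgue_integral_def)
  also have "\<dots> = (\<integral>s. (\<integral>r. F s \<bullet> F r \<partial>lborel) \<partial>lborel)"
    using F by simp
  also have "\<dots> = (\<integral>x. (case x of (s, r) \<Rightarrow> F s \<bullet> F r) \<partial>?P)"
    by (subst lborel_pair.integral_fst'[symmetric]) (use b0 in auto)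
  also have "\<dots> = (\<integral>x. (case x of (s, r) \<Rightarrow> indicator {..s} r *\<^sub>R (F s \<bullet> F r)) + (case x of (s, r) \<Rightarrow> indicator {..r} s *\<^sub>R (F s \<bullet> F r)) \<partial>?P)"
  proof (rule integral_cong_AE)
    have m: "{x \<in> space ?P. fst x \<noteq> snd x} \<in> sets ?P" by measurable
    have "AE r in lborel. s \<noteq> r" for s :: real
      using AE_lborel_singleton[of s] by eventually_elim auto
    then have "AE s in lborel. AE r in lborel. s \<noteq> (r::real)" by simp
    then have "AE x in ?P. fst x \<noteq> snd x"
      using lborel_pair.AE_pair_iff[of "\<lambda>s r. s \<noteq> r"] m by blast
    then show "AE x in ?P. (case x of (s, r) \<Rightarrow> F s \<bullet> F r) = (case x of (s, r) \<Rightarrow> indicator {..s} r *\<^sub>R (F s \<bullet> F r)) + (case x of (s, r) \<Rightarrow> indicator {..r} s *\<^sub>R (F s \<bullet> F r))"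
      by eventually_elim (auto simp: indicator_def split: prod.splits)
  qed (use b0 b1 b2 in \<open>auto intro: borel_measurable_integrable\<close>)
  also have "\<dots> = 2 * (LINT s:{0..t}|lborel. f s \<bullet> (LINT r:{0..s}|lborel. f r))"
    using i1 i2 b1 b2 by (subst Bochner_Integration.integral_add) auto
  finally show "(norm (LINT s:{0..t}|lborel. f s))\<^sup>2 = 2 * (LINT s:{0..t}|lborel. f s \<bullet> (LINT r:{0..s}|lborel. f r))" .
qed

text \<open>
  The ceiling gives the cell \<open>(h n, h (n + 1)]\<close> the value at its right end, where an implicit scheme
  evaluates its drift. The one exceptional point is \<open>0\<close>, which belongs to no cell.
\<close>

lemma has_bochner_integral_step:
  fixes u :: "nat \<Rightarrow> 'b::{banach, second_countable_topology}" and h :: real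
  assumes h: "0 < h"
  shows "has_bochner_integral lborel (\<lambda>s. indicator {0..h * real N} s *\<^sub>R u (nat \<lceil>s / h\<rceil>)) (\<Sum>j<N. h *\<^sub>R u (Suc j))"
proof (induction N)
  case 0
  have "has_bochner_integral lborel (\<lambda>s::real. indicator {0} s *\<^sub>R u 0) ((0::real) *\<^sub>R u 0)"
    using has_bochner_integral_real_indicator[of "{0::real}" lborel]
    by (intro has_bochner_integral_scaleR_left) simp
  moreover have "indicator {0..h * real 0} s *\<^sub>R u (nat \<lceil>s / h\<rceil>) = indicator {0} s *\<^sub>R u 0" for s
    by (cases "s = 0") (auto simp: indicator_def)
  ultimately show ?case by (simp del: mult_zero_right of_nat_0)
next
  case (Suc N)
  let ?C = "{h * real N<..h * real (Suc N)}"
  have "has_bochner_integral lborel (indicator ?C :: real \<Rightarrow> real) h"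
    using has_bochner_integral_real_indicator[of ?C lborel] h by (simp add: field_simps)
  then have "has_bochner_integral lborel (\<lambda>s. indicator {0..h * real N} s *\<^sub>R u (nat \<lceil>s / h\<rceil>) + indicator ?C s *\<^sub>R u (Suc N))
      ((\<Sum>j<N. h *\<^sub>R u (Suc j)) + h *\<^sub>R u (Suc N))"
    by (intro has_bochner_integral_add Suc.IH has_bochner_integral_scaleR_left)
  moreover have "indicator {0..h * real N} s *\<^sub>R u (nat \<lceil>s / h\<rceil>) + indicator ?C s *\<^sub>R u (Suc N)
      = indicator {0..h * real (Suc N)} s *\<^sub>R u (nat \<lceil>s / h\<rceil>)" for s
  proof (cases "s \<in> ?C")
    case True
    then have "\<lceil>s / h\<rceil> = int (Suc N)"
      using h by (intro ceiling_unique) (auto simp: field_simps)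
    moreover have "0 \<le> s" using True h by (auto intro: order_trans[OF _ less_imp_le, of _ "h * real N"])
    ultimately show ?thesis using True by (simp add: indicator_def del: of_nat_Suc)
  next
    case False
    then have "s \<in> {0..h * real N} \<longleftrightarrow> s \<in> {0..h * real (Suc N)}"
      using h by (auto simp: algebra_simps)
    then show ?thesis using False by (simp add: indicator_def)
  qed
  ultimately show ?case by (simp add: add.commute)
qed

lemma step_integral:
  fixes u :: "nat \<Rightarrow> 'b::{banach, second_countable_topology}" and h :: real
  assumes h: "0 < h"
  shows "set_integrable lborel {0..h * real N} (\<lambda>s. u (nat \<lceil>s / h\<rceil>))"
    and "(LINT s:{0..h * real N}|lborel. u (nat \<lceil>s / h\<rceil>)) = (\<Sum>j<N. h *\<^sub>R u (Suc j))"
  using has_bochner_integral_step[OF h, of N u]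
  by (auto simp: set_integrable_def set_lebesgue_integral_def has_bochner_integral_iff)

lemma step_set_integrable:
  fixes u :: "nat \<Rightarrow> 'b::{banach, second_countable_topology}" and h :: real
  assumes h: "0 < h"
  shows "set_integrable lborel {0..t} (\<lambda>s. u (nat \<lceil>s / h\<rceil>))"
proof (rule set_integrable_subset[OF step_integral(1)[OF h, of "nat \<lceil>t / h\<rceil>"]])
  have "t \<le> h * real (nat \<lceil>t / h\<rceil>)"
    using h real_nat_ceiling_ge[of "t / h"] by (simp add: field_simps)
  then show "{0..t} \<subseteq> {0..h * real (nat \<lceil>t / h\<rceil>)}" by auto
qed auto

lemma step_integral_cell:
  fixes u :: "nat \<Rightarrow> 'b::{banach, second_countable_topology}" and h :: real
  assumes h: "0 < h" and s: "h * real n \<le> s" "s \<le> h * real (Suc n)"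
  shows "(LINT s:{0..s}|lborel. u (nat \<lceil>s / h\<rceil>)) = (\<Sum>j<n. h *\<^sub>R u (Suc j)) + (s - h * real n) *\<^sub>R u (Suc n)"
proof -
  let ?f = "\<lambda>s. u (nat \<lceil>s / h\<rceil>)"
  let ?a = "h * real n"
  have a0: "0 \<le> ?a" using h by simp
  have "{0..s} = {0..?a} \<union> {?a<..s}" using s a0 by auto
  then have "(LINT s:{0..s}|lborel. ?f s) = (LINT s:{0..?a}|lborel. ?f s) + (LINT s:{?a<..s}|lborel. ?f s)"
    using step_set_integrable[OF h, of s u] a0
    by (subst set_integral_Un[symmetric]) (auto intro: set_integrable_subset)
  also have "(LINT s:{?a<..s}|lborel. ?f s) = (LINT r:{?a<..s}|lborel. u (Suc n))"
  proof (rule set_lebesgue_integral_cong)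
    show "\<forall>r. r \<in> {?a<..s} \<longrightarrow> ?f r = u (Suc n)"
    proof (intro allI impI)
      fix r assume "r \<in> {?a<..s}"
      then have "\<lceil>r / h\<rceil> = int (Suc n)"
        using h s by (intro ceiling_unique) (auto simp: field_simps)
      then show "?f r = u (Suc n)" by (simp only: nat_int)
    qed
  qed auto
  also have "\<dots> = (s - ?a) *\<^sub>R u (Suc n)"
    using s by (simp add: set_lebesgue_integral_def)
  finally show ?thesis using step_integral(2)[OF h, of n u] by simp
qed

lemma continuous_on_set_integral:
  fixes f :: "real \<Rightarrow> 'v::euclidean_space"
  assumes f: "set_integrable lborel {0..T} f"
  shows "continuous_on {0..T} (\<lambda>t. LINT s:{0..t}|lborel. f s)"
proof -
  have fi: "f integrable_on {0..T}" by (rule set_borel_integral_eq_integral(1)[OF f])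
  have "(LINT s:{0..t}|lborel. f s) = integral {0..t} f" if "t \<in> {0..T}" for t
    using that by (intro set_borel_integral_eq_integral(2) set_integrable_subset[OF f]) auto
  then show ?thesis
    by (intro continuous_on_eq[OF indefinite_integral_continuous_1[OF fi]]) simp
qed

lemma ceiling_cell:
  fixes s h :: real
  assumes "0 < h" "0 < s"
  obtains n where "nat \<lceil>s / h\<rceil> = Suc n" "h * real n \<le> s" "s \<le> h * real (Suc n)"
proof -
  have p: "0 < s / h" using assms by simp
  then have c: "0 < \<lceil>s / h\<rceil>" by simp
  define n where "n = nat (\<lceil>s / h\<rceil> - 1)"
  have n: "real n = of_int \<lceil>s / h\<rceil> - 1" using c by (simp add: n_def)
  show ?thesis
  proof (rule that[of n])
    show "nat \<lceil>s / h\<rceil> = Suc n" using c by (simp add: n_def nat_diff_distrib)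
    have "real n \<le> s / h" "s / h \<le> real (Suc n)" using n ceiling_correct[of "s / h"] by auto
    then show "h * real n \<le> s" "s \<le> h * real (Suc n)" using assms by (auto simp: field_simps)
  qed
qed

lemma floor_cell:
  fixes s h :: real
  assumes "0 < h" "0 \<le> s"
  shows "h * real (nat \<lfloor>s / h\<rfloor>) \<le> s" "s \<le> h * real (Suc (nat \<lfloor>s / h\<rfloor>))"
proof -
  have "0 \<le> s / h" using assms by simp
  then have "real (nat \<lfloor>s / h\<rfloor>) = of_int \<lfloor>s / h\<rfloor>" by simp
  then have "real (nat \<lfloor>s / h\<rfloor>) \<le> s / h" "s / h \<le> real (Suc (nat \<lfloor>s / h\<rfloor>))"
    using floor_correct[of "s / h"] by linarith+
  then have "h * real (nat \<lfloor>s / h\<rfloor>) \<le> h * (s / h)" "h * (s / h) \<le> h * real (Suc (nat \<lfloor>s / h\<rfloor>))"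
    using assms by (intro mult_left_mono; simp)+
  then show "h * real (nat \<lfloor>s / h\<rfloor>) \<le> s" "s \<le> h * real (Suc (nat \<lfloor>s / h\<rfloor>))"
    using assms by simp_all
qed

lemma polynomial_function_lipschitz:
  fixes p :: "real \<Rightarrow> 'v::euclidean_space"
  assumes "polynomial_function p"
  obtains L where "0 \<le> L" "\<And>s t. s \<in> {0..T} \<Longrightarrow> t \<in> {0..T} \<Longrightarrow> norm (p s - p t) \<le> L * \<bar>s - t\<bar>"
proof -
  obtain p' where p': "polynomial_function p'" "\<And>x. (p has_vector_derivative p' x) (at x)"
    using has_vector_derivative_polynomial_function[OF assms] by blast
  have "bounded (p' ` {0..T})"
    by (intro compact_imp_bounded compact_continuous_image continuous_on_polymonial_function p') auto
  then obtain L where L: "0 < L" "\<And>x. x \<in> {0..T} \<Longrightarrow> norm (p' x) \<le> L"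
    unfolding bounded_pos by auto
  show ?thesis
  proof (rule that[of L])
    fix s t assume st: "s \<in> {0..T}" "t \<in> {0..T}"
    have "norm (p s - p t) \<le> L * norm (s - t)"
    proof (rule differentiable_bound[where S = "{0..T}" and f' = "\<lambda>x h. h *\<^sub>R p' x"])
      show "(p has_derivative (\<lambda>h. h *\<^sub>R p' x)) (at x within {0..T})" for x
        using p'(2)[of x] unfolding has_vector_derivative_def by (rule has_derivative_at_withinI)
      show "onorm (\<lambda>h. h *\<^sub>R p' x) \<le> L" if "x \<in> {0..T}" for x
        using L(2)[OF that] by (intro onorm_le) (simp add: mult.commute[of L] mult_left_mono)
    qed (use st in auto)
    then show "norm (p s - p t) \<le> L * \<bar>s - t\<bar>" by simp
  qed (use L in auto)
qed

section \<open>The implicit Euler scheme along a continuous path\<close>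

context cot_chamber
begin

primrec Y :: "real \<Rightarrow> (real \<Rightarrow> 'v) \<Rightarrow> 'v \<Rightarrow> nat \<Rightarrow> 'v" where
  "Y h w x 0 = x"
| "Y h w x (Suc n) = J h (Y h w x n + (w (h * real (Suc n)) - w (h * real n)))"

declare Y.simps(2) [simp del]

lemma Y_in_D: "0 < h \<Longrightarrow> Y h w x (Suc n) \<in> D"
  by (simp add: Y.simps(2) J(1))

lemma Y_in_Dc: "0 < h \<Longrightarrow> x \<in> Dc \<Longrightarrow> Y h w x n \<in> Dc"
  using Y_in_D[of h w x] D_subset_Dc by (cases n) auto

lemma Y_step:
  "0 < h \<Longrightarrow> Y h w x (Suc n) = Y h w x n + (w (h * real (Suc n)) - w (h * real n)) + h *\<^sub>R b (Y h w x (Suc n))"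
  unfolding Y.simps(2) by (rule J(2))

lemma Y_eq_sum:
  "0 < h \<Longrightarrow> Y h w x n = x + w (h * real n) - w 0 + (\<Sum>j<n. h *\<^sub>R b (Y h w x (Suc j)))"
proof (induction n)
  case (Suc n)
  have "Y h w x (Suc n) = Y h w x n + (w (h * real (Suc n)) - w (h * real n)) + h *\<^sub>R b (Y h w x (Suc n))"
    using Suc.prems by (rule Y_step)
  also have "Y h w x n = x + w (h * real n) - w 0 + (\<Sum>j<n. h *\<^sub>R b (Y h w x (Suc j)))"
    using Suc by simp
  finally show ?case by (rule trans) simp
qed simp

lemma Dc_bound: obtains R where "0 < R" "\<And>x. x \<in> Dc \<Longrightarrow> norm x \<le> R"
  using compact_imp_bounded[OF compact_Dc] bounded_pos by blast

text \<open>
  The energy estimate for \<open>|y\<^sub>n - x0|\<^sup>2\<close> along a path that may have unbounded variation. Replace the path by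
  a uniformly close polynomial \<open>p\<close>, and take the energy of \<open>y\<^sub>n - x0 - (w - p)\<close>, whose increments involve
  only \<open>p\<close> and the drift. The correction \<open>w - p\<close> pairs with the drift to at most \<open>|w - p| |b| \<le> e A g\<close>,
  which half of the coercivity absorbs.
\<close>

lemma drift_sum_bounded:
  assumes w: "continuous_on {0..T} w" and x: "x \<in> Dc"
  obtains C where "0 \<le> C"
    "\<And>h N. 0 < h \<Longrightarrow> h \<le> 1 \<Longrightarrow> h * real N \<le> T \<Longrightarrow> (\<Sum>j<N. h * g (Y h w x (Suc j))) \<le> C"
proof -
  obtain \<delta> C0 where \<delta>: "0 < \<delta>" "0 \<le> C0" "\<And>x. x \<in> D \<Longrightarrow> b x \<bullet> (x - x0) \<le> C0 - \<delta> * g x"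
    using b_coercive by blast
  obtain R where R: "0 < R" "\<And>x. x \<in> Dc \<Longrightarrow> norm x \<le> R" using Dc_bound by blast
  \<comment> \<open>Chosen so that \<open>e A g\<close> is half of the coercivity term \<open>\<delta> g\<close>.\<close>
  define e where "e = \<delta> / (2 * A)"
  have e: "0 < e" "A * e = \<delta> / 2" using \<delta> A_pos by (auto simp: e_def)
  obtain p where p: "polynomial_function p" "\<And>t. t \<in> {0..T} \<Longrightarrow> norm (w t - p t) < e"
    using Stone_Weierstrass_polynomial_function[OF _ w e(1)] by auto
  obtain L where L: "0 \<le> L" "\<And>s t. s \<in> {0..T} \<Longrightarrow> t \<in> {0..T} \<Longrightarrow> norm (p s - p t) \<le> L * \<bar>s - t\<bar>"
    using polynomial_function_lipschitz[OF p(1)] by blast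
  define R' where "R' = 2 * R + e"
  define K where "K = 2 * R' * L + L\<^sup>2 + 2 * C0"
  have Kpos: "0 \<le> K" using R e L \<delta> by (simp add: K_def R'_def)
  show ?thesis
  proof (rule that[of "(R'\<^sup>2 + K * \<bar>T\<bar>) / \<delta>"])
    show "0 \<le> (R'\<^sup>2 + K * \<bar>T\<bar>) / \<delta>" using Kpos \<delta> by simp
    fix h N assume h: "0 < h" "h \<le> 1" and N: "h * real N \<le> T"
    define V where "V n = Y h w x n - x0 - (w (h * real n) - p (h * real n))" for n
    have inT: "h * real n \<in> {0..T}" if "n \<le> N" for n
    proof -
      have "h * real n \<le> h * real N" using that h by (intro mult_left_mono) auto
      then have "h * real n \<le> T" using N by linarith
      then show ?thesis using h by simp
    qed
    have V_le: "norm (V n) \<le> R'" if "n \<le> N" for n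
    proof -
      have "norm (V n) \<le> norm (Y h w x n) + norm x0 + norm (w (h * real n) - p (h * real n))"
        unfolding V_def using norm_triangle_ineq4[of "Y h w x n - x0" "w (h * real n) - p (h * real n)"]
          norm_triangle_ineq4[of "Y h w x n" x0] by linarith
      also have "\<dots> \<le> R + R + e"
        using R(2)[OF Y_in_Dc[OF h(1) x]] R(2)[of x0] x0_in_D D_subset_Dc p(2)[OF inT[OF that]]
        by (intro add_mono) (auto intro: less_imp_le)
      finally show ?thesis by (simp add: R'_def)
    qed
    have step: "\<delta> * (h * g (Y h w x (Suc n))) \<le> (norm (V n))\<^sup>2 - (norm (V (Suc n)))\<^sup>2 + K * h" if n: "n < N" for n
    proof -
      let ?y = "Y h w x (Suc n)" and ?d = "p (h * real (Suc n)) - p (h * real n)"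
      let ?q = "w (h * real (Suc n)) - p (h * real (Suc n))"
      have yD: "?y \<in> D" using Y_in_D h by auto
      have Veq: "V (Suc n) = V n + ?d + h *\<^sub>R b ?y"
        unfolding V_def using Y_step[OF h(1), of w x n] by (simp add: algebra_simps)
      have "norm (?d) \<le> L * \<bar>h * real (Suc n) - h * real n\<bar>"
        using n by (intro L inT) auto
      then have dn: "norm ?d \<le> L * h" using h by (simp add: algebra_simps)
      have "(norm (V n + ?d))\<^sup>2 \<le> (norm (V n) + norm ?d)\<^sup>2"
        by (intro power_mono norm_triangle_ineq) auto
      also have "\<dots> = (norm (V n))\<^sup>2 + 2 * norm (V n) * norm ?d + (norm ?d)\<^sup>2"
        by (simp add: power2_sum algebra_simps)
      also have "\<dots> \<le> (norm (V n))\<^sup>2 + 2 * R' * (L * h) + (L * h)\<^sup>2"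
        using V_le[of n] n dn L h R e
        by (intro add_mono mult_mono power_mono) (auto simp: R'_def)
      also have "(L * h)\<^sup>2 \<le> L\<^sup>2 * h"
        unfolding power_mult_distrib using h by (intro mult_left_mono) (simp_all add: power2_eq_square mult_left_le)
      finally have 1: "(norm (V n + ?d))\<^sup>2 \<le> (norm (V n))\<^sup>2 + 2 * R' * L * h + L\<^sup>2 * h" by simp
      have "V n + ?d = V (Suc n) - h *\<^sub>R b ?y" using Veq by simp
      then have "(norm (V n + ?d))\<^sup>2 = (norm (V (Suc n)))\<^sup>2 - 2 * (h * (b ?y \<bullet> V (Suc n))) + (norm (h *\<^sub>R b ?y))\<^sup>2"
        by (simp only: power2_norm_eq_inner) (simp add: inner_diff_left inner_diff_right inner_commute algebra_simps)
      then have 2: "(norm (V (Suc n)))\<^sup>2 \<le> (norm (V n + ?d))\<^sup>2 + 2 * (h * (b ?y \<bullet> V (Suc n)))"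
        by simp
      have "b ?y \<bullet> V (Suc n) = b ?y \<bullet> (?y - x0) - b ?y \<bullet> ?q"
        by (simp add: V_def inner_diff_right)
      also have "\<dots> \<le> (C0 - \<delta> * g ?y) + norm (b ?y) * norm ?q"
        using \<delta>(3)[OF yD] norm_cauchy_schwarz[of "- b ?y" ?q] by simp
      also have "norm (b ?y) * norm ?q \<le> (A * g ?y) * e"
        using norm_b_le[OF yD] p(2)[OF inT[of "Suc n"]] n A_pos g_nonneg[OF yD]
        by (intro mult_mono) (auto intro: less_imp_le)
      also have "(A * g ?y) * e = \<delta> / 2 * g ?y" using e(2) by (metis mult.assoc mult.commute)
      finally have "b ?y \<bullet> V (Suc n) \<le> C0 - \<delta> / 2 * g ?y" by simp
      then have "h * (b ?y \<bullet> V (Suc n)) \<le> h * (C0 - \<delta> / 2 * g ?y)" using h by (intro mult_left_mono) auto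
      then show ?thesis using 1 2 by (simp add: K_def algebra_simps)
    qed
    have "\<delta> * (\<Sum>j<N. h * g (Y h w x (Suc j))) = (\<Sum>j<N. \<delta> * (h * g (Y h w x (Suc j))))"
      by (simp add: sum_distrib_left)
    also have "\<dots> \<le> (\<Sum>j<N. (norm (V j))\<^sup>2 - (norm (V (Suc j)))\<^sup>2 + K * h)"
      by (intro sum_mono step) auto
    also have "\<dots> = (norm (V 0))\<^sup>2 - (norm (V N))\<^sup>2 + K * (h * real N)"
        using sum_lessThan_telescope'[of "\<lambda>j. (norm (V j))\<^sup>2" N]
      by (simp add: sum.distrib)
    also have "\<dots> \<le> R'\<^sup>2 + K * \<bar>T\<bar>"
    proof -
      have "(norm (V 0))\<^sup>2 \<le> R'\<^sup>2" using V_le[of 0] by (intro power_mono) auto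
      moreover have "K * (h * real N) \<le> K * \<bar>T\<bar>" using Kpos N by (intro mult_left_mono) auto
      moreover have "0 \<le> (norm (V N))\<^sup>2" by simp
      ultimately show ?thesis by linarith
    qed
    finally show "(\<Sum>j<N. h * g (Y h w x (Suc j))) \<le> (R'\<^sup>2 + K * \<bar>T\<bar>) / \<delta>"
      using \<delta> by (simp add: field_simps)
  qed
qed

end

section \<open>Truncated cotangents\<close>

text \<open>
  The value at \<open>0\<close> is chosen such that the truncation is continuous on \<open>[0, \<pi>/2]\<close> although the
  cotangent has a pole there; this is what makes it pass to limits on the closed chamber.
\<close>

definition tcot :: "real \<Rightarrow> real \<Rightarrow> real" where
  "tcot L x = (if x \<le> 0 then L else min (cot x) L)"

lemma tendsto_tcot:
  assumes "u \<longlonglongrightarrow> l" and u: "\<And>n. 0 < u n \<and> u n \<le> pi / 2"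
  shows "(\<lambda>n. tcot L (u n)) \<longlonglongrightarrow> tcot L l"
proof -
  have l: "0 \<le> l" using u by (intro LIMSEQ_le_const[OF assms(1)]) (auto intro: less_imp_le)
  have l2: "l \<le> pi / 2" using u by (intro LIMSEQ_le_const2[OF assms(1)]) blast
  have e: "tcot L (u n) = min (cot (u n)) L" for n using u[of n] by (simp add: tcot_def)
  show ?thesis
  proof (cases "l = 0")
    case False
    then have "sin l > 0" using l l2 pi_gt_zero by (intro sin_gt_zero) linarith+
    then have "(\<lambda>n. min (cot (u n)) L) \<longlonglongrightarrow> min (cot l) L"
      using assms(1) by (intro tendsto_min tendsto_const isCont_tendsto_compose[OF isCont_cot]) auto
    then show ?thesis using False l unfolding e by (simp add: tcot_def)
  next
    case True
    have "eventually (\<lambda>n. u n < 1 / (\<bar>L\<bar> + 1)) sequentially"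
      using assms(1) True by (intro order_tendstoD) auto
    then have "eventually (\<lambda>n. tcot L (u n) = L) sequentially"
    proof eventually_elim
      case (elim n)
      have "\<bar>L\<bar> + 1 \<le> 1 / u n" using elim u[of n] by (simp add: field_simps add_pos_nonneg)
      then have "L \<le> cot (u n)" using inverse_le_cot_plus_one[of "u n"] u[of n] by linarith
      then show ?case by (simp add: e)
    qed
    then show ?thesis using True by (simp add: tcot_def tendsto_eventually)
  qed
qed

lemma tcot_measurable [measurable]: "tcot L \<in> borel_measurable borel"
  unfolding tcot_def cot_def by measurable

lemma tcot_bounds: "0 \<le> L \<Longrightarrow> 0 \<le> x \<Longrightarrow> x \<le> pi / 2 \<Longrightarrow> 0 \<le> tcot L x \<and> tcot L x \<le> L"
  using cot_nonneg[of x] by (auto simp: tcot_def)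

lemma tcot_mono: "L \<le> L' \<Longrightarrow> tcot L x \<le> tcot L' x"
  by (auto simp: tcot_def)

lemma tcot_le_cot: "0 < x \<Longrightarrow> tcot L x \<le> cot x"
  by (auto simp: tcot_def)

context cot_chamber
begin

definition gL :: "real \<Rightarrow> 'v \<Rightarrow> real" where "gL L y = (\<Sum>i\<in>I. k i * tcot L (X i y))"
definition bL :: "real \<Rightarrow> 'v \<Rightarrow> 'v" where "bL L y = (\<Sum>i\<in>I. (k i * tcot L (X i y)) *\<^sub>R a i)"

lemma X_measurable [measurable]: "X i \<in> borel_measurable borel"
  unfolding X_def by measurable

lemma gL_measurable [measurable]: "gL L \<in> borel_measurable borel"
  unfolding gL_def by measurable
lemma bL_measurable [measurable]: "bL L \<in> borel_measurable borel"
  unfolding bL_def by measurable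
lemma g_measurable [measurable]: "g \<in> borel_measurable borel"
  unfolding g_def cot_def by measurable
lemma b_measurable [measurable]: "b \<in> borel_measurable borel"
  unfolding b_def cot_def by measurable

lemma tcot_X_bounds: "0 \<le> L \<Longrightarrow> y \<in> Dc \<Longrightarrow> i \<in> I \<Longrightarrow> 0 \<le> tcot L (X i y) \<and> tcot L (X i y) \<le> L"
  using X_le[of y i] by (intro tcot_bounds) (simp_all add: Dc_def)

lemma gL_nonneg: "0 \<le> L \<Longrightarrow> y \<in> Dc \<Longrightarrow> 0 \<le> gL L y"
  unfolding gL_def using tcot_X_bounds k_pos by (intro sum_nonneg mult_nonneg_nonneg) (auto intro: less_imp_le)

lemma gL_mono: "L \<le> L' \<Longrightarrow> gL L y \<le> gL L' y"
  unfolding gL_def using k_pos by (intro sum_mono mult_left_mono tcot_mono) (auto intro: less_imp_le)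

lemma gL_le: "0 \<le> L \<Longrightarrow> y \<in> Dc \<Longrightarrow> gL L y \<le> (\<Sum>i\<in>I. k i) * L"
  unfolding gL_def sum_distrib_right using tcot_X_bounds k_pos
  by (intro sum_mono mult_left_mono) (auto intro: less_imp_le)

lemma gL_le_g: "y \<in> D \<Longrightarrow> gL L y \<le> g y"
  unfolding gL_def g_def using k_pos D_X
  by (intro sum_mono mult_left_mono tcot_le_cot) (auto intro: less_imp_le)

text \<open>
  A time integral of \<open>gL L\<close> that stays bounded as \<open>L\<close> grows therefore leaves no time for the boundary.
\<close>

lemma gL_boundary:
  assumes y: "y \<in> Dc" "y \<notin> D"
  obtains i where "i \<in> I" "\<And>L. 0 \<le> L \<Longrightarrow> k i * L \<le> gL L y"
proof -
  obtain i where i: "i \<in> I" "X i y \<le> 0" using y by (auto simp: D_def not_less)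
  have "k i * L \<le> gL L y" if L: "0 \<le> L" for L
  proof -
    have "k i * tcot L (X i y) \<le> gL L y"
      unfolding gL_def using tcot_X_bounds[OF L y(1)] k_pos finite_I i(1)
      by (intro member_le_sum mult_nonneg_nonneg) (auto intro: less_imp_le)
    then show ?thesis using i by (simp add: tcot_def)
  qed
  then show ?thesis using that i by blast
qed

lemma norm_bL_le: "0 \<le> L \<Longrightarrow> y \<in> Dc \<Longrightarrow> norm (bL L y) \<le> A * gL L y"
  unfolding bL_def gL_def sum_distrib_left
proof (rule sum_norm_le)
  fix i assume i: "i \<in> I" and *: "0 \<le> L" "y \<in> Dc"
  have p: "0 \<le> k i * tcot L (X i y)" using tcot_X_bounds[OF * i] k_pos[OF i] by simp
  have "k i * tcot L (X i y) * norm (a i) \<le> k i * tcot L (X i y) * A"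
    using norm_a_le[OF i] p by (rule mult_left_mono)
  then show "norm ((k i * tcot L (X i y)) *\<^sub>R a i) \<le> A * (k i * tcot L (X i y))"
    using p by (simp add: mult.commute)
qed

text \<open>
  All the truncation errors have the same sign, so the scalar error controls the vectorial one.
\<close>

lemma norm_b_diff_bL_le:
  assumes y: "y \<in> D"
  shows "norm (b y - bL L y) \<le> A * (g y - gL L y)"
proof -
  have "b y - bL L y = (\<Sum>i\<in>I. (k i * (cot (X i y) - tcot L (X i y))) *\<^sub>R a i)"
    by (simp add: b_def bL_def sum_subtractf[symmetric] algebra_simps)
  also have "norm \<dots> \<le> (\<Sum>i\<in>I. A * (k i * (cot (X i y) - tcot L (X i y))))"
  proof (rule sum_norm_le)
    fix i assume i: "i \<in> I"
    have p: "0 \<le> k i * (cot (X i y) - tcot L (X i y))"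
      using tcot_le_cot[OF D_X(1)[OF y i], of L] k_pos[OF i] by simp
    have "k i * (cot (X i y) - tcot L (X i y)) * norm (a i) \<le> k i * (cot (X i y) - tcot L (X i y)) * A"
      using norm_a_le[OF i] p by (rule mult_left_mono)
    then show "norm ((k i * (cot (X i y) - tcot L (X i y))) *\<^sub>R a i) \<le> A * (k i * (cot (X i y) - tcot L (X i y)))"
      using p unfolding norm_scaleR by (simp only: real_norm_def abs_of_nonneg mult.commute)
  qed
  also have "\<dots> = A * (g y - gL L y)"
    by (simp add: g_def gL_def sum_distrib_left sum_subtractf[symmetric] algebra_simps)
  finally show ?thesis .
qed

lemma eventually_gL_eq_g: "y \<in> D \<Longrightarrow> eventually (\<lambda>n. gL (real n) y = g y) sequentially"
proof -
  assume y: "y \<in> D"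
  obtain N where N: "(\<Sum>i\<in>I. \<bar>cot (X i y)\<bar>) \<le> real N" using real_arch_simple by blast
  have "gL (real n) y = g y" if "N \<le> n" for n
    unfolding gL_def g_def
  proof (intro sum.cong refl arg_cong[where f="(*) _"])
    fix i assume i: "i \<in> I"
    have "\<bar>cot (X i y)\<bar> \<le> (\<Sum>i\<in>I. \<bar>cot (X i y)\<bar>)" using finite_I i by (intro member_le_sum) auto
    then have "cot (X i y) \<le> real n" using N that by linarith
    then show "tcot (real n) (X i y) = cot (X i y)" using D_X[OF y i] by (simp add: tcot_def)
  qed
  then show ?thesis by (auto simp: eventually_sequentially)
qed

lemma tendsto_gL:
  assumes "u \<longlonglongrightarrow> l" "\<And>n. u n \<in> D"
  shows "(\<lambda>n. gL L (u n)) \<longlonglongrightarrow> gL L l" "(\<lambda>n. bL L (u n)) \<longlonglongrightarrow> bL L l"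
  unfolding gL_def bL_def using assms D_X
  by (auto intro!: tendsto_intros tendsto_tcot)

section \<open>Convergence of the scheme\<close>

definition Sg :: "real \<Rightarrow> (real \<Rightarrow> 'v) \<Rightarrow> 'v \<Rightarrow> real \<Rightarrow> 'v" where
  "Sg h w x s = (LINT r:{0..s}|lborel. b (Y h w x (nat \<lceil>r / h\<rceil>)))"

text \<open>
  Between the mesh points the interpolation follows the path itself. Two interpolations with
  different step sizes then differ only by integrals of their drifts.
\<close>

definition interp :: "real \<Rightarrow> (real \<Rightarrow> 'v) \<Rightarrow> 'v \<Rightarrow> real \<Rightarrow> 'v" where
  "interp h w x s = x + w s - w 0 + Sg h w x s"

lemma interp_cell:
  assumes "0 < h" "h * real n \<le> s" "s \<le> h * real (Suc n)"
  shows "interp h w x s = Y h w x n + (w s - w (h * real n)) + (s - h * real n) *\<^sub>R b (Y h w x (Suc n))"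
  unfolding interp_def Sg_def
  using step_integral_cell[OF assms, of "\<lambda>n. b (Y h w x n)"] Y_eq_sum[OF assms(1), of w x n] by simp

lemma interp_0: "0 < h \<Longrightarrow> interp h w x 0 = x"
  using interp_cell[of h 0 0 w x] by simp

text \<open>
  The interpolation of one cell consists of an increment of the path and a part of
  \<open>h b(y\<^sub>n\<^sub>+\<^sub>1)\<close>. The latter is small although \<open>b\<close> is unbounded, since it equals
  \<open>J h (y\<^sub>n + d) - y\<^sub>n - d\<close>, where \<open>d\<close> is the increment of the path.
\<close>

lemma interp_near_scheme:
  assumes w: "continuous_on {0..T + 1} w" and x: "x \<in> Dc" and e: "0 < e"
  obtains h0 where "0 < h0" "h0 \<le> 1"
    "\<And>h n s. 0 < h \<Longrightarrow> h < h0 \<Longrightarrow> h * real n \<le> s \<Longrightarrow> s \<le> h * real (Suc n) \<Longrightarrow> s \<le> T \<Longrightarrow>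
       norm (interp h w x s - Y h w x n) \<le> e \<and> norm (interp h w x s - Y h w x (Suc n)) \<le> e"
proof -
  have "uniformly_continuous_on {0..T + 1} w" using w by (intro compact_uniformly_continuous) auto
  then obtain d where d: "0 < d" "\<And>s t. s \<in> {0..T+1} \<Longrightarrow> t \<in> {0..T+1} \<Longrightarrow> \<bar>t - s\<bar> < d \<Longrightarrow> norm (w t - w s) < e / 8"
    unfolding uniformly_continuous_on_def dist_norm using e by (metis divide_pos_pos real_norm_def zero_less_numeral)
  have e8: "0 < e / 8" using e by simp
  obtain h1 where h1: "0 < h1" "\<And>h z. 0 < h \<Longrightarrow> h < h1 \<Longrightarrow> z \<in> Dc \<Longrightarrow> norm (J h z - z) \<le> e / 8"
    using J_uniformly_close[OF e8] by blast
  show ?thesis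
  proof (rule that[of "min 1 (min d h1)"])
    fix h n s
    assume h: "0 < h" "h < min 1 (min d h1)" and s: "h * real n \<le> s" "s \<le> h * real (Suc n)" "s \<le> T"
    let ?y = "Y h w x n" and ?y' = "Y h w x (Suc n)"
    let ?d = "w (h * real (Suc n)) - w (h * real n)"
    have r: "h * real (Suc n) = h * real n + h" by (simp add: algebra_simps)
    have hn0: "0 \<le> h * real n" using h by simp
    then have s0: "0 \<le> s" using s by linarith
    have dn: "norm ?d \<le> e / 8" using h s hn0 s0 unfolding r by (intro less_imp_le d) auto
    have dn2: "norm (w s - w (h * real n)) \<le> e / 8" using h s hn0 s0 unfolding r by (intro less_imp_le d) auto
    have diff: "z = y + d + u \<Longrightarrow> u = z - y - d" "z = y + d + u \<Longrightarrow> z - y = d + u" for z y d u :: 'v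
      by simp_all
    have hb_eq: "h *\<^sub>R b ?y' = (J h (?y + ?d) - J h ?y) + (J h ?y - ?y) - ?d"
      unfolding diff(1)[OF Y_step[OF h(1)]] by (simp add: Y.simps(2))
    have "norm (h *\<^sub>R b ?y') \<le> norm (J h (?y + ?d) - J h ?y) + norm (J h ?y - ?y) + norm ?d"
      unfolding hb_eq using norm_triangle_ineq4[of "(J h (?y + ?d) - J h ?y) + (J h ?y - ?y)" ?d]
        norm_triangle_ineq[of "J h (?y + ?d) - J h ?y" "J h ?y - ?y"] by linarith
    also have "\<dots> \<le> e / 8 + e / 8 + e / 8"
    proof (intro add_mono dn)
      show "norm (J h (?y + ?d) - J h ?y) \<le> e / 8"
        using J_nonexpansive[OF h(1), of "?y + ?d" ?y] dn unfolding add_diff_cancel_left' by linarith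
      show "norm (J h ?y - ?y) \<le> e / 8" using h by (intro h1(2) Y_in_Dc x) auto
    qed
    finally have hb: "norm (h *\<^sub>R b ?y') \<le> e / 8 + e / 8 + e / 8" .
    have "norm ((s - h * real n) *\<^sub>R b ?y') \<le> norm (h *\<^sub>R b ?y')"
      using s h unfolding r by (auto intro!: mult_right_mono)
    moreover have "interp h w x s - ?y = (w s - w (h * real n)) + (s - h * real n) *\<^sub>R b ?y'"
      using interp_cell[OF h(1) s(1,2), of w x] by simp
    ultimately have 1: "norm (interp h w x s - ?y) \<le> e / 2"
      using dn2 hb norm_triangle_ineq[of "w s - w (h * real n)" "(s - h * real n) *\<^sub>R b ?y'"] by simp
    have "?y' - ?y = ?d + h *\<^sub>R b ?y'" by (rule diff(2)[OF Y_step[OF h(1)]])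
    then have 2: "norm (?y' - ?y) \<le> e / 2" using dn hb norm_triangle_ineq[of ?d "h *\<^sub>R b ?y'"] by simp
    have "norm (interp h w x s - ?y') \<le> norm (interp h w x s - ?y) + norm (?y' - ?y)"
      using norm_triangle_ineq4[of "interp h w x s - ?y" "?y' - ?y"] by simp
    then show "norm (interp h w x s - ?y) \<le> e \<and> norm (interp h w x s - ?y') \<le> e" using 1 2 e by simp
  qed (use d h1 in auto)
qed

lemma scheme_integral_le:
  assumes w: "continuous_on {0..T + 1} w" and x: "x \<in> Dc"
  obtains C where "0 \<le> C"
    "\<And>h t. 0 < h \<Longrightarrow> h \<le> 1 \<Longrightarrow> t \<in> {0..T} \<Longrightarrow> (LINT s:{0..t}|lborel. \<bar>g (Y h w x (nat \<lceil>s / h\<rceil>))\<bar>) \<le> C"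
    "\<And>h t. 0 < h \<Longrightarrow> h \<le> 1 \<Longrightarrow> t \<in> {0..T} \<Longrightarrow> (LINT s:{0..t}|lborel. norm (b (Y h w x (nat \<lceil>s / h\<rceil>)))) \<le> A * C"
proof -
  obtain C where C: "0 \<le> C"
    "\<And>h N. 0 < h \<Longrightarrow> h \<le> 1 \<Longrightarrow> h * real N \<le> T + 1 \<Longrightarrow> (\<Sum>j<N. h * g (Y h w x (Suc j))) \<le> C"
    using drift_sum_bounded[OF w x] by blast
  have *: "(LINT s:{0..t}|lborel. \<bar>f (Y h w x (nat \<lceil>s / h\<rceil>))\<bar>) \<le> B * C"
    if h: "0 < h" "h \<le> 1" and t: "t \<in> {0..T}" and f: "\<And>y. y \<in> D \<Longrightarrow> \<bar>f y\<bar> \<le> B * g y" and B: "0 \<le> B"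
    for h t B :: real and f :: "'v \<Rightarrow> real"
  proof -
    define N where "N = nat \<lceil>t / h\<rceil>"
    have tN: "t \<le> h * real N"
      using h real_nat_ceiling_ge[of "t / h"] by (simp add: N_def field_simps)
    have "0 \<le> t / h" using t h by simp
    then have "real N \<le> t / h + 1"
      unfolding N_def by (simp add: of_nat_nat of_int_ceiling_le_add_one)
    then have "h * real N \<le> h * (t / h + 1)" using h by (intro mult_left_mono) auto
    then have NT: "h * real N \<le> T + 1" using h t by (simp add: algebra_simps)
    note si = step_integral[OF h(1), of N "\<lambda>n. \<bar>f (Y h w x n)\<bar>"]
    have "(LINT s:{0..t}|lborel. \<bar>f (Y h w x (nat \<lceil>s / h\<rceil>))\<bar>) \<le> (LINT s:{0..h * real N}|lborel. \<bar>f (Y h w x (nat \<lceil>s / h\<rceil>))\<bar>)"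
      unfolding set_lebesgue_integral_def
    proof (rule integral_mono)
      show "integrable lborel (\<lambda>s. indicator {0..t} s *\<^sub>R \<bar>f (Y h w x (nat \<lceil>s / h\<rceil>))\<bar>)"
        using step_set_integrable[OF h(1), of t "\<lambda>n. \<bar>f (Y h w x n)\<bar>"] by (simp add: set_integrable_def)
      show "integrable lborel (\<lambda>s. indicator {0..h * real N} s *\<^sub>R \<bar>f (Y h w x (nat \<lceil>s / h\<rceil>))\<bar>)"
        using si(1) by (simp add: set_integrable_def)
    qed (use tN in \<open>auto simp: indicator_def\<close>)
    also have "\<dots> = (\<Sum>j<N. h *\<^sub>R \<bar>f (Y h w x (Suc j))\<bar>)" by (rule si(2))
    also have "\<dots> \<le> (\<Sum>j<N. B * (h * g (Y h w x (Suc j))))"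
    proof (rule sum_mono)
      fix j
      have "h * \<bar>f (Y h w x (Suc j))\<bar> \<le> h * (B * g (Y h w x (Suc j)))"
        using f[OF Y_in_D[OF h(1)]] h by (intro mult_left_mono) auto
      then show "h *\<^sub>R \<bar>f (Y h w x (Suc j))\<bar> \<le> B * (h * g (Y h w x (Suc j)))" by (simp add: mult.left_commute)
    qed
    also have "\<dots> = B * (\<Sum>j<N. h * g (Y h w x (Suc j)))" by (simp add: sum_distrib_left)
    also have "\<dots> \<le> B * C" using C(2)[OF h NT] B by (intro mult_left_mono) auto
    finally show ?thesis .
  qed
  show ?thesis
  proof (rule that[OF C(1)])
    fix h t :: real assume h: "0 < h" "h \<le> 1" and t: "t \<in> {0..T}"
    show "(LINT s:{0..t}|lborel. \<bar>g (Y h w x (nat \<lceil>s / h\<rceil>))\<bar>) \<le> C"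
      using *[OF h t, of g 1] g_nonneg by simp
    show "(LINT s:{0..t}|lborel. norm (b (Y h w x (nat \<lceil>s / h\<rceil>)))) \<le> A * C"
      using *[OF h t, of "\<lambda>y. norm (b y)" A] norm_b_le A_pos by simp
  qed
qed

text \<open>
  Let \<open>r\<close> be the difference of the two interpolations and \<open>f\<close> the difference of their drifts, so
  that \<open>|r|\<^sup>2 = 2 \<integral> f \<bullet> r\<close>. If \<open>r\<close> were the difference of the points at which the drifts are taken, the
  integrand would be nonpositive by monotonicity. For small steps it is within \<open>2 e'\<close> of that
  difference, and the integral of \<open>|f|\<close> is bounded independently of the step sizes.
\<close>

lemma interp_Cauchy:
  assumes w: "continuous_on {0..T + 1} w" and x: "x \<in> Dc" and e: "0 < e"
  obtains h0 where "0 < h0"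
    "\<And>h h' t. 0 < h \<Longrightarrow> h < h0 \<Longrightarrow> 0 < h' \<Longrightarrow> h' < h0 \<Longrightarrow> t \<in> {0..T} \<Longrightarrow> norm (interp h w x t - interp h' w x t) \<le> e"
proof -
  obtain C where C: "0 \<le> C"
    "\<And>h t. 0 < h \<Longrightarrow> h \<le> 1 \<Longrightarrow> t \<in> {0..T} \<Longrightarrow> (LINT s:{0..t}|lborel. norm (b (Y h w x (nat \<lceil>s / h\<rceil>)))) \<le> A * C"
    using scheme_integral_le[OF w x] by metis
  define e' where "e' = e\<^sup>2 / (8 * (A * C) + 1)"
  have AC: "0 \<le> A * C" using A_pos C by simp
  then have e': "0 < e'" "8 * e' * (A * C) \<le> e\<^sup>2"
    using e by (auto simp: e'_def field_simps)
  obtain h0 where h0: "0 < h0" "h0 \<le> 1"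
    "\<And>h n s. 0 < h \<Longrightarrow> h < h0 \<Longrightarrow> h * real n \<le> s \<Longrightarrow> s \<le> h * real (Suc n) \<Longrightarrow> s \<le> T \<Longrightarrow>
       norm (interp h w x s - Y h w x n) \<le> e' \<and> norm (interp h w x s - Y h w x (Suc n)) \<le> e'"
    using interp_near_scheme[OF w x e'(1)] by blast
  show ?thesis
  proof (rule that[OF h0(1)])
    fix h h' t assume h: "0 < h" "h < h0" "0 < h'" "h' < h0" and t: "t \<in> {0..T}"
    let ?U = "\<lambda>h s. Y h w x (nat \<lceil>s / h\<rceil>)"
    let ?f = "\<lambda>s. b (?U h s) - b (?U h' s)"
    have int: "set_integrable lborel {0..s} (\<lambda>s. b (?U h s))" if "0 < h" for h s
      using step_set_integrable[OF that, of s "\<lambda>n. b (Y h w x n)"] .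
    have intn: "set_integrable lborel {0..s} (\<lambda>s. norm (b (?U h s)))" if "0 < h" for h s
      using step_set_integrable[OF that, of s "\<lambda>n. norm (b (Y h w x n))"] .
    have intf: "set_integrable lborel {0..s} ?f" for s
      using int[OF h(1)] int[OF h(3)] by (rule set_integral_diff(1))
    have eqD: "(LINT s:{0..s}|lborel. ?f s) = interp h w x s - interp h' w x s" for s
      unfolding interp_def Sg_def using set_integral_diff(2)[OF int[OF h(1)] int[OF h(3)], of s] by simp
    have near: "norm (interp h w x s - ?U h s) \<le> e'" if hs: "0 < h" "h < h0" "0 < s" "s \<le> T" for h s
    proof -
      obtain n where n: "nat \<lceil>s / h\<rceil> = Suc n" "h * real n \<le> s" "s \<le> h * real (Suc n)"
        using ceiling_cell[OF hs(1,3)] by blast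
      then show ?thesis using h0(3)[OF hs(1,2) n(2,3) hs(4)] by simp
    qed
    note sq = square_norm_integral[OF intf[of t]]
    have 1: "(norm (interp h w x t - interp h' w x t))\<^sup>2 = 2 * (LINT s:{0..t}|lborel. ?f s \<bullet> (interp h w x s - interp h' w x s))"
      using sq(2) unfolding eqD .
    have 2: "(LINT s:{0..t}|lborel. ?f s \<bullet> (interp h w x s - interp h' w x s))
        \<le> (LINT s:{0..t}|lborel. 2 * e' * (norm (b (?U h s)) + norm (b (?U h' s))))"
    proof (rule set_integral_mono)
      show "set_integrable lborel {0..t} (\<lambda>s. ?f s \<bullet> (interp h w x s - interp h' w x s))"
        using sq(1) unfolding eqD .
      show "set_integrable lborel {0..t} (\<lambda>s. 2 * e' * (norm (b (?U h s)) + norm (b (?U h' s))))"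
        using intn[OF h(1)] intn[OF h(3)] by (intro set_integrable_mult_right set_integral_add(1)) auto
      fix s assume s: "s \<in> {0..t}"
      show "?f s \<bullet> (interp h w x s - interp h' w x s) \<le> 2 * e' * (norm (b (?U h s)) + norm (b (?U h' s)))"
      proof (cases "s = 0")
        case True
        then have "interp h w x s - interp h' w x s = 0"
          using h by (simp add: interp_0)
        then show ?thesis using e'(1) by simp
      next
        case False
        then have sp: "0 < s" "s \<le> T" using s t by auto
        let ?r = "interp h w x s - ?U h s" and ?r' = "interp h' w x s - ?U h' s"
        have UD: "?U h s \<in> D" "?U h' s \<in> D"
          by (rule ceiling_cell[OF h(1) sp(1)], simp only: Y_in_D[OF h(1)])
            (rule ceiling_cell[OF h(3) sp(1)], simp only: Y_in_D[OF h(3)])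
        have "?f s \<bullet> (interp h w x s - interp h' w x s) = ?f s \<bullet> (?U h s - ?U h' s) + ?f s \<bullet> (?r - ?r')"
          by (simp add: inner_diff_right)
        also have "\<dots> \<le> norm (?f s) * norm (?r - ?r')"
          using b_monotone[OF UD] norm_cauchy_schwarz[of "?f s" "?r - ?r'"] by simp
        also have "\<dots> \<le> (norm (b (?U h s)) + norm (b (?U h' s))) * (e' + e')"
        proof (intro mult_mono norm_triangle_ineq4)
          show "norm (?r - ?r') \<le> e' + e'"
            using near[OF h(1,2) sp] near[OF h(3,4) sp] norm_triangle_ineq4[of ?r ?r'] by linarith
        qed simp_all
        finally show ?thesis by (simp add: algebra_simps)
      qed
    qed
    have "(LINT s:{0..t}|lborel. 2 * e' * (norm (b (?U h s)) + norm (b (?U h' s))))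
      = 2 * e' * ((LINT s:{0..t}|lborel. norm (b (?U h s))) + (LINT s:{0..t}|lborel. norm (b (?U h' s))))"
      by (simp only: set_integral_mult_right set_integral_add(2)[OF intn[OF h(1), of t] intn[OF h(3), of t]])
    also have "\<dots> \<le> 2 * e' * (A * C + A * C)"
    proof (intro mult_left_mono add_mono)
      show "(LINT s:{0..t}|lborel. norm (b (?U h s))) \<le> A * C"
        using h h0(2) by (intro C(2)[OF h(1) _ t]) linarith
      show "(LINT s:{0..t}|lborel. norm (b (?U h' s))) \<le> A * C"
        using h h0(2) by (intro C(2)[OF h(3) _ t]) linarith
    qed (use e' in simp)
    finally have "(LINT s:{0..t}|lborel. 2 * e' * (norm (b (?U h s)) + norm (b (?U h' s)))) \<le> 2 * e' * (A * C + A * C)" .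
    then have "(norm (interp h w x t - interp h' w x t))\<^sup>2 \<le> 2 * (2 * e' * (A * C + A * C))" using 1 2 by linarith
    also have "\<dots> \<le> e\<^sup>2" using e'(2) by (simp add: algebra_simps)
    finally have "(norm (interp h w x t - interp h' w x t))\<^sup>2 \<le> e\<^sup>2" .
    then show "norm (interp h w x t - interp h' w x t) \<le> e" using e by (simp add: power2_le_iff_abs_le)
  qed
qed

end

section \<open>The limit path\<close>

text \<open>
  Fixed step sizes for which every natural number is a mesh point.
\<close>

definition mesh :: "nat \<Rightarrow> real" where "mesh n = 1 / real (Suc n)"

lemma mesh_pos [simp]: "0 < mesh n" and mesh_le_1 [simp]: "mesh n \<le> 1"
  by (auto simp: mesh_def)

lemma mesh_mult: "mesh n * real (T * Suc n) = real T"
  by (simp add: mesh_def del: of_nat_Suc mult_Suc_right)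

lemma mesh_tendsto_0: "mesh \<longlonglongrightarrow> 0"
  unfolding mesh_def using LIMSEQ_inverse_real_of_nat by (simp add: inverse_eq_divide)

lemma eventually_mesh_less: "0 < e \<Longrightarrow> eventually (\<lambda>n. mesh n < e) sequentially"
  using mesh_tendsto_0 by (rule order_tendstoD)

context cot_chamber
begin

text \<open>
  Rounding down makes every approximation at time \<open>t\<close> a function of the path up to time \<open>t\<close>, so the
  limit is adapted.
\<close>

definition limit_path :: "(real \<Rightarrow> 'v) \<Rightarrow> 'v \<Rightarrow> real \<Rightarrow> 'v" where
  "limit_path w x t = lim (\<lambda>n. Y (mesh n) w x (nat \<lfloor>t / mesh n\<rfloor>))"

context
  fixes w :: "real \<Rightarrow> 'v" and x :: 'v
  assumes w: "continuous_on {0..} w" and x: "x \<in> Dc"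
begin

abbreviation (input) \<phi> :: "real \<Rightarrow> 'v" where "\<phi> \<equiv> limit_path w x"
abbreviation (input) U :: "nat \<Rightarrow> real \<Rightarrow> 'v" where "U n s \<equiv> Y (mesh n) w x (nat \<lceil>s / mesh n\<rceil>)"

lemma w_on: "continuous_on {0..T} w"
  using w by (rule continuous_on_subset) auto

lemma near_eventually:
  assumes "0 < e"
  shows "eventually (\<lambda>n. \<forall>j s. mesh n * real j \<le> s \<longrightarrow> s \<le> mesh n * real (Suc j) \<longrightarrow> s \<le> T \<longrightarrow>
    norm (interp (mesh n) w x s - Y (mesh n) w x j) \<le> e \<and> norm (interp (mesh n) w x s - Y (mesh n) w x (Suc j)) \<le> e) sequentially"
proof -
  obtain h0 where h0: "0 < h0" "h0 \<le> 1"
    "\<And>h n s. 0 < h \<Longrightarrow> h < h0 \<Longrightarrow> h * real n \<le> s \<Longrightarrow> s \<le> h * real (Suc n) \<Longrightarrow> s \<le> T \<Longrightarrow>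
       norm (interp h w x s - Y h w x n) \<le> e \<and> norm (interp h w x s - Y h w x (Suc n)) \<le> e"
    using interp_near_scheme[OF w_on x assms] by blast
  show ?thesis
    using eventually_mesh_less[OF h0(1)] by eventually_elim (intro allI impI h0(3) mesh_pos)
qed

lemma floor_near: "0 \<le> t \<Longrightarrow> (\<lambda>n. interp (mesh n) w x t - Y (mesh n) w x (nat \<lfloor>t / mesh n\<rfloor>)) \<longlonglongrightarrow> 0"
proof (rule tendstoI)
  fix e :: real assume t: "0 \<le> t" and e: "0 < e"
  then have e2: "0 < e / 2" by simp
  show "eventually (\<lambda>n. dist (interp (mesh n) w x t - Y (mesh n) w x (nat \<lfloor>t / mesh n\<rfloor>)) 0 < e) sequentially"
    using near_eventually[OF e2, of t]
  proof eventually_elim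
    case (elim n)
    then have "norm (interp (mesh n) w x t - Y (mesh n) w x (nat \<lfloor>t / mesh n\<rfloor>)) \<le> e / 2"
      using floor_cell[OF mesh_pos t] by blast
    then show ?case using e by simp
  qed
qed

lemma ceiling_near: "0 < t \<Longrightarrow> (\<lambda>n. interp (mesh n) w x t - U n t) \<longlonglongrightarrow> 0"
proof (rule tendstoI)
  fix e :: real assume t: "0 < t" and e: "0 < e"
  then have e2: "0 < e / 2" by simp
  show "eventually (\<lambda>n. dist (interp (mesh n) w x t - U n t) 0 < e) sequentially"
    using near_eventually[OF e2, of t]
  proof eventually_elim
    case (elim n)
    obtain j where j: "nat \<lceil>t / mesh n\<rceil> = Suc j" "mesh n * real j \<le> t" "t \<le> mesh n * real (Suc j)"
      using ceiling_cell[OF mesh_pos t] by blast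
    then have "norm (interp (mesh n) w x t - U n t) \<le> e / 2"
      using elim by (simp only: j(1))
    then show ?case using e by simp
  qed
qed

lemma interp_uniform_limit: "uniform_limit {0..T} (\<lambda>n. interp (mesh n) w x) \<phi> sequentially"
proof -
  have "uniformly_Cauchy_on {0..T} (\<lambda>n. interp (mesh n) w x)"
  proof (rule uniformly_Cauchy_onI)
    fix e :: real assume e: "0 < e"
    then have e2: "0 < e / 2" by simp
    obtain h0 where h0: "0 < h0"
      "\<And>h h' t. 0 < h \<Longrightarrow> h < h0 \<Longrightarrow> 0 < h' \<Longrightarrow> h' < h0 \<Longrightarrow> t \<in> {0..T} \<Longrightarrow> norm (interp h w x t - interp h' w x t) \<le> e / 2"
      using interp_Cauchy[OF w_on x e2] by blast
    obtain N where N: "\<And>n. N \<le> n \<Longrightarrow> mesh n < h0"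
      using eventually_mesh_less[OF h0(1)] by (auto simp: eventually_sequentially)
    have "dist (interp (mesh m) w x t) (interp (mesh n) w x t) < e" if "t \<in> {0..T}" "N \<le> m" "N \<le> n" for t m n
      using h0(2)[OF mesh_pos N[OF that(2)] mesh_pos N[OF that(3)] that(1)] e by (simp add: dist_norm)
    then show "\<exists>M. \<forall>t\<in>{0..T}. \<forall>m\<ge>M. \<forall>n\<ge>M. dist (interp (mesh m) w x t) (interp (mesh n) w x t) < e" by blast
  qed
  then have "uniformly_convergent_on {0..T} (\<lambda>n. interp (mesh n) w x)"
    by (rule Cauchy_uniformly_convergent)
  then obtain l where l: "uniform_limit {0..T} (\<lambda>n. interp (mesh n) w x) l sequentially"
    by (auto simp: uniformly_convergent_on_def)
  have "l t = \<phi> t" if t: "t \<in> {0..T}" for t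
  proof -
    have "(\<lambda>n. interp (mesh n) w x t) \<longlonglongrightarrow> l t" using tendsto_uniform_limitI[OF l t] .
    from tendsto_diff[OF this floor_near[of t]] t
    have "(\<lambda>n. Y (mesh n) w x (nat \<lfloor>t / mesh n\<rfloor>)) \<longlonglongrightarrow> l t" by simp
    then show ?thesis unfolding limit_path_def by (simp add: limI)
  qed
  then have "uniform_limit {0..T} (\<lambda>n. interp (mesh n) w x) l sequentially = uniform_limit {0..T} (\<lambda>n. interp (mesh n) w x) \<phi> sequentially"
    by (intro uniform_limit_cong') auto
  then show ?thesis using l by simp
qed

lemma interp_tendsto: "0 \<le> t \<Longrightarrow> (\<lambda>n. interp (mesh n) w x t) \<longlonglongrightarrow> \<phi> t"
  using tendsto_uniform_limitI[OF interp_uniform_limit[of t], of t] by simp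

lemma floor_tendsto: "0 \<le> t \<Longrightarrow> (\<lambda>n. Y (mesh n) w x (nat \<lfloor>t / mesh n\<rfloor>)) \<longlonglongrightarrow> \<phi> t"
  using tendsto_diff[OF interp_tendsto[of t] floor_near[of t]] by simp

lemma ceiling_tendsto: "0 < t \<Longrightarrow> (\<lambda>n. U n t) \<longlonglongrightarrow> \<phi> t"
  using tendsto_diff[OF interp_tendsto[of t] ceiling_near[of t]] by simp

lemma U_in_D: "0 < s \<Longrightarrow> U n s \<in> D"
proof -
  assume "0 < s"
  then obtain j where "nat \<lceil>s / mesh n\<rceil> = Suc j" using ceiling_cell[OF mesh_pos] by blast
  then show ?thesis by (simp only: Y_in_D[OF mesh_pos])
qed

lemma U_in_Dc: "U n s \<in> Dc"
  using Y_in_Dc[OF mesh_pos x] .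

lemma limit_path_in_Dc: "0 \<le> t \<Longrightarrow> \<phi> t \<in> Dc"
  using closed_sequentially[OF closed_Dc _ floor_tendsto] Y_in_Dc[OF mesh_pos x] by blast

lemma continuous_interp: "continuous_on {0..T} (interp (mesh n) w x)"
  unfolding interp_def Sg_def
  by (intro continuous_intros w_on continuous_on_set_integral step_set_integrable[where u = "\<lambda>n. b (Y _ w x n)"] mesh_pos)

lemma continuous_limit_path: "continuous_on {0..} \<phi>"
  unfolding continuous_on_def
proof
  fix t :: real assume t: "t \<in> {0..}"
  have "continuous_on {0..t+1} \<phi>"
    by (rule uniform_limit_theorem[OF _ interp_uniform_limit]) (simp_all add: continuous_interp)
  then have "(\<phi> \<longlongrightarrow> \<phi> t) (at t within {0..t+1})" using t by (auto simp: continuous_on_def)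
  moreover have "at t within {0..} = at t within {0..t+1}"
    by (rule at_within_nhd[of _ "{..<t+1}"]) auto
  ultimately show "(\<phi> \<longlongrightarrow> \<phi> t) (at t within {0..})" by simp
qed

lemma limit_path_compose_measurable:
  assumes [measurable]: "F \<in> borel_measurable borel"
  shows "(\<lambda>s. indicator {0..t} s *\<^sub>R (F (\<phi> s) :: 'b::{banach, second_countable_topology})) \<in> borel_measurable lborel"
proof -
  have "continuous_on UNIV (\<lambda>s. \<phi> (max 0 s))"
    by (intro continuous_on_compose2[OF continuous_limit_path] continuous_intros) auto
  then have [measurable]: "(\<lambda>s. \<phi> (max 0 s)) \<in> borel_measurable borel"
    by (rule borel_measurable_continuous_onI)
  have "(\<lambda>s. indicator {0..t} s *\<^sub>R F (\<phi> (max 0 s))) \<in> borel_measurable lborel"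
    by measurable
  also have "(\<lambda>s. indicator {0..t} s *\<^sub>R F (\<phi> (max 0 s))) = (\<lambda>s. indicator {0..t} s *\<^sub>R F (\<phi> s))"
    by (auto simp: indicator_def fun_eq_iff max_def)
  finally show ?thesis .
qed

lemma AE_pos: "AE s in lborel. s \<noteq> (0::real)"
  by (rule AE_lborel_singleton)

lemma integral_U_tendsto:
  fixes F :: "'v \<Rightarrow> 'b::{banach, second_countable_topology}"
  assumes F: "F \<in> borel_measurable borel" and B: "\<And>y. y \<in> Dc \<Longrightarrow> norm (F y) \<le> B"
    and lim: "\<And>u l. u \<longlonglongrightarrow> l \<Longrightarrow> (\<And>n. u n \<in> D) \<Longrightarrow> (\<lambda>n. F (u n)) \<longlonglongrightarrow> F l"
  shows "set_integrable lborel {0..t} (\<lambda>s. F (\<phi> s))"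
    and "(\<lambda>n. LINT s:{0..t}|lborel. F (U n s)) \<longlonglongrightarrow> (LINT s:{0..t}|lborel. F (\<phi> s))"
proof -
  have 1: "AE s in lborel. (\<lambda>n. indicator {0..t} s *\<^sub>R F (U n s)) \<longlonglongrightarrow> indicator {0..t} s *\<^sub>R F (\<phi> s)"
    using AE_pos
  proof eventually_elim
    case (elim s)
    show ?case
    proof (cases "s \<in> {0..t}")
      case True
      then have "0 < s" using elim by auto
      then show ?thesis by (intro tendsto_intros lim ceiling_tendsto U_in_D)
    qed simp
  qed
  have 2: "AE s in lborel. norm (indicator {0..t} s *\<^sub>R F (U n s)) \<le> indicator {0..t} s * B" for n
    using B[OF U_in_Dc] by (intro AE_I2) (auto simp: indicator_def)
  have 3: "(\<lambda>s. indicator {0..t} s *\<^sub>R F (U n s)) \<in> borel_measurable lborel" for n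
    using step_set_integrable[of "mesh n" t "\<lambda>j. F (Y (mesh n) w x j)"] by (auto simp: set_integrable_def)
  have 4: "integrable lborel (\<lambda>s. indicator {0..t} s * B)"
    by (intro integrable_mult_left) (cases "0 \<le> t"; simp add: integrable_indicator_iff)
  \<comment> \<open>The schemes evaluated on the right cell ends converge for every positive time, and \<open>F\<close> is bounded.\<close>
  note dct = 3 limit_path_compose_measurable[OF F] 4 1 2
  show "set_integrable lborel {0..t} (\<lambda>s. F (\<phi> s))"
    unfolding set_integrable_def by (rule integrable_dominated_convergence) (rule dct)+
  show "(\<lambda>n. LINT s:{0..t}|lborel. F (U n s)) \<longlonglongrightarrow> (LINT s:{0..t}|lborel. F (\<phi> s))"
    unfolding set_lebesgue_integral_def by (rule integral_dominated_convergence) (rule dct)+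
qed

lemma gL_integral_tendsto:
  assumes "0 \<le> L"
  shows "set_integrable lborel {0..t} (\<lambda>s. gL L (\<phi> s))"
    and "(\<lambda>n. LINT s:{0..t}|lborel. gL L (U n s)) \<longlonglongrightarrow> (LINT s:{0..t}|lborel. gL L (\<phi> s))"
proof -
  have "norm (gL L y) \<le> sum k I * L" if "y \<in> Dc" for y
    using gL_nonneg[OF assms that] gL_le[OF assms that] by simp
  note i = integral_U_tendsto[OF gL_measurable this tendsto_gL(1)]
  show "set_integrable lborel {0..t} (\<lambda>s. gL L (\<phi> s))"
    and "(\<lambda>n. LINT s:{0..t}|lborel. gL L (U n s)) \<longlonglongrightarrow> (LINT s:{0..t}|lborel. gL L (\<phi> s))"
    by (rule i; assumption)+
qed

lemma bL_integral_tendsto: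
  assumes "0 \<le> L"
  shows "set_integrable lborel {0..t} (\<lambda>s. bL L (\<phi> s))"
    and "(\<lambda>n. LINT s:{0..t}|lborel. bL L (U n s)) \<longlonglongrightarrow> (LINT s:{0..t}|lborel. bL L (\<phi> s))"
proof -
  have "norm (bL L y) \<le> A * (sum k I * L)" if "y \<in> Dc" for y
    using norm_bL_le[OF assms that] mult_left_mono[OF gL_le[OF assms that], of A] A_pos by linarith
  note i = integral_U_tendsto[OF bL_measurable this tendsto_gL(2)]
  show "set_integrable lborel {0..t} (\<lambda>s. bL L (\<phi> s))"
    and "(\<lambda>n. LINT s:{0..t}|lborel. bL L (U n s)) \<longlonglongrightarrow> (LINT s:{0..t}|lborel. bL L (\<phi> s))"
    by (rule i; assumption)+
qed

text \<open>
  The truncated repulsion is bounded and continuous on the closed chamber, so its integral along the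
  limit path is bounded by the uniform bound for the schemes, whatever the level \<open>L\<close>. Monotone
  convergence in \<open>L\<close> then gives integrability of \<open>g\<close>; and as the truncated repulsion grows linearly in
  \<open>L\<close> at a boundary point, the path spends no time on the boundary.
\<close>

lemma limit_path_interior:
  shows "AE s in lborel. s \<in> {0..T} \<longrightarrow> \<phi> s \<in> D"
    and "set_integrable lborel {0..T} (\<lambda>s. g (\<phi> s))"
proof -
  have T: "0 \<le> T \<or> {0..T} = {}" by auto
  have main: "(AE s in lborel. s \<in> {0..T} \<longrightarrow> \<phi> s \<in> D) \<and> set_integrable lborel {0..T} (\<lambda>s. g (\<phi> s))" if T: "0 \<le> T"
  proof -
    obtain C where C: "0 \<le> C"
      "\<And>h t. 0 < h \<Longrightarrow> h \<le> 1 \<Longrightarrow> t \<in> {0..T} \<Longrightarrow> (LINT s:{0..t}|lborel. \<bar>g (Y h w x (nat \<lceil>s / h\<rceil>))\<bar>) \<le> C"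
      using scheme_integral_le[OF w_on x] by metis
    have le: "(LINT s:{0..T}|lborel. gL L (\<phi> s)) \<le> C" if L: "0 \<le> L" for L
    proof (rule LIMSEQ_le_const2[OF gL_integral_tendsto(2)[OF L]], intro exI allI impI)
      fix n
      have "(LINT s:{0..T}|lborel. gL L (U n s)) \<le> (LINT s:{0..T}|lborel. \<bar>g (U n s)\<bar>)"
        unfolding set_lebesgue_integral_def
      proof (rule integral_mono_AE)
        show "integrable lborel (\<lambda>s. indicator {0..T} s *\<^sub>R gL L (U n s))"
          using step_set_integrable[of "mesh n" T "\<lambda>j. gL L (Y (mesh n) w x j)"] by (simp add: set_integrable_def)
        show "integrable lborel (\<lambda>s. indicator {0..T} s *\<^sub>R \<bar>g (U n s)\<bar>)"
          using step_set_integrable[of "mesh n" T "\<lambda>j. \<bar>g (Y (mesh n) w x j)\<bar>"] by (simp add: set_integrable_def)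
        show "AE s in lborel. indicator {0..T} s *\<^sub>R gL L (U n s) \<le> indicator {0..T} s *\<^sub>R \<bar>g (U n s)\<bar>"
          using AE_pos
        proof eventually_elim
          case (elim s)
          have "gL L (U n s) \<le> \<bar>g (U n s)\<bar>" if "0 < s"
            using gL_le_g[OF U_in_D[OF that], of L n] by linarith
          then show ?case using elim by (auto simp: indicator_def)
        qed
      qed
      also have "\<dots> \<le> C" using T by (intro C(2)) auto
      finally show "(LINT s:{0..T}|lborel. gL L (U n s)) \<le> C" .
    qed
    define F where "F L s = ennreal (indicator {0..T} s *\<^sub>R gL (real L) (\<phi> s))" for L :: nat and s
    have nonneg: "0 \<le> indicator {0..T} s *\<^sub>R gL (real L) (\<phi> s)" for L s
      using gL_nonneg[OF _ limit_path_in_Dc, of "real L" s] by (auto simp: indicator_def)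
    have F_meas [measurable]: "F L \<in> borel_measurable lborel" for L
      unfolding F_def using limit_path_compose_measurable[OF gL_measurable] by measurable
    have F_int: "(\<integral>\<^sup>+s. F L s \<partial>lborel) \<le> ennreal C" for L
    proof -
      have "(\<integral>\<^sup>+s. F L s \<partial>lborel) = ennreal (LINT s:{0..T}|lborel. gL (real L) (\<phi> s))"
        unfolding F_def set_lebesgue_integral_def
        using gL_integral_tendsto(1)[of "real L" T] nonneg
        by (intro nn_integral_eq_integral) (auto simp: set_integrable_def)
      then show ?thesis using le[of "real L"] by (simp add: ennreal_leI)
    qed
    have "incseq F"
    proof (intro incseq_SucI le_funI)
      fix L s
      show "F L s \<le> F (Suc L) s"
        unfolding F_def using gL_mono[of "real L" "real (Suc L)" "\<phi> s"]
        by (intro ennreal_leI) (auto simp: indicator_def)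
    qed
    then have "(\<integral>\<^sup>+s. (SUP L. F L s) \<partial>lborel) = (SUP L. \<integral>\<^sup>+s. F L s \<partial>lborel)"
      by (rule nn_integral_monotone_convergence_SUP) measurable
    also have "\<dots> \<le> ennreal C" by (intro SUP_least F_int)
    finally have SUP: "(\<integral>\<^sup>+s. (SUP L. F L s) \<partial>lborel) \<le> ennreal C" .
    then have "AE s in lborel. (SUP L. F L s) \<noteq> \<infinity>"
      by (intro nn_integral_PInf_AE) (auto simp: top_unique)
    then have inD: "AE s in lborel. s \<in> {0..T} \<longrightarrow> \<phi> s \<in> D"
    proof eventually_elim
      case (elim s)
      show ?case
      proof (intro impI, rule ccontr)
        assume s: "s \<in> {0..T}" and "\<phi> s \<notin> D"
        then obtain i where i: "i \<in> I" "\<And>L. 0 \<le> L \<Longrightarrow> k i * L \<le> gL L (\<phi> s)"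
          using gL_boundary[OF limit_path_in_Dc, of s] by auto
        obtain M where M: "(SUP L. F L s) = ennreal M" "0 \<le> M"
          using elim by (cases "SUP L. F L s") auto
        obtain L :: nat where L: "M / k i < real L" using reals_Archimedean2 by blast
        have "F L s \<le> ennreal M" unfolding M(1)[symmetric] by (intro SUP_upper) auto
        then have "gL (real L) (\<phi> s) \<le> M"
          using s M(2) by (simp add: F_def ennreal_le_iff)
        then show False using i(2)[of "real L"] L k_pos[OF i(1)] by (simp add: field_simps)
      qed
    qed
    have gm: "(\<lambda>s. indicator {0..T} s *\<^sub>R g (\<phi> s)) \<in> borel_measurable lborel"
      by (rule limit_path_compose_measurable[OF g_measurable])
    have "(\<integral>\<^sup>+s. ennreal (norm (indicator {0..T} s *\<^sub>R g (\<phi> s))) \<partial>lborel) \<le> (\<integral>\<^sup>+s. (SUP L. F L s) \<partial>lborel)"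
      using inD
    proof (intro nn_integral_mono_AE, eventually_elim)
      case (elim s)
      show ?case
      proof (cases "s \<in> {0..T}")
        case True
        then have D: "\<phi> s \<in> D" using elim by simp
        obtain L where "gL (real L) (\<phi> s) = g (\<phi> s)"
          using eventually_gL_eq_g[OF D] by (auto simp: eventually_sequentially)
        then have "ennreal (norm (indicator {0..T} s *\<^sub>R g (\<phi> s))) = F L s"
          using g_nonneg[OF D] by (simp add: F_def abs_mult)
        also have "\<dots> \<le> (SUP L. F L s)" by (intro SUP_upper) auto
        finally show ?thesis .
      qed simp
    qed
    also have "\<dots> < \<infinity>" using SUP by (simp add: le_less_trans)
    finally have "set_integrable lborel {0..T} (\<lambda>s. g (\<phi> s))"
      unfolding set_integrable_def using gm by (intro integrableI_bounded)
    then show ?thesis using inD by simp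
  qed
  show "AE s in lborel. s \<in> {0..T} \<longrightarrow> \<phi> s \<in> D" using main by (cases "0 \<le> T") auto
  show "set_integrable lborel {0..T} (\<lambda>s. g (\<phi> s))" using main
    by (cases "0 \<le> T") (auto simp: set_integrable_def)
qed

lemma limit_path_b_integrable: "set_integrable lborel {0..t} (\<lambda>s. b (\<phi> s))"
  unfolding set_integrable_def
proof (rule Bochner_Integration.integrable_bound)
  show "integrable lborel (\<lambda>s. A * (indicator {0..t} s *\<^sub>R g (\<phi> s)))"
    using limit_path_interior(2)[of t] by (simp add: set_integrable_def)
  show "AE s in lborel. norm (indicator {0..t} s *\<^sub>R b (\<phi> s)) \<le> norm (A * (indicator {0..t} s *\<^sub>R g (\<phi> s)))"
    using limit_path_interior(1)[of t]
  proof eventually_elim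
    case (elim s)
    show ?case
    proof (cases "s \<in> {0..t}")
      case True
      then show ?thesis using elim norm_b_le[of "\<phi> s"] g_nonneg[of "\<phi> s"] A_pos by (simp add: abs_mult)
    qed simp
  qed
qed (rule limit_path_compose_measurable[OF b_measurable])

lemma bL_limit_tendsto:
  "(\<lambda>n. LINT s:{0..t}|lborel. bL (real n) (\<phi> s)) \<longlonglongrightarrow> (LINT s:{0..t}|lborel. b (\<phi> s))"
  unfolding set_lebesgue_integral_def
proof (rule integral_dominated_convergence)
  show "integrable lborel (\<lambda>s. A * (indicator {0..t} s *\<^sub>R g (\<phi> s)))"
    using limit_path_interior(2)[of t] by (simp add: set_integrable_def)
  show "AE s in lborel. (\<lambda>n. indicator {0..t} s *\<^sub>R bL (real n) (\<phi> s)) \<longlonglongrightarrow> indicator {0..t} s *\<^sub>R b (\<phi> s)"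
    using limit_path_interior(1)[of t]
  proof eventually_elim
    case (elim s)
    show ?case
    proof (cases "s \<in> {0..t}")
      case True
      then have D: "\<phi> s \<in> D" using elim by simp
      have "eventually (\<lambda>n. bL (real n) (\<phi> s) = b (\<phi> s)) sequentially"
        using eventually_gL_eq_g[OF D]
      proof eventually_elim
        case (elim n)
        then have "norm (b (\<phi> s) - bL (real n) (\<phi> s)) \<le> 0" using norm_b_diff_bL_le[OF D, of "real n"] by simp
        then show ?case by simp
      qed
      then show ?thesis by (intro tendsto_scaleR tendsto_const tendsto_eventually)
    qed simp
  qed
  show "AE s in lborel. norm (indicator {0..t} s *\<^sub>R bL (real n) (\<phi> s)) \<le> A * (indicator {0..t} s *\<^sub>R g (\<phi> s))" for n
    using limit_path_interior(1)[of t]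
  proof eventually_elim
    case (elim s)
    show ?case
    proof (cases "s \<in> {0..t}")
      case True
      then have D: "\<phi> s \<in> D" using elim by simp
      have "norm (bL (real n) (\<phi> s)) \<le> A * gL (real n) (\<phi> s)" using D D_subset_Dc by (intro norm_bL_le) auto
      also have "\<dots> \<le> A * g (\<phi> s)" using gL_le_g[OF D] A_pos by (intro mult_left_mono) auto
      finally show ?thesis using True by simp
    qed simp
  qed
qed (rule limit_path_compose_measurable b_measurable bL_measurable)+

text \<open>
  Compare the drift integral of the scheme with that of the limit through the truncated drift \<open>bL L\<close>:
  passing from \<open>b\<close> to \<open>bL L\<close> costs the truncation error of the hypothesis for the scheme and a small
  amount for the limit, and the truncated integrals converge. The drift integrals of the schemes
  converge to some limit anyway, so it is enough to identify it along infinitely many step sizes; a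
  weak hypothesis of this kind is what Fatou's lemma provides for random paths.
\<close>

lemma limit_path_equation:
  fixes T :: nat
  assumes hyp: "\<And>\<eta>. 0 < \<eta> \<Longrightarrow> \<exists>L\<ge>0. \<exists>\<^sub>F n in sequentially.
      (\<Sum>j<T * Suc n. mesh n * (g (Y (mesh n) w x (Suc j)) - gL L (Y (mesh n) w x (Suc j)))) < \<eta>"
    and t: "t \<in> {0..real T}"
  shows "\<phi> t = x + (w t - w 0) + (LINT s:{0..t}|lborel. b (\<phi> s))"
proof -
  define I where "I = (LINT s:{0..t}|lborel. b (\<phi> s))"
  have t0: "0 \<le> t" using t by simp
  have lim: "(\<lambda>n. Sg (mesh n) w x t) \<longlonglongrightarrow> \<phi> t - (x + w t - w 0)"
    using tendsto_diff[OF interp_tendsto[OF t0] tendsto_const[of "x + w t - w 0"]] by (simp add: interp_def)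
  \<comment> \<open>The integral along the limit is a cluster point of the drift integrals.\<close>
  have freq: "\<exists>\<^sub>F n in sequentially. norm (Sg (mesh n) w x t - I) < e" if e: "0 < e" for e
  proof -
    define \<eta> where "\<eta> = e / (3 * A)"
    have \<eta>: "0 < \<eta>" "A * \<eta> = e / 3" using e A_pos by (auto simp: \<eta>_def)
    have e3: "0 < e / 3" using e by simp
    obtain L1 where L1: "0 \<le> L1" "\<exists>\<^sub>F n in sequentially.
        (\<Sum>j<T * Suc n. mesh n * (g (Y (mesh n) w x (Suc j)) - gL L1 (Y (mesh n) w x (Suc j)))) < \<eta>"
      using hyp[OF \<eta>(1)] by blast
    have "eventually (\<lambda>n. norm ((LINT s:{0..t}|lborel. bL (real n) (\<phi> s)) - I) < e / 3) sequentially"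
      using tendstoD[OF bL_limit_tendsto e3, of t] by (simp add: dist_norm I_def)
    moreover have "eventually (\<lambda>n. L1 \<le> real n) sequentially"
      by (rule eventually_sequentiallyI[of "nat \<lceil>L1\<rceil>"]) (simp add: nat_le_iff ceiling_le_iff)
    ultimately obtain L where L: "norm ((LINT s:{0..t}|lborel. bL (real L) (\<phi> s)) - I) < e / 3" "L1 \<le> real L"
      using eventually_conj[THEN eventually_happens'[OF sequentially_bot]] by blast
    have ev: "eventually (\<lambda>n. norm ((LINT s:{0..t}|lborel. bL (real L) (U n s)) - (LINT s:{0..t}|lborel. bL (real L) (\<phi> s))) < e / 3) sequentially"
      using tendstoD[OF bL_integral_tendsto(2)[of "real L" t] e3] by (simp add: dist_norm)
    show ?thesis
    proof (rule frequently_rev_mp[OF L1(2)], use ev in eventually_elim, intro impI)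
      fix n
      assume n2: "norm ((LINT s:{0..t}|lborel. bL (real L) (U n s)) - (LINT s:{0..t}|lborel. bL (real L) (\<phi> s))) < e / 3"
      assume n1: "(\<Sum>j<T * Suc n. mesh n * (g (Y (mesh n) w x (Suc j)) - gL L1 (Y (mesh n) w x (Suc j)))) < \<eta>"
      note int = step_set_integrable[OF mesh_pos[of n], of t]
      define r where "r = (LINT s:{0..t}|lborel. b (U n s) - bL (real L) (U n s))"
      have r_eq: "Sg (mesh n) w x t - (LINT s:{0..t}|lborel. bL (real L) (U n s)) = r"
        unfolding Sg_def r_def
        using set_integral_diff(2)[OF int[of "\<lambda>j. b (Y (mesh n) w x j)"] int[of "\<lambda>j. bL (real L) (Y (mesh n) w x j)"]] by (rule sym)
      have "norm r \<le> (LINT s:{0..t}|lborel. norm (b (U n s) - bL (real L) (U n s)))"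
        unfolding r_def
        by (rule set_integral_norm_bound[OF int[of "\<lambda>j. b (Y (mesh n) w x j) - bL (real L) (Y (mesh n) w x j)"]])
      also have "\<dots> \<le> (LINT s:{0..real T}|lborel. A * (g (U n s) - gL (real L) (U n s)))"
        unfolding set_lebesgue_integral_def
      proof (rule integral_mono_AE)
        show "integrable lborel (\<lambda>s. indicator {0..t} s *\<^sub>R norm (b (U n s) - bL (real L) (U n s)))"
          using int[of "\<lambda>j. norm (b (Y (mesh n) w x j) - bL (real L) (Y (mesh n) w x j))"] by (simp add: set_integrable_def)
        show "integrable lborel (\<lambda>s. indicator {0..real T} s *\<^sub>R (A * (g (U n s) - gL (real L) (U n s))))"
          using step_set_integrable[OF mesh_pos[of n], of "real T" "\<lambda>j. A * (g (Y (mesh n) w x j) - gL (real L) (Y (mesh n) w x j))"]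
          by (simp add: set_integrable_def)
        show "AE s in lborel. indicator {0..t} s *\<^sub>R norm (b (U n s) - bL (real L) (U n s))
            \<le> indicator {0..real T} s *\<^sub>R (A * (g (U n s) - gL (real L) (U n s)))"
          using AE_pos
        proof eventually_elim
          case (elim s)
          show ?case
          proof (cases "s \<in> {0..real T}")
            case True
            then have s: "0 < s" using elim by auto
            note UD = U_in_D[OF s, of n]
            have "0 \<le> A * (g (U n s) - gL (real L) (U n s))" using A_pos gL_le_g[OF UD] by simp
            then show ?thesis using True norm_b_diff_bL_le[OF UD, of "real L"] by (simp add: indicator_def)
          next
            case False
            then show ?thesis using t by (auto simp: indicator_def)
          qed
        qed
      qed
      also have "\<dots> = (\<Sum>j<T * Suc n. mesh n *\<^sub>R (A * (g (Y (mesh n) w x (Suc j)) - gL (real L) (Y (mesh n) w x (Suc j)))))"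
        using step_integral(2)[OF mesh_pos[of n], of "T * Suc n" "\<lambda>j. A * (g (Y (mesh n) w x j) - gL (real L) (Y (mesh n) w x j))"]
        unfolding mesh_mult .
      also have "\<dots> = A * (\<Sum>j<T * Suc n. mesh n * (g (Y (mesh n) w x (Suc j)) - gL (real L) (Y (mesh n) w x (Suc j))))"
        unfolding sum_distrib_left by (intro sum.cong refl) (simp add: mult.left_commute)
      also have "\<dots> \<le> A * (\<Sum>j<T * Suc n. mesh n * (g (Y (mesh n) w x (Suc j)) - gL L1 (Y (mesh n) w x (Suc j))))"
        using A_pos gL_mono[OF L(2)] by (intro mult_left_mono sum_mono diff_left_mono) (auto intro: less_imp_le)
      also have "\<dots> \<le> A * \<eta>" using n1 A_pos by (intro mult_left_mono) auto
      finally have "norm r \<le> e / 3" using \<eta>(2) by linarith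
      then have near: "norm (Sg (mesh n) w x t - (LINT s:{0..t}|lborel. bL (real L) (U n s))) \<le> e / 3" unfolding r_eq .
      have "norm (p - s) \<le> norm (p - q) + norm (q - r) + norm (r - s)" for p q r s :: 'v
        using norm_triangle_ineq[of "p - q" "q - r"] norm_triangle_ineq[of "p - r" "r - s"] by simp
      note this[of "Sg (mesh n) w x t" I "LINT s:{0..t}|lborel. bL (real L) (U n s)" "LINT s:{0..t}|lborel. bL (real L) (\<phi> s)"]
      with near show "norm (Sg (mesh n) w x t - I) < e"
        using n2 L(1) by linarith
    qed
  qed
  have "\<phi> t - (x + w t - w 0) - I = 0"
  proof (rule ccontr)
    assume ne: "\<phi> t - (x + w t - w 0) - I \<noteq> 0"
    have "(\<lambda>n. norm (Sg (mesh n) w x t - I)) \<longlonglongrightarrow> norm (\<phi> t - (x + w t - w 0) - I)"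
      by (intro tendsto_intros lim)
    then have "eventually (\<lambda>n. norm (\<phi> t - (x + w t - w 0) - I) / 2 < norm (Sg (mesh n) w x t - I)) sequentially"
      using ne by (intro order_tendstoD(1)) auto
    moreover have "\<exists>\<^sub>F n in sequentially. norm (Sg (mesh n) w x t - I) < norm (\<phi> t - (x + w t - w 0) - I) / 2"
      using ne by (intro freq) auto
    ultimately have "\<exists>\<^sub>F n in sequentially. False"
      by (elim frequently_rev_mp eventually_mono) simp
    then show False by simp
  qed
  then show ?thesis unfolding I_def[symmetric] by (simp add: algebra_simps)
qed

end
end

section \<open>Elementary estimates\<close>

text \<open>
  The point \<open>p\<close> of the convex hull closest to the origin satisfies \<open>p \<bullet> a\<^sub>j \<ge> |p|\<^sup>2\<close>, and it is not the
  origin because the hull lies in an open half space. Some of its coefficients may vanish; a small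
  multiple of the sum of all vectors makes them positive.
\<close>

lemma positive_combination_in_dual:
  fixes a :: "'i \<Rightarrow> 'v::euclidean_space"
  assumes S: "finite S" "S \<noteq> {}" and u: "\<And>i. i \<in> S \<Longrightarrow> 0 < a i \<bullet> u"
  obtains q where "\<And>i. i \<in> S \<Longrightarrow> 0 < q i" "\<And>j. j \<in> S \<Longrightarrow> 0 < (\<Sum>i\<in>S. q i *\<^sub>R a i) \<bullet> a j"
proof -
  let ?H = "convex hull (a ` S)"
  define p where "p = closest_point ?H 0"
  have fin: "finite (a ` S)" using S by simp
  have ne: "?H \<noteq> {}" using S by simp
  have cl: "closed ?H" using fin by (intro compact_imp_closed compact_convex_hull finite_imp_compact)
  have pH: "p \<in> ?H" unfolding p_def by (rule closest_point_in_set[OF cl ne])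
  have "?H \<subseteq> {y. 0 < u \<bullet> y}"
    using u by (intro hull_minimal convex_halfspace_gt) (auto simp: inner_commute)
  then have "p \<noteq> 0" using pH by auto
  then have p2: "0 < p \<bullet> p" by simp
  have pa: "p \<bullet> p \<le> p \<bullet> a j" if "j \<in> S" for j
    using closest_point_dot[OF convex_convex_hull cl hull_inc[of "a j" "a ` S"], of 0] that
    by (simp add: p_def[symmetric] inner_diff_right)
  obtain r where r: "\<And>y. y \<in> a ` S \<Longrightarrow> 0 \<le> r y" "(\<Sum>y\<in>a ` S. r y *\<^sub>R y) = p"
    using pH unfolding convex_hull_finite[OF fin] by auto
  \<comment> \<open>The hull gives coefficients for vectors; indices with the same vector share its coefficient.\<close>
  define q0 where "q0 i = r (a i) / real (card {j\<in>S. a j = a i})" for i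
  have q0: "0 \<le> q0 i" if "i \<in> S" for i using r(1)[of "a i"] that by (simp add: q0_def)
  have "(\<Sum>i\<in>S. q0 i *\<^sub>R a i) = (\<Sum>y\<in>a ` S. \<Sum>i\<in>{i\<in>S. a i = y}. q0 i *\<^sub>R a i)"
    by (rule sum.image_gen[OF S(1)])
  also have "\<dots> = (\<Sum>y\<in>a ` S. r y *\<^sub>R y)"
  proof (rule sum.cong[OF refl])
    fix y assume "y \<in> a ` S"
    then have "{i\<in>S. a i = y} \<noteq> {}" by auto
    then have n: "real (card {i\<in>S. a i = y}) \<noteq> 0" using S(1) by simp
    have "(\<Sum>i\<in>{i\<in>S. a i = y}. q0 i *\<^sub>R a i) = (\<Sum>i\<in>{i\<in>S. a i = y}. (r y / real (card {j\<in>S. a j = y})) *\<^sub>R y)"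
      by (intro sum.cong) (auto simp: q0_def)
    also have "\<dots> = r y *\<^sub>R y" using n by (simp add: sum_constant_scaleR)
    finally show "(\<Sum>i\<in>{i\<in>S. a i = y}. q0 i *\<^sub>R a i) = r y *\<^sub>R y" .
  qed
  finally have sum_q0: "(\<Sum>i\<in>S. q0 i *\<^sub>R a i) = p" using r(2) by simp
  define s where "s = (\<Sum>i\<in>S. a i)"
  define B where "B = 1 + (\<Sum>j\<in>S. \<bar>s \<bullet> a j\<bar>)"
  have B: "0 < B" "\<And>j. j \<in> S \<Longrightarrow> \<bar>s \<bullet> a j\<bar> \<le> B"
    unfolding B_def using member_le_sum[of _ S "\<lambda>j. \<bar>s \<bullet> a j\<bar>"] S(1)
    by (auto simp: add_pos_nonneg sum_nonneg intro: add_increasing)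
  \<comment> \<open>Small enough that the perturbation costs at most half of \<open>p \<bullet> p\<close>.\<close>
  define \<theta> where "\<theta> = p \<bullet> p / (2 * B)"
  have \<theta>: "0 < \<theta>" "\<theta> * B = p \<bullet> p / 2" using p2 B by (auto simp: \<theta>_def)
  show ?thesis
  proof (rule that[of "\<lambda>i. q0 i + \<theta>"])
    show "0 < q0 i + \<theta>" if "i \<in> S" for i using q0[OF that] \<theta> by simp
    fix j assume j: "j \<in> S"
    have "(\<Sum>i\<in>S. (q0 i + \<theta>) *\<^sub>R a i) = p + \<theta> *\<^sub>R s"
      by (simp add: scaleR_add_left sum.distrib sum_q0 s_def scaleR_sum_right)
    moreover have "\<theta> * (- (s \<bullet> a j)) \<le> \<theta> * B" using B(2)[OF j] \<theta>(1) by (intro mult_left_mono) auto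
    ultimately show "0 < (\<Sum>i\<in>S. (q0 i + \<theta>) *\<^sub>R a i) \<bullet> a j"
      using pa[OF j] p2 \<theta>(2) by (simp only: inner_add_left inner_scaleR_left)
  qed
qed

lemma sum_exp_le_inverse:
  fixes y :: real
  assumes "0 < y"
  shows "(\<Sum>i=1..n. exp (- real i * y)) \<le> 1 / y"
proof -
  define r where "r = exp (- y)"
  have r: "0 < r" "r < 1" using assms by (auto simp: r_def)
  have e: "exp (- real i * y) = r ^ i" for i
    by (simp add: r_def exp_of_nat_mult[symmetric] mult.commute)
  have "(\<Sum>i=1..n. r ^ i) * (1 - r) = r * (1 - r ^ n)"
    by (induction n) (simp_all add: distrib_right, simp add: algebra_simps)
  then have "(\<Sum>i=1..n. r ^ i) = r * (1 - r ^ n) / (1 - r)"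
    using r by (simp add: field_simps)
  also have "\<dots> \<le> r / (1 - r)"
    using r by (intro divide_right_mono) (auto simp: mult_left_le)
  also have "\<dots> \<le> 1 / y"
  proof -
    have "1 + y \<le> exp y" by (rule exp_ge_add_one_self)
    moreover have "exp y = 1 / r" by (simp add: r_def exp_minus field_simps)
    ultimately have "1 + y \<le> 1 / r" by simp
    then show ?thesis using r assms by (simp add: field_simps)
  qed
  finally show ?thesis by (simp only: e)
qed

lemma exp_half_minus_one_le:
  fixes u :: real
  assumes "0 \<le> u" "u \<le> 1"
  shows "exp (u / 2) - 1 \<le> u"
proof -
  have "exp (u / 2) \<le> 1 + u / 2 + (u / 2)\<^sup>2" using assms by (intro exp_bound) auto
  moreover have "(u / 2)\<^sup>2 \<le> u / 2"
    using assms mult_left_mono[of u 1 u] by (simp add: power2_eq_square)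
  ultimately show ?thesis by simp
qed

lemma harmonic_sum_unbounded:
  obtains n where "m \<le> n" "B \<le> (\<Sum>i=m..n. 1 / real i)"
proof -
  have "eventually (\<lambda>n. B + harm m \<le> (harm n :: real)) sequentially"
    using harm_at_top by (simp add: filterlim_at_top)
  then obtain n where n: "m \<le> n" "B + harm m \<le> (harm n :: real)"
    using eventually_happens'[OF sequentially_bot eventually_conj[OF _ eventually_ge_at_top[of m]]] by blast
  have "{1..n} \<subseteq> {1..m} \<union> {m..n}" by auto
  then have "(harm n :: real) \<le> (\<Sum>i\<in>{1..m} \<union> {m..n}. 1 / real i)"
    unfolding harm_def inverse_eq_divide by (intro sum_mono2) auto
  also have "\<dots> \<le> (\<Sum>i\<in>{1..m}. 1 / real i) + (\<Sum>i\<in>{m..n}. 1 / real i)"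
  proof -
    have "0 \<le> (\<Sum>i\<in>{1..m} \<inter> {m..n}. 1 / real i)" by (intro sum_nonneg) auto
    then show ?thesis
      using sum.union_inter[of "{1..m}" "{m..n}" "\<lambda>i. 1 / real i"] by simp
  qed
  finally show ?thesis using n that by (simp add: harm_def inverse_eq_divide)
qed

section \<open>The scheme driven by random increments\<close>

text \<open>
  The properties of the Brownian motion that the estimates need: independence of the
  increments from the past, and the exponential moments, mean and mean square of the increments. The initial value
  lies in the closed chamber at every sample point, so that the bounds valid on the chamber hold along
  the scheme from time \<open>0\<close> on.
\<close>

locale noisy_chamber = cot_chamber I a c k x0 + prob_space M
  for I :: "'i set" and a :: "'i \<Rightarrow> 'v::euclidean_space" and c k x0 and M :: "'w measure" +
  fixes G :: "real \<Rightarrow> 'w measure" and \<nu> :: "real \<Rightarrow> 'w \<Rightarrow> 'v" and \<xi> :: "'w \<Rightarrow> 'v"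
  assumes subalg: "subalgebra M (G t)"
    and G_mono: "0 \<le> s \<Longrightarrow> s \<le> t \<Longrightarrow> subalgebra (G t) (G s)"
    and nu_measurable: "0 \<le> t \<Longrightarrow> \<nu> t \<in> borel_measurable (G t)"
    and xi_measurable: "\<xi> \<in> borel_measurable (G 0)"
    and xi_in_Dc: "\<xi> \<omega> \<in> Dc"
    and increment_indep: "0 \<le> s \<Longrightarrow> s < t \<Longrightarrow>
      indep_set (sets (G s)) (sets (vimage_algebra (space M) (\<lambda>\<omega>. \<nu> t \<omega> - \<nu> s \<omega>) borel))"
    and increment_exp: "0 \<le> s \<Longrightarrow> s < t \<Longrightarrow>
      has_bochner_integral M (\<lambda>\<omega>. exp (u \<bullet> (\<nu> t \<omega> - \<nu> s \<omega>))) (exp ((norm u)\<^sup>2 * (t - s) / 2))"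
    and increment_mean: "0 \<le> s \<Longrightarrow> s < t \<Longrightarrow> has_bochner_integral M (\<lambda>\<omega>. u \<bullet> (\<nu> t \<omega> - \<nu> s \<omega>)) 0"
    and increment_square: "0 \<le> s \<Longrightarrow> s < t \<Longrightarrow>
      has_bochner_integral M (\<lambda>\<omega>. (norm (\<nu> t \<omega> - \<nu> s \<omega>))\<^sup>2) (real DIM('v) * (t - s))"
begin

abbreviation (input) V :: "real \<Rightarrow> nat \<Rightarrow> 'w \<Rightarrow> 'v" where
  "V h j \<omega> \<equiv> Y h (\<lambda>t. \<nu> t \<omega>) (\<xi> \<omega>) j"
abbreviation (input) \<Delta> :: "real \<Rightarrow> nat \<Rightarrow> 'w \<Rightarrow> 'v" where
  "\<Delta> h j \<omega> \<equiv> \<nu> (h * real (Suc j)) \<omega> - \<nu> (h * real j) \<omega>"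

lemma V_measurable_G: "0 < h \<Longrightarrow> V h j \<in> borel_measurable (G (h * real j))"
proof (induction j)
  case 0
  then show ?case using xi_measurable by simp
next
  case (Suc j)
  have le: "h * real j \<le> h * real (Suc j)" and nn: "0 \<le> h * real j" "0 \<le> h * real (Suc j)"
    using Suc.prems by auto
  note sub = measurable_from_subalg[OF G_mono[OF nn(1) le]]
  have [measurable]: "V h j \<in> borel_measurable (G (h * real (Suc j)))"
    "\<nu> (h * real j) \<in> borel_measurable (G (h * real (Suc j)))"
    "\<nu> (h * real (Suc j)) \<in> borel_measurable (G (h * real (Suc j)))"
    using sub[OF Suc.IH[OF Suc.prems]] sub[OF nu_measurable[OF nn(1)]] nu_measurable[OF nn(2)] by auto
  have [measurable]: "J h \<in> borel_measurable borel"
    using continuous_on_J[OF Suc.prems] by (rule borel_measurable_continuous_onI)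
  show ?case unfolding Y.simps(2) by measurable
qed

lemma V_measurable: "0 < h \<Longrightarrow> V h j \<in> borel_measurable M"
  using measurable_from_subalg[OF subalg V_measurable_G] .

lemma nu_measurable_M: "0 \<le> t \<Longrightarrow> \<nu> t \<in> borel_measurable M"
  using measurable_from_subalg[OF subalg nu_measurable] .

lemma increment_measurable: "0 < h \<Longrightarrow> \<Delta> h j \<in> borel_measurable M"
  by (intro borel_measurable_diff nu_measurable_M) auto

lemma indep_V_increment:
  assumes h: "0 < h"
  shows "indep_var borel (V h j) borel (\<Delta> h j)"
  unfolding indep_var_eq
proof (intro conjI V_measurable[OF h] increment_measurable[OF h])
  have 1: "indep_set (sets (G (h * real j))) (sets (vimage_algebra (space M) (\<Delta> h j) borel))"
    using h by (intro increment_indep) auto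
  have "sigma_sets (space M) {V h j -` B \<inter> space M |B. B \<in> sets borel} \<subseteq> sets (G (h * real j))"
    using measurable_sets[OF V_measurable_G[OF h, of j]] subalg[of "h * real j"]
      sets.sigma_sets_subset[of "{V h j -` B \<inter> space M |B. B \<in> sets borel}" "G (h * real j)"]
    by (auto simp: subalgebra_def)
  then show "indep_set (sigma_sets (space M) {V h j -` B \<inter> space M |B. B \<in> sets borel})
      (sigma_sets (space M) {\<Delta> h j -` B \<inter> space M |B. B \<in> sets borel})"
    using 1 unfolding indep_set_def sets_vimage_algebra
    by (elim indep_sets_mono_sets) (auto split: bool.split)
qed

lemma
  fixes f F :: "'v \<Rightarrow> real"
  assumes h: "0 < h" and [measurable]: "f \<in> borel_measurable borel" "F \<in> borel_measurable borel"
    and int: "integrable M (\<lambda>\<omega>. f (V h j \<omega>))" "integrable M (\<lambda>\<omega>. F (\<Delta> h j \<omega>))"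
  shows integrable_V_increment: "integrable M (\<lambda>\<omega>. f (V h j \<omega>) * F (\<Delta> h j \<omega>))"
    and expectation_V_increment:
      "expectation (\<lambda>\<omega>. f (V h j \<omega>) * F (\<Delta> h j \<omega>)) = expectation (\<lambda>\<omega>. f (V h j \<omega>)) * expectation (\<lambda>\<omega>. F (\<Delta> h j \<omega>))"
  using indep_var_compose[OF indep_V_increment[OF h, of j] assms(2,3)]
    indep_var_integrable indep_var_lebesgue_integral int by (auto simp: comp_def)

lemma V_in_Dc: "0 < h \<Longrightarrow> V h j \<omega> \<in> Dc"
  by (rule Y_in_Dc[OF _ xi_in_Dc])

lemma bounded_integrable:
  fixes f :: "'v \<Rightarrow> real"
  assumes h: "0 < h" and [measurable]: "f \<in> borel_measurable borel" and B: "\<And>y. y \<in> Dc \<Longrightarrow> \<bar>f y\<bar> \<le> B"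
  shows "integrable M (\<lambda>\<omega>. f (V h j \<omega>))"
proof (rule integrable_const_bound)
  show "AE \<omega> in M. norm (f (V h j \<omega>)) \<le> B" using B V_in_Dc[OF h] by simp
  show "(\<lambda>\<omega>. f (V h j \<omega>)) \<in> borel_measurable M" using V_measurable[OF h] by measurable
qed

text \<open>
  The expected time integral of \<open>f\<close> along the scheme, up to time \<open>h N\<close>. All estimates near the boundary
  are stated for this functional.
\<close>

definition mean_sum :: "real \<Rightarrow> nat \<Rightarrow> ('v \<Rightarrow> real) \<Rightarrow> real" where
  "mean_sum h N f = (\<Sum>j<N. h * expectation (\<lambda>\<omega>. f (V h (Suc j) \<omega>)))"

text \<open>
  The squared distance from \<open>x0\<close> satisfies a discrete Ito inequality: a step adds a martingale
  increment, the square of a noise increment, which has mean proportional to \<open>h\<close>, and a drift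
  term, which is at most \<open>C0 h - \<delta> h g\<close> up to a factor by coercivity. Summation bounds the mean of \<open>g\<close>.
\<close>

lemma energy:
  obtains C where "0 \<le> C"
    "\<And>h j. 0 < h \<Longrightarrow> integrable M (\<lambda>\<omega>. g (V h (Suc j) \<omega>))"
    "\<And>h N. 0 < h \<Longrightarrow> mean_sum h N g \<le> C * (1 + h * real N)"
proof -
  obtain \<delta> C0 where \<delta>: "0 < \<delta>" "0 \<le> C0" "\<And>x. x \<in> D \<Longrightarrow> b x \<bullet> (x - x0) \<le> C0 - \<delta> * g x"
    using b_coercive by blast
  obtain R where R: "0 < R" "\<And>x. x \<in> Dc \<Longrightarrow> norm x \<le> R" using Dc_bound by blast
  define f where "f y = (norm (y - x0))\<^sup>2" for y
  have f_meas [measurable]: "f \<in> borel_measurable borel" unfolding f_def by measurable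
  have f_bound: "\<bar>f y\<bar> \<le> (2 * R)\<^sup>2" if "y \<in> Dc" for y
  proof -
    have "norm (y - x0) \<le> 2 * R"
      using R(2)[OF that] R(2)[of x0] x0_in_D D_subset_Dc norm_triangle_ineq4[of y x0] by auto
    then show ?thesis unfolding f_def using power_mono[of "norm (y - x0)" "2 * R" 2] by simp
  qed
  have step: "2 * \<delta> * h * g (V h (Suc j) \<omega>) \<le> f (V h j \<omega>) - f (V h (Suc j) \<omega>)
      + 2 * ((V h j \<omega> - x0) \<bullet> \<Delta> h j \<omega>) + (norm (\<Delta> h j \<omega>))\<^sup>2 + 2 * C0 * h"
    if h: "0 < h" for h j \<omega>
  proof -
    let ?y = "V h j \<omega> - x0" and ?y' = "V h (Suc j) \<omega> - x0" and ?d = "\<Delta> h j \<omega>" and ?b = "b (V h (Suc j) \<omega>)"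
    have diff: "z = y + d + u \<Longrightarrow> z - x = (y - x) + d + u" for z y d u x :: 'v by simp
    have e: "?y' = ?y + ?d + h *\<^sub>R ?b" by (rule diff[OF Y_step[OF h]])
    have gen: "z = y + d + u \<Longrightarrow> (norm z)\<^sup>2 \<le> (norm y)\<^sup>2 + 2 * (y \<bullet> d) + (norm d)\<^sup>2 + 2 * (u \<bullet> z)" for z y d u :: 'v
    proof -
      assume z: "z = y + d + u"
      have "0 \<le> (z - (y + d)) \<bullet> (z - (y + d))" by simp
      moreover have "u = z - (y + d)" using z by simp
      ultimately show ?thesis
        by (simp add: power2_norm_eq_inner inner_diff_left inner_diff_right inner_add_left inner_add_right inner_commute)
    qed
    have "f (V h (Suc j) \<omega>) \<le> f (V h j \<omega>) + 2 * (?y \<bullet> ?d) + (norm ?d)\<^sup>2 + 2 * (h *\<^sub>R ?b \<bullet> ?y')"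
      unfolding f_def by (rule gen[OF e])
    moreover have "h *\<^sub>R ?b \<bullet> ?y' \<le> h * (C0 - \<delta> * g (V h (Suc j) \<omega>))"
      using mult_left_mono[OF \<delta>(3)[OF Y_in_D[OF h]], of h] h by (simp add: inner_scaleR_left)
    ultimately show ?thesis by (simp add: algebra_simps)
  qed
  \<comment> \<open>The position is bounded and independent of the noise increment, which has mean \<open>0\<close>.\<close>
  have cross: "has_bochner_integral M (\<lambda>\<omega>. (V h j \<omega> - x0) \<bullet> \<Delta> h j \<omega>) 0" if h: "0 < h" for h j
  proof -
    have "has_bochner_integral M (\<lambda>\<omega>. \<Sum>e\<in>Basis. (e \<bullet> (V h j \<omega> - x0)) * (e \<bullet> \<Delta> h j \<omega>)) (\<Sum>e\<in>(Basis::'v set). 0)"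
    proof (rule has_bochner_integral_sum)
      fix e :: 'v assume e: "e \<in> Basis"
      have d: "has_bochner_integral M (\<lambda>\<omega>. e \<bullet> \<Delta> h j \<omega>) 0" using h by (intro increment_mean) auto
      have B: "\<bar>e \<bullet> (y - x0)\<bar> \<le> 2 * R" if "y \<in> Dc" for y
      proof -
        have "\<bar>e \<bullet> (y - x0)\<bar> \<le> norm (y - x0)" using Basis_le_norm[OF e, of "y - x0"] by (simp add: inner_commute)
        then show ?thesis
          using R(2)[OF that] R(2)[of x0] x0_in_D D_subset_Dc norm_triangle_ineq4[of y x0] by auto
      qed
      have m: "(\<lambda>y. e \<bullet> (y - x0)) \<in> borel_measurable borel" "(\<lambda>y. e \<bullet> y) \<in> borel_measurable borel" by measurable
      have i1: "integrable M (\<lambda>\<omega>. e \<bullet> (V h j \<omega> - x0))" by (rule bounded_integrable[OF h m(1) B])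
      have i2: "integrable M (\<lambda>\<omega>. e \<bullet> \<Delta> h j \<omega>)" and e2: "expectation (\<lambda>\<omega>. e \<bullet> \<Delta> h j \<omega>) = 0"
        using d by (auto simp: has_bochner_integral_iff)
      show "has_bochner_integral M (\<lambda>\<omega>. (e \<bullet> (V h j \<omega> - x0)) * (e \<bullet> \<Delta> h j \<omega>)) 0"
        using integrable_V_increment[OF h m i1 i2] expectation_V_increment[OF h m i1 i2] e2
        by (simp add: has_bochner_integral_iff)
    qed
    moreover have "(\<Sum>e\<in>Basis. (e \<bullet> (V h j \<omega> - x0)) * (e \<bullet> \<Delta> h j \<omega>)) = (V h j \<omega> - x0) \<bullet> \<Delta> h j \<omega>" for \<omega>
      by (subst (3) euclidean_inner) (simp add: inner_commute)
    ultimately show ?thesis by simp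
  qed
  have rhs: "has_bochner_integral M (\<lambda>\<omega>. f (V h j \<omega>) - f (V h (Suc j) \<omega>)
      + 2 * ((V h j \<omega> - x0) \<bullet> \<Delta> h j \<omega>) + (norm (\<Delta> h j \<omega>))\<^sup>2 + 2 * C0 * h)
      (expectation (\<lambda>\<omega>. f (V h j \<omega>)) - expectation (\<lambda>\<omega>. f (V h (Suc j) \<omega>)) + 2 * 0 + real DIM('v) * h + 2 * C0 * h)"
    if h: "0 < h" for h j
  proof -
    have f: "has_bochner_integral M (\<lambda>\<omega>. f (V h i \<omega>)) (expectation (\<lambda>\<omega>. f (V h i \<omega>)))" for i
      using bounded_integrable[OF h f_meas f_bound] by (rule has_bochner_integral_integrable)
    have sq: "has_bochner_integral M (\<lambda>\<omega>. (norm (\<Delta> h j \<omega>))\<^sup>2) (real DIM('v) * h)"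
      using increment_square[of "h * real j" "h * real (Suc j)"] h by (simp add: algebra_simps)
    have const: "has_bochner_integral M (\<lambda>\<omega>. 2 * C0 * h) (2 * C0 * h)"
      by (simp add: has_bochner_integral_iff prob_space)
    show ?thesis
      by (intro has_bochner_integral_add[OF _ const] has_bochner_integral_add[OF _ sq]
          has_bochner_integral_add[OF has_bochner_integral_diff[OF f f]] has_bochner_integral_mult_right cross h)
  qed
  have g_int: "integrable M (\<lambda>\<omega>. g (V h (Suc j) \<omega>))" if h: "0 < h" for h j
  proof -
    have "integrable M (\<lambda>\<omega>. 2 * \<delta> * h * g (V h (Suc j) \<omega>))"
    proof (rule Bochner_Integration.integrable_bound)
      show "integrable M (\<lambda>\<omega>. f (V h j \<omega>) - f (V h (Suc j) \<omega>)
        + 2 * ((V h j \<omega> - x0) \<bullet> \<Delta> h j \<omega>) + (norm (\<Delta> h j \<omega>))\<^sup>2 + 2 * C0 * h)"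
        using rhs[OF h] by (simp only: has_bochner_integral_iff)
      show "AE \<omega> in M. norm (2 * \<delta> * h * g (V h (Suc j) \<omega>)) \<le> norm (f (V h j \<omega>) - f (V h (Suc j) \<omega>)
        + 2 * ((V h j \<omega> - x0) \<bullet> \<Delta> h j \<omega>) + (norm (\<Delta> h j \<omega>))\<^sup>2 + 2 * C0 * h)"
      proof (rule AE_I2)
        fix \<omega>
        have "0 \<le> 2 * \<delta> * h * g (V h (Suc j) \<omega>)" using g_nonneg[OF Y_in_D[OF h]] \<delta> h by simp
        with step[OF h, of \<omega> j] show "norm (2 * \<delta> * h * g (V h (Suc j) \<omega>)) \<le> norm (f (V h j \<omega>) - f (V h (Suc j) \<omega>)
          + 2 * ((V h j \<omega> - x0) \<bullet> \<Delta> h j \<omega>) + (norm (\<Delta> h j \<omega>))\<^sup>2 + 2 * C0 * h)"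
          unfolding real_norm_def by linarith
      qed
    qed (use V_measurable[OF h, of "Suc j"] in measurable)
    then show ?thesis using \<delta> h by simp
  qed
  define C where "C = ((2 * R)\<^sup>2 + real DIM('v) + 2 * C0) / (2 * \<delta>)"
  have Cpos: "0 \<le> C" using \<delta> by (simp add: C_def)
  have sum: "mean_sum h N g \<le> C * (1 + h * real N)" if h: "0 < h" for h N
  proof -
    let ?E = "\<lambda>j. expectation (\<lambda>\<omega>. f (V h j \<omega>))"
    have "2 * \<delta> * (h * expectation (\<lambda>\<omega>. g (V h (Suc j) \<omega>))) \<le> ?E j - ?E (Suc j) + (real DIM('v) + 2 * C0) * h" for j
    proof -
      have "expectation (\<lambda>\<omega>. 2 * \<delta> * h * g (V h (Suc j) \<omega>)) \<le> expectation (\<lambda>\<omega>. f (V h j \<omega>) - f (V h (Suc j) \<omega>)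
        + 2 * ((V h j \<omega> - x0) \<bullet> \<Delta> h j \<omega>) + (norm (\<Delta> h j \<omega>))\<^sup>2 + 2 * C0 * h)"
        using rhs[OF h, of j] g_int[OF h] by (intro integral_mono step[OF h]) (auto simp: has_bochner_integral_iff)
      also have "\<dots> = ?E j - ?E (Suc j) + 2 * 0 + real DIM('v) * h + 2 * C0 * h"
        using rhs[OF h, of j] by (simp only: has_bochner_integral_iff)
      finally show ?thesis by (simp add: algebra_simps)
    qed
    then have "(\<Sum>j<N. 2 * \<delta> * (h * expectation (\<lambda>\<omega>. g (V h (Suc j) \<omega>)))) \<le> (\<Sum>j<N. ?E j - ?E (Suc j) + (real DIM('v) + 2 * C0) * h)"
      by (intro sum_mono)
    also have "\<dots> = ?E 0 - ?E N + (real DIM('v) + 2 * C0) * (h * real N)"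
      using sum_lessThan_telescope'[of ?E N] by (simp add: sum.distrib)
    also have "\<dots> \<le> (2 * R)\<^sup>2 + (real DIM('v) + 2 * C0) * (h * real N)"
    proof -
      have "?E 0 \<le> expectation (\<lambda>_. (2 * R)\<^sup>2)"
        by (intro integral_mono bounded_integrable[OF h f_meas f_bound] integrable_const abs_le_D1[OF f_bound] V_in_Dc[OF h])
      moreover have "0 \<le> ?E N" by (intro integral_nonneg_AE) (simp add: f_def)
      ultimately show ?thesis by (simp add: prob_space)
    qed
    also have "\<dots> \<le> ((2 * R)\<^sup>2 + real DIM('v) + 2 * C0) * (1 + h * real N)"
    proof -
      have "0 \<le> (2 * R)\<^sup>2 * (h * real N)" using h by simp
      moreover have "0 \<le> real DIM('v) + 2 * C0" using \<delta> by simp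
      ultimately show ?thesis by (simp add: algebra_simps)
    qed
    finally have "2 * \<delta> * mean_sum h N g \<le> ((2 * R)\<^sup>2 + real DIM('v) + 2 * C0) * (1 + h * real N)"
      by (simp add: mean_sum_def sum_distrib_left)
    then show ?thesis using \<delta> unfolding C_def by (simp add: field_simps)
  qed
  show ?thesis using that[OF Cpos g_int sum] by blast
qed

end

section \<open>Functions controlled by the repulsion\<close>

context cot_chamber
begin

text \<open>
  The weighted sum of the forms that vanish on a face measures the distance from the face.
\<close>

definition lin :: "('i \<Rightarrow> real) \<Rightarrow> 'i set \<Rightarrow> 'v \<Rightarrow> real" where "lin q S y = (\<Sum>i\<in>S. q i * X i y)"
definition grad :: "('i \<Rightarrow> real) \<Rightarrow> 'i set \<Rightarrow> 'v" where "grad q S = (\<Sum>i\<in>S. q i *\<^sub>R a i)"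

lemma lin_diff: "lin q S y - lin q S z = grad q S \<bullet> (y - z)"
  by (simp add: lin_def grad_def inner_sum_left X_diff[symmetric] sum_subtractf[symmetric] right_diff_distrib)

lemma lin_measurable [measurable]: "lin q S \<in> borel_measurable borel"
  unfolding lin_def by measurable

lemma lin_ge:
  assumes "S \<subseteq> I" "\<And>i. i \<in> S \<Longrightarrow> 0 < q i" "y \<in> D" "i \<in> S"
  shows "q i * X i y \<le> lin q S y" "0 < lin q S y"
proof -
  have "finite S" using finite_subset[OF assms(1) finite_I] .
  moreover have "0 \<le> q j * X j y" if "j \<in> S" for j
    using assms(1) assms(2)[OF that] D_X(1)[OF assms(3), of j] that by (auto intro!: mult_nonneg_nonneg less_imp_le)
  ultimately show "q i * X i y \<le> lin q S y" unfolding lin_def using assms(4) by (intro member_le_sum) auto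
  moreover have "0 < q i * X i y" using assms D_X(1)[OF assms(3), of i] by auto
  ultimately show "0 < lin q S y" by linarith
qed

lemma inverse_lin_le:
  assumes "S \<subseteq> I" "S \<noteq> {}" "\<And>i. i \<in> S \<Longrightarrow> 0 < q i"
  obtains K where "0 < K" "\<And>y. y \<in> D \<Longrightarrow> 1 / lin q S y \<le> K * (1 + g y)"
proof -
  obtain i where i: "i \<in> S" "i \<in> I" using assms by blast
  have p: "0 < q i" "0 < k i" using assms(3) k_pos i by auto
  show ?thesis
  proof (rule that[of "(1 / q i) * (1 + 1 / k i)"])
    show "0 < (1 / q i) * (1 + 1 / k i)" using p by (simp add: add_pos_pos)
    fix y assume y: "y \<in> D"
    have "1 / lin q S y \<le> 1 / (q i * X i y)"
      using lin_ge[OF assms(1,3) y i(1)] p D_X[OF y i(2)] by (intro divide_left_mono) auto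
    also have "\<dots> = (1 / q i) * (1 / X i y)" by simp
    also have "\<dots> \<le> (1 / q i) * (cot (X i y) + 1)"
      using p inverse_le_cot_plus_one[OF D_X(1,2)[OF y i(2)]] by (intro mult_left_mono) auto
    also have "\<dots> \<le> (1 / q i) * ((1 + 1 / k i) * (1 + g y))"
    proof (intro mult_left_mono)
      have "cot (X i y) \<le> (1 / k i) * g y" using g_term_le[OF y i(2)] p by (simp add: field_simps)
      then show "cot (X i y) + 1 \<le> (1 + 1 / k i) * (1 + g y)"
        using g_nonneg[OF y] p by (simp add: algebra_simps add_increasing)
    qed (use p in simp)
    finally show "1 / lin q S y \<le> (1 / q i) * (1 + 1 / k i) * (1 + g y)" by (simp add: mult.assoc)
  qed
qed

text \<open>
  The functions whose expected time integrals are finite by the energy estimate. Only their values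
  on the open chamber matter, where the scheme lives after its first step.
\<close>

definition adm :: "('v \<Rightarrow> real) \<Rightarrow> bool" where
  "adm f \<longleftrightarrow> f \<in> borel_measurable borel \<and> (\<exists>B. \<forall>y\<in>D. \<bar>f y\<bar> \<le> B * (1 + g y))"

lemma admI: "f \<in> borel_measurable borel \<Longrightarrow> (\<And>y. y \<in> D \<Longrightarrow> \<bar>f y\<bar> \<le> B * (1 + g y)) \<Longrightarrow> adm f"
  unfolding adm_def by blast

lemma adm_bounded: "f \<in> borel_measurable borel \<Longrightarrow> (\<And>y. y \<in> D \<Longrightarrow> \<bar>f y\<bar> \<le> B) \<Longrightarrow> adm f"
proof (rule admI[of _ "\<bar>B\<bar>"])
  fix y assume B: "\<And>y. y \<in> D \<Longrightarrow> \<bar>f y\<bar> \<le> B" and y: "y \<in> D"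
  have "\<bar>B\<bar> * 1 \<le> \<bar>B\<bar> * (1 + g y)" using g_nonneg[OF y] by (intro mult_left_mono) auto
  then show "\<bar>f y\<bar> \<le> \<bar>B\<bar> * (1 + g y)" using B[OF y] by linarith
qed

lemma adm_const: "adm (\<lambda>_. r)" by (rule adm_bounded[of _ "\<bar>r\<bar>"]) auto

lemma adm_g: "adm g"
  by (rule admI[of _ 1]) (use g_nonneg in \<open>auto simp: g_measurable\<close>)

lemma adm_gL: assumes "0 \<le> L" shows "adm (gL L)"
  by (rule admI[of _ 1]) (use gL_nonneg[OF assms] gL_le_g[of _ L] D_subset_Dc in \<open>force simp: gL_measurable\<close>)+

lemma adm_add: assumes "adm f" "adm f'" shows "adm (\<lambda>y. f y + f' y)"
proof -
  obtain B B' where B: "\<And>y. y \<in> D \<Longrightarrow> \<bar>f y\<bar> \<le> B * (1 + g y)" "\<And>y. y \<in> D \<Longrightarrow> \<bar>f' y\<bar> \<le> B' * (1 + g y)"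
    using assms unfolding adm_def by blast
  show ?thesis
  proof (rule admI[of _ "B + B'"])
    show "(\<lambda>y. f y + f' y) \<in> borel_measurable borel" using assms by (auto simp: adm_def)
    fix y assume "y \<in> D"
    from B(1)[OF this] B(2)[OF this] show "\<bar>f y + f' y\<bar> \<le> (B + B') * (1 + g y)"
      by (simp only: distrib_right)
  qed
qed

lemma adm_mult_bounded:
  assumes "f \<in> borel_measurable borel" "\<And>y. y \<in> D \<Longrightarrow> \<bar>f y\<bar> \<le> C" "adm f'"
  shows "adm (\<lambda>y. f y * f' y)"
proof -
  obtain B where B: "\<And>y. y \<in> D \<Longrightarrow> \<bar>f' y\<bar> \<le> B * (1 + g y)"
    using assms unfolding adm_def by blast
  show ?thesis
  proof (rule admI[of _ "C * B"])
    show "(\<lambda>y. f y * f' y) \<in> borel_measurable borel" using assms by (auto simp: adm_def)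
    fix y assume y: "y \<in> D"
    have "\<bar>f y\<bar> * \<bar>f' y\<bar> \<le> C * (B * (1 + g y))"
      using B[OF y] assms(2)[OF y] by (intro mult_mono) auto
    then show "\<bar>f y * f' y\<bar> \<le> C * B * (1 + g y)" by (simp add: abs_mult mult.assoc)
  qed
qed

lemma adm_cmult: "adm f \<Longrightarrow> adm (\<lambda>y. r * f y)"
  by (rule adm_mult_bounded[of _ "\<bar>r\<bar>"]) auto

lemma adm_sum: "(\<And>i. i \<in> S \<Longrightarrow> adm (f i)) \<Longrightarrow> adm (\<lambda>y. \<Sum>i\<in>S. f i y)"
  by (induction S rule: infinite_finite_induct) (auto intro: adm_const adm_add)

lemma adm_diff: "adm f \<Longrightarrow> adm f' \<Longrightarrow> adm (\<lambda>y. f y - f' y)"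
  using adm_add[of f "\<lambda>y. (-1) * f' y"] adm_cmult[of f' "-1"] by simp

lemma adm_inner_b: "adm (\<lambda>y. v \<bullet> b y)"
proof (rule admI[of _ "norm v * A"])
  fix y assume y: "y \<in> D"
  have "\<bar>v \<bullet> b y\<bar> \<le> norm v * norm (b y)" by (rule Cauchy_Schwarz_ineq2)
  also have "\<dots> \<le> norm v * (A * (1 + g y))"
    using norm_b_le[OF y] A_pos by (intro mult_left_mono) (auto simp: distrib_left)
  finally show "\<bar>v \<bullet> b y\<bar> \<le> norm v * A * (1 + g y)" by (simp add: mult.assoc)
qed measurable

lemma adm_indicator: "adm f \<Longrightarrow> Measurable.pred borel P \<Longrightarrow> adm (\<lambda>y. if P y then f y else 0)"
proof -
  assume f: "adm f" and [measurable]: "Measurable.pred borel P"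
  have "adm (\<lambda>y. (if P y then 1 else 0) * f y)"
  proof (rule adm_mult_bounded[OF _ _ f])
    show "(\<lambda>y. if P y then 1 else 0 :: real) \<in> borel_measurable borel" by measurable
    show "\<bar>if P y then 1 else 0\<bar> \<le> (1::real)" for y by simp
  qed
  moreover have "(\<lambda>y. (if P y then 1 else 0) * f y) = (\<lambda>y. if P y then f y else 0)" by auto
  ultimately show ?thesis by simp
qed

end

context noisy_chamber
begin

lemma adm_integrable: assumes "adm f" "0 < h" shows "integrable M (\<lambda>\<omega>. f (V h (Suc j) \<omega>))"
proof -
  obtain B where B: "\<And>y. y \<in> D \<Longrightarrow> \<bar>f y\<bar> \<le> B * (1 + g y)" and [measurable]: "f \<in> borel_measurable borel"
    using assms unfolding adm_def by blast
  have gi: "integrable M (\<lambda>\<omega>. g (V h (Suc j) \<omega>))" using energy assms(2) by metis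
  show ?thesis
  proof (rule Bochner_Integration.integrable_bound)
    show "integrable M (\<lambda>\<omega>. B * (1 + g (V h (Suc j) \<omega>)))" using gi by simp
    show "(\<lambda>\<omega>. f (V h (Suc j) \<omega>)) \<in> borel_measurable M" using V_measurable[OF assms(2)] by measurable
    show "AE \<omega> in M. norm (f (V h (Suc j) \<omega>)) \<le> norm (B * (1 + g (V h (Suc j) \<omega>)))"
      using B[OF Y_in_D[OF assms(2)]] by (intro AE_I2) (simp only: real_norm_def, meson abs_ge_self order_trans)
  qed
qed

lemma mean_sum_mono:
  assumes "adm f" "adm f'" "0 < h" "\<And>y. y \<in> D \<Longrightarrow> f y \<le> f' y"
  shows "mean_sum h N f \<le> mean_sum h N f'"
  unfolding mean_sum_def using assms(3)
  by (intro sum_mono mult_left_mono integral_mono adm_integrable assms Y_in_D) auto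

lemma mean_sum_add: "adm f \<Longrightarrow> adm f' \<Longrightarrow> 0 < h \<Longrightarrow> mean_sum h N (\<lambda>y. f y + f' y) = mean_sum h N f + mean_sum h N f'"
  unfolding mean_sum_def by (simp add: adm_integrable sum.distrib distrib_left)

lemma mean_sum_cmult: "mean_sum h N (\<lambda>y. r * f y) = r * mean_sum h N f"
  unfolding mean_sum_def by (simp add: sum_distrib_left mult.left_commute)

lemma mean_sum_sum:
  assumes "finite S" "\<And>i. i \<in> S \<Longrightarrow> adm (f i)" "0 < h"
  shows "mean_sum h N (\<lambda>y. \<Sum>i\<in>S. f i y) = (\<Sum>i\<in>S. mean_sum h N (f i))"
  using assms(1,2)
proof (induction S rule: finite_induct)
  case empty
  then show ?case by (simp add: mean_sum_def)
next
  case (insert i S)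
  then show ?case using mean_sum_add[OF _ adm_sum assms(3), of "f i" S f N] by auto
qed

lemma mean_sum_const: "mean_sum h N (\<lambda>_. r) = r * (h * real N)"
  by (simp add: mean_sum_def prob_space)

section \<open>Exponential test functions\<close>

text \<open>
  One step of Ito's formula for \<open>exp (-l \<cdot> lin)\<close>. The noise contributes its exponential moment exactly,
  by independence; for the implicit drift the convexity inequality \<open>exp u \<ge> 1 + u\<close> points in the
  direction that is needed, so there is no remainder to estimate.
\<close>

lemma dynkin_step:
  assumes h: "0 < h" and S: "S \<subseteq> I" "\<And>i. i \<in> S \<Longrightarrow> 0 < q i" and l: "0 < l"
  defines "\<theta> \<equiv> \<lambda>y. exp (- l * lin q S y)"
  shows "l * (h * expectation (\<lambda>\<omega>. \<theta> (V h (Suc j) \<omega>) * (grad q S \<bullet> b (V h (Suc j) \<omega>)))) + expectation (\<lambda>\<omega>. \<theta> (V h (Suc j) \<omega>))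
    \<le> exp (l\<^sup>2 * (norm (grad q S))\<^sup>2 * h / 2) * expectation (\<lambda>\<omega>. \<theta> (V h j \<omega>))"
proof -
  let ?v = "grad q S"
  have [measurable]: "\<theta> \<in> borel_measurable borel" unfolding \<theta>_def by measurable
  have nonneg: "0 \<le> lin q S y" if "y \<in> Dc" for y
    unfolding lin_def using S that by (intro sum_nonneg mult_nonneg_nonneg) (auto simp: Dc_def intro: less_imp_le)
  have \<theta>1: "\<bar>\<theta> y\<bar> \<le> 1" if "y \<in> Dc" for y
    using nonneg[OF that] l by (simp add: \<theta>_def)
  have adm1: "adm \<theta>" by (rule adm_bounded[of _ 1]) (use \<theta>1 D_subset_Dc in auto)
  have adm2: "adm (\<lambda>y. \<theta> y * (?v \<bullet> b y))"
    by (rule adm_mult_bounded[OF _ _ adm_inner_b, of _ 1]) (use \<theta>1 D_subset_Dc in auto)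
  note i1 = adm_integrable[OF adm1 h, of j] and i2 = adm_integrable[OF adm2 h, of j]
  have em: "has_bochner_integral M (\<lambda>\<omega>. exp ((- l *\<^sub>R ?v) \<bullet> \<Delta> h j \<omega>)) (exp (l\<^sup>2 * (norm ?v)\<^sup>2 * h / 2))"
    using increment_exp[of "h * real j" "h * real (Suc j)" "- l *\<^sub>R ?v"] h
    by (simp add: algebra_simps power_mult_distrib)
  have i3: "integrable M (\<lambda>\<omega>. \<theta> (V h j \<omega>))" by (rule bounded_integrable[OF h _ \<theta>1]) auto
  have i4: "integrable M (\<lambda>\<omega>. (\<lambda>z. exp ((- l *\<^sub>R ?v) \<bullet> z)) (\<Delta> h j \<omega>))"
    using em by (simp only: has_bochner_integral_iff)
  have m4: "(\<lambda>z. exp ((- l *\<^sub>R ?v) \<bullet> z)) \<in> borel_measurable borel" by measurable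
  have i5: "integrable M (\<lambda>\<omega>. \<theta> (V h j \<omega>) * exp ((- l *\<^sub>R ?v) \<bullet> \<Delta> h j \<omega>))"
    by (rule integrable_V_increment[OF h _ m4 i3 i4]) measurable
  have e5: "expectation (\<lambda>\<omega>. \<theta> (V h j \<omega>) * exp ((- l *\<^sub>R ?v) \<bullet> \<Delta> h j \<omega>))
      = expectation (\<lambda>\<omega>. \<theta> (V h j \<omega>)) * exp (l\<^sup>2 * (norm ?v)\<^sup>2 * h / 2)"
    using expectation_V_increment[OF h _ m4 i3 i4] em by (simp add: has_bochner_integral_iff)
  have pw: "l * h * (\<theta> (V h (Suc j) \<omega>) * (?v \<bullet> b (V h (Suc j) \<omega>))) + \<theta> (V h (Suc j) \<omega>)
      \<le> \<theta> (V h j \<omega>) * exp ((- l *\<^sub>R ?v) \<bullet> \<Delta> h j \<omega>)" for \<omega>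
  proof -
    let ?y = "V h j \<omega>" and ?y' = "V h (Suc j) \<omega>" and ?d = "\<Delta> h j \<omega>"
    have diff: "z = y + d + u \<Longrightarrow> z - y = d + u" for z y d u :: 'v by simp
    have "lin q S ?y' - lin q S ?y = ?v \<bullet> (?d + h *\<^sub>R b ?y')"
      unfolding lin_diff by (rule arg_cong[OF diff[OF Y_step[OF h]]])
    then have ly: "lin q S ?y + ?v \<bullet> ?d = lin q S ?y' - h * (?v \<bullet> b ?y')"
      by (simp only: inner_add_right inner_scaleR_right)
    have "\<theta> ?y * exp ((- l *\<^sub>R ?v) \<bullet> ?d) = exp (- l * (lin q S ?y + ?v \<bullet> ?d))"
      by (simp add: \<theta>_def exp_add[symmetric] algebra_simps)
    also have "\<dots> = exp (- l * (lin q S ?y' - h * (?v \<bullet> b ?y')))" by (simp only: ly)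
    also have "\<dots> = \<theta> ?y' * exp (l * h * (?v \<bullet> b ?y'))"
      by (simp add: \<theta>_def exp_add[symmetric] algebra_simps)
    also have "\<dots> \<ge> \<theta> ?y' * (1 + l * h * (?v \<bullet> b ?y'))"
      by (intro mult_left_mono exp_ge_add_one_self) (simp add: \<theta>_def)
    finally show ?thesis by (simp add: algebra_simps)
  qed
  have "expectation (\<lambda>\<omega>. l * h * (\<theta> (V h (Suc j) \<omega>) * (?v \<bullet> b (V h (Suc j) \<omega>))) + \<theta> (V h (Suc j) \<omega>))
    \<le> expectation (\<lambda>\<omega>. \<theta> (V h j \<omega>) * exp ((- l *\<^sub>R ?v) \<bullet> \<Delta> h j \<omega>))"
    using i1 i2 i5 by (intro integral_mono pw) auto
  then show ?thesis using i1 i2 e5 by (simp add: mult.commute mult.left_commute)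
qed

text \<open>
  Summation of the single steps. The sum over the old positions becomes a sum over the new ones at the cost of
  one term, hence the additional \<open>h\<close>.
\<close>

lemma dynkin_exp:
  assumes h: "0 < h" and S: "S \<subseteq> I" "\<And>i. i \<in> S \<Longrightarrow> 0 < q i" and l: "0 < l"
    and small: "l\<^sup>2 * (norm (grad q S))\<^sup>2 * h \<le> 1"
  shows "mean_sum h N (\<lambda>y. exp (- l * lin q S y) * (grad q S \<bullet> b y))
    \<le> 1 / l + l * (norm (grad q S))\<^sup>2 * (mean_sum h N (\<lambda>y. exp (- l * lin q S y)) + h)"
proof -
  define \<theta> where "\<theta> = (\<lambda>y. exp (- l * lin q S y))"
  let ?v = "grad q S"
  define w where "w = l\<^sup>2 * (norm ?v)\<^sup>2 * h"
  let ?E = "\<lambda>j. expectation (\<lambda>\<omega>. \<theta> (V h j \<omega>))"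
  have w: "0 \<le> w" "w \<le> 1" using small h by (auto simp: w_def)
  have [measurable]: "\<theta> \<in> borel_measurable borel" unfolding \<theta>_def by measurable
  have nonneg: "0 \<le> lin q S y" if "y \<in> Dc" for y
    unfolding lin_def using S that by (intro sum_nonneg mult_nonneg_nonneg) (auto simp: Dc_def intro: less_imp_le)
  have \<theta>1: "\<bar>\<theta> y\<bar> \<le> 1" if "y \<in> Dc" for y
    using nonneg[OF that] l by (simp add: \<theta>_def)
  have E: "0 \<le> ?E j" "?E j \<le> 1" for j
  proof -
    show "0 \<le> ?E j" by (intro integral_nonneg_AE) (simp add: \<theta>_def)
    have "?E j \<le> expectation (\<lambda>_. 1)"
      by (intro integral_mono bounded_integrable[OF h _ \<theta>1] integrable_const abs_le_D1[OF \<theta>1] V_in_Dc[OF h]) measurable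
    then show "?E j \<le> 1" by (simp add: prob_space)
  qed
  have "l * (h * expectation (\<lambda>\<omega>. \<theta> (V h (Suc j) \<omega>) * (?v \<bullet> b (V h (Suc j) \<omega>)))) \<le> ?E j - ?E (Suc j) + w * ?E j" for j
  proof -
    have "exp (w / 2) * ?E j \<le> (1 + w) * ?E j"
      using exp_half_minus_one_le[OF w] E by (intro mult_right_mono) auto
    then show ?thesis
      using dynkin_step[where q = q and S = S and l = l and h = h and j = j, OF h S l] unfolding \<theta>_def w_def[symmetric] by (simp add: distrib_right)
  qed
  then have "(\<Sum>j<N. l * (h * expectation (\<lambda>\<omega>. \<theta> (V h (Suc j) \<omega>) * (?v \<bullet> b (V h (Suc j) \<omega>)))))
    \<le> (\<Sum>j<N. ?E j - ?E (Suc j) + w * ?E j)" by (intro sum_mono)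
  then have "l * mean_sum h N (\<lambda>y. \<theta> y * (?v \<bullet> b y)) \<le> (\<Sum>j<N. ?E j - ?E (Suc j) + w * ?E j)"
    by (simp add: mean_sum_def sum_distrib_left)
  also have "\<dots> = ?E 0 - ?E N + w * (\<Sum>j<N. ?E j)"
    using sum_lessThan_telescope'[of ?E N] by (simp add: sum.distrib sum_distrib_left)
  also have "\<dots> \<le> 1 + w * ((\<Sum>j<N. ?E (Suc j)) + 1)"
  proof -
    have "(\<Sum>j<N. ?E j) + ?E N = ?E 0 + (\<Sum>j<N. ?E (Suc j))"
      using sum.lessThan_Suc[of ?E N] sum.lessThan_Suc_shift[of ?E N] by linarith
    then have "(\<Sum>j<N. ?E j) \<le> (\<Sum>j<N. ?E (Suc j)) + 1" using E(1)[of N] E(2)[of 0] by linarith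
    then have "w * (\<Sum>j<N. ?E j) \<le> w * ((\<Sum>j<N. ?E (Suc j)) + 1)" using w by (intro mult_left_mono)
    then show ?thesis using E(1)[of N] E(2)[of 0] by linarith
  qed
  also have "\<dots> = l * (1 / l + l * (norm ?v)\<^sup>2 * (mean_sum h N \<theta> + h))"
    using l by (simp add: w_def mean_sum_def sum_distrib_left[symmetric] field_simps power2_eq_square)
  finally show ?thesis using l unfolding \<theta>_def by simp
qed

lemma mean_sum_one_plus_g:
  fixes T :: nat
  obtains P where "0 \<le> P" "\<And>n. mean_sum (mesh n) (T * Suc n) (\<lambda>y. 1 + g y) \<le> P"
proof -
  obtain C where C: "0 \<le> C" "\<And>h N. 0 < h \<Longrightarrow> mean_sum h N g \<le> C * (1 + h * real N)"
    using energy by metis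
  show ?thesis
  proof (rule that[of "real T + C * (1 + real T)"])
    fix n
    have "mean_sum (mesh n) (T * Suc n) (\<lambda>y. 1 + g y) = real T + mean_sum (mesh n) (T * Suc n) g"
      using mean_sum_add[where h = "mesh n" and N = "T * Suc n", OF adm_const[of 1] adm_g mesh_pos]
      by (simp only: mean_sum_const mesh_mult mult_1)
    also have "\<dots> \<le> real T + C * (1 + real T)"
      using C(2)[OF mesh_pos, of n "T * Suc n"] by (simp only: mesh_mult)
    finally show "mean_sum (mesh n) (T * Suc n) (\<lambda>y. 1 + g y) \<le> real T + C * (1 + real T)" .
  qed (use C in simp)
qed

text \<open>
  The function is the mixture of \<open>x \<mapsto> exp (-i x)\<close>, \<open>i = m, ..., n\<close>, with weights \<open>1/(i H)\<close>, where \<open>H\<close> is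
  the sum of the \<open>1/i\<close>. In the mixture of the bounds from \<open>dynkin_exp\<close> the first-order term is at most
  \<open>1/m\<close>, and the factor \<open>i\<close> of the second-order term cancels against the weight, which leaves a
  multiple of \<open>(1/H) \<Sum> exp (-i x) \<le> 1/(H x)\<close>. The mean of \<open>1/x\<close> at \<open>x = lin q S y\<close> is bounded by the energy
  estimate, and \<open>H\<close> can be made large after \<open>m\<close> has been chosen.
\<close>

lemma test_function:
  fixes T :: nat
  assumes S: "S \<subseteq> I" "S \<noteq> {}" "\<And>i. i \<in> S \<Longrightarrow> 0 < q i" and \<eta>: "0 < \<eta>"
  obtains F :: "real \<Rightarrow> real" and \<rho> where "0 < \<rho>" "F \<in> borel_measurable borel"
    "\<And>x. 0 < x \<Longrightarrow> 0 \<le> F x" "\<And>x. 0 < x \<Longrightarrow> F x \<le> 1" "\<And>x. 0 < x \<Longrightarrow> F x \<le> \<eta> / x"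
    "\<And>x. 0 < x \<Longrightarrow> x \<le> \<rho> \<Longrightarrow> 1 / 4 \<le> F x"
    "eventually (\<lambda>n. mean_sum (mesh n) (T * Suc n) (\<lambda>y. F (lin q S y) * (grad q S \<bullet> b y)) \<le> \<eta>) sequentially"
proof -
  let ?v = "grad q S" and ?l = "lin q S"
  define w where "w = (norm ?v)\<^sup>2"
  have w0: "0 \<le> w" by (simp add: w_def)
  have lpos: "0 < ?l y" if "y \<in> D" for y
    using lin_ge(2)[where q = q, OF S(1,3) that] S(2) by blast
  obtain P0 where P0': "0 \<le> P0" "\<And>n. mean_sum (mesh n) (T * Suc n) (\<lambda>y. 1 + g y) \<le> P0"
    using mean_sum_one_plus_g by blast
  obtain K where K: "0 < K" "\<And>y. y \<in> D \<Longrightarrow> 1 / ?l y \<le> K * (1 + g y)"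
    using inverse_lin_le[where q = q, OF S] by blast
  define P where "P = K * P0"
  have P0: "0 \<le> P" using K P0' by (simp add: P_def)
  have P: "mean_sum (mesh n) (T * Suc n) (\<lambda>y. K * (1 + g y)) \<le> P" for n
    unfolding P_def mean_sum_cmult using K P0'(2) by (intro mult_left_mono) auto
  \<comment> \<open>First \<open>m\<close> is chosen for the first-order term, then \<open>n\<close> for the second-order term.\<close>
  obtain m0 :: nat where m0: "1 / (\<eta> / 4) < real m0" using reals_Archimedean2 by blast
  define m where "m = Suc m0"
  have m: "1 \<le> m" "1 / real m \<le> \<eta> / 4"
  proof -
    have "1 / (\<eta> / 4) < real m" using m0 by (simp add: m_def)
    then show "1 / real m \<le> \<eta> / 4" using \<eta> by (simp add: m_def field_simps)
  qed (simp add: m_def)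
  obtain n where n: "m \<le> n" "1 + 4 * w * P / \<eta> \<le> (\<Sum>i=m..n. 1 / real i)"
    using harmonic_sum_unbounded by blast
  define H where "H = (\<Sum>i=m..n. 1 / real i)"
  have H: "0 < H" "w * P / H \<le> \<eta> / 4"
  proof -
    have "1 + 4 * w * P / \<eta> \<le> H" using n(2) by (simp add: H_def)
    moreover have "0 \<le> 4 * w * P / \<eta>" using w0 P0 \<eta> by simp
    ultimately show "0 < H" by linarith
    have "4 * w * P / \<eta> \<le> H" using \<open>1 + 4 * w * P / \<eta> \<le> H\<close> by linarith
    then show "w * P / H \<le> \<eta> / 4" using \<eta> \<open>0 < H\<close> by (simp add: field_simps)
  qed
  define u where "u i = (1 / real i) / H" for i
  have u_sum: "(\<Sum>i=m..n. u i) = 1"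
    unfolding u_def sum_divide_distrib[symmetric] H_def[symmetric] using H(1) by simp
  have u_pos: "0 < u i" if "i \<in> {m..n}" for i using that m H by (simp add: u_def)
  define F where "F x = (\<Sum>i=m..n. u i * exp (- real i * x))" for x
  have F_meas [measurable]: "F \<in> borel_measurable borel" unfolding F_def by measurable
  have F_le: "F x \<le> exp (- real m * x)" if "0 < x" for x
  proof -
    have "F x \<le> (\<Sum>i=m..n. u i * exp (- real m * x))"
      unfolding F_def using u_pos that by (intro sum_mono mult_left_mono) (auto intro: less_imp_le)
    also have "\<dots> = exp (- real m * x)" by (simp only: sum_distrib_right[symmetric] u_sum mult_1)
    finally show ?thesis .
  qed
  have F0: "0 \<le> F x" for x unfolding F_def using u_pos by (intro sum_nonneg mult_nonneg_nonneg) (auto intro: less_imp_le)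
  have F1: "F x \<le> 1" if "0 < x" for x
  proof -
    have "exp (- real m * x) \<le> 1" using that by simp
    then show ?thesis using F_le[OF that] by linarith
  qed
  have F2: "F x \<le> \<eta> / x" if "0 < x" for x
  proof -
    have mx: "0 < real m * x" using m that by simp
    have "exp (- (real m * x)) \<le> 1 / (real m * x)"
    proof -
      have "real m * x \<le> exp (real m * x)" using exp_ge_add_one_self[of "real m * x"] by linarith
      then show ?thesis using mx by (simp add: exp_minus field_simps)
    qed
    also have "\<dots> = (1 / real m) / x" by simp
    also have "\<dots> \<le> (\<eta> / 4) / x" using m that by (intro divide_right_mono) auto
    also have "\<dots> \<le> \<eta> / x" using \<eta> that by (intro divide_right_mono) auto
    finally show ?thesis using F_le[OF that] by simp
  qed
  have F3: "1 / 4 \<le> F x" if "0 < x" "x \<le> 1 / real n" for x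
  proof -
    have "exp (- 1) \<le> exp (- real i * x)" if "i \<in> {m..n}" for i
    proof -
      have "real i * x \<le> real n * (1 / real n)"
        using that \<open>0 < x\<close> \<open>x \<le> 1 / real n\<close> by (intro mult_mono) auto
      also have "\<dots> \<le> 1" by simp
      finally show ?thesis by simp
    qed
    then have "(\<Sum>i=m..n. u i * exp (- 1)) \<le> F x"
      unfolding F_def using u_pos by (intro sum_mono mult_left_mono) (auto intro: less_imp_le)
    moreover have "(\<Sum>i=m..n. u i * exp (- 1)) = exp (- 1)" by (simp only: sum_distrib_right[symmetric] u_sum mult_1)
    moreover have "(1::real) / 4 \<le> exp (- 1)" using exp_le by (simp add: exp_minus field_simps)
    ultimately show ?thesis by linarith
  qed
  have l0: "0 \<le> real i * ?l y" if "y \<in> D" for i y using lpos[OF that] by simp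
  have adm_exp: "adm (\<lambda>y. exp (- real i * ?l y))" for i
    by (rule adm_bounded[of _ 1]) (use l0 in auto)
  have adm_term: "adm (\<lambda>y. exp (- real i * ?l y) * (?v \<bullet> b y))" for i
    by (rule adm_mult_bounded[OF _ _ adm_inner_b, of _ 1]) (use l0 in auto)
  have main: "mean_sum (mesh r) (T * Suc r) (\<lambda>y. F (?l y) * (?v \<bullet> b y)) \<le> \<eta>"
    if r1: "mesh r < 1 / ((real n)\<^sup>2 * w + 1)" and r2: "mesh r < H * \<eta> / (4 * (w * (real n + 1) + 1))" for r
  proof -
    let ?h = "mesh r" and ?N = "T * Suc r"
    let ?\<mu> = "mean_sum ?h ?N"
    have small: "(real i)\<^sup>2 * (norm ?v)\<^sup>2 * ?h \<le> 1" if "i \<in> {m..n}" for i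
    proof -
      have "(real i)\<^sup>2 * w * ?h \<le> (real n)\<^sup>2 * w * ?h"
        using that w0 by (intro mult_right_mono power_mono) (auto intro: less_imp_le[OF mesh_pos])
      also have "\<dots> \<le> ((real n)\<^sup>2 * w + 1) * ?h" by (intro mult_right_mono) (auto intro: less_imp_le[OF mesh_pos])
      also have "\<dots> \<le> 1"
      proof -
        have "0 < (real n)\<^sup>2 * w + 1" using w0 by (simp add: add_nonneg_pos)
        then have "?h * ((real n)\<^sup>2 * w + 1) < 1" using r1 by (simp only: pos_less_divide_eq)
        then show ?thesis by (simp only: mult.commute)
      qed
      finally show ?thesis by (simp add: w_def)
    qed
    define EE where "EE i = ?\<mu> (\<lambda>y. exp (- real i * ?l y))" for i
    define GG where "GG i = ?\<mu> (\<lambda>y. exp (- real i * ?l y) * (?v \<bullet> b y))" for i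
    define hr where "hr = mesh r"
    have GG_le: "GG i \<le> 1 / real i + real i * w * (EE i + hr)" if i: "i \<in> {m..n}" for i
    proof -
      have ip: "0 < real i" using i m by simp
      show ?thesis
        unfolding GG_def EE_def w_def hr_def
        by (rule dynkin_exp[where q = q and S = S and l = "real i" and h = "mesh r"]) (use S ip small[OF i] in auto)
    qed
    have expand: "(\<lambda>y. F (?l y) * (?v \<bullet> b y)) = (\<lambda>y. \<Sum>i=m..n. u i * (exp (- real i * ?l y) * (?v \<bullet> b y)))"
      unfolding F_def by (simp add: sum_distrib_right mult.assoc)
    have F_eq: "?\<mu> (\<lambda>y. F (?l y) * (?v \<bullet> b y)) = (\<Sum>i=m..n. u i * GG i)"
    proof -
      have "?\<mu> (\<lambda>y. \<Sum>i=m..n. u i * (exp (- real i * ?l y) * (?v \<bullet> b y)))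
        = (\<Sum>i=m..n. ?\<mu> (\<lambda>y. u i * (exp (- real i * ?l y) * (?v \<bullet> b y))))"
        by (rule mean_sum_sum[where f = "\<lambda>i y. u i * (exp (- real i * ?l y) * (?v \<bullet> b y))"])
          (simp_all only: finite_atLeastAtMost mesh_pos adm_cmult[OF adm_term])
      then show ?thesis unfolding expand GG_def by (simp only: mean_sum_cmult)
    qed
    have EE_sum: "(\<Sum>i=m..n. EE i) = ?\<mu> (\<lambda>y. \<Sum>i=m..n. exp (- real i * ?l y))"
      unfolding EE_def 
      by (rule mean_sum_sum[where f = "\<lambda>i y. exp (- real i * ?l y)", symmetric])
        (simp_all only: finite_atLeastAtMost mesh_pos adm_exp)
    have "(\<Sum>i=m..n. u i * GG i) \<le> (\<Sum>i=m..n. u i * (1 / real m) + (w / H) * (EE i + hr))"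
    proof (rule sum_mono)
      fix i assume i: "i \<in> {m..n}"
      then have ip: "0 < real i" using m by simp
      have "u i * GG i \<le> u i * (1 / real i + real i * w * (EE i + hr))"
        by (rule mult_left_mono[OF GG_le[OF i] less_imp_le[OF u_pos[OF i]]])
      moreover have "u i * (1 / real i) \<le> u i * (1 / real m)"
        using i m u_pos[OF i] by (intro mult_left_mono divide_left_mono) auto
      moreover have "u i * (real i * w * z) = (w / H) * z" for z using ip by (simp add: u_def)
      ultimately show "u i * GG i \<le> u i * (1 / real m) + (w / H) * (EE i + hr)"
        by (simp only: distrib_left[of "u i"])
    qed
    also have "\<dots> = 1 / real m + (w / H) * ((\<Sum>i=m..n. EE i) + real (card {m..n}) * hr)"
      by (simp only: sum.distrib sum_distrib_left[symmetric] sum_distrib_right[symmetric] u_sum mult_1 sum_constant)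
    finally have 1: "?\<mu> (\<lambda>y. F (?l y) * (?v \<bullet> b y))
      \<le> 1 / real m + (w / H) * (?\<mu> (\<lambda>y. \<Sum>i=m..n. exp (- real i * ?l y)) + real (card {m..n}) * ?h)"
      unfolding F_eq EE_sum hr_def .
    have 2: "?\<mu> (\<lambda>y. \<Sum>i=m..n. exp (- real i * ?l y)) \<le> P"
    proof (rule order_trans[OF mean_sum_mono P])
      show "adm (\<lambda>y. K * (1 + g y))" by (intro adm_cmult adm_add adm_const adm_g)
      fix y assume y: "y \<in> D"
      have "(\<Sum>i=m..n. exp (- real i * ?l y)) \<le> (\<Sum>i=1..n. exp (- real i * ?l y))"
        using m by (intro sum_mono2) auto
      also have "\<dots> \<le> 1 / ?l y" by (rule sum_exp_le_inverse[OF lpos[OF y]])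
      finally show "(\<Sum>i=m..n. exp (- real i * ?l y)) \<le> K * (1 + g y)" using K(2)[OF y] by linarith
    next
      show "adm (\<lambda>y. \<Sum>i=m..n. exp (- real i * ?l y))" by (rule adm_sum) (rule adm_exp)
    qed (rule mesh_pos)
    have cn: "real (card {m..n}) * ?h \<le> (real n + 1) * ?h"
      by (intro mult_right_mono) (auto intro: less_imp_le[OF mesh_pos])
    have "(w / H) * (?\<mu> (\<lambda>y. \<Sum>i=m..n. exp (- real i * ?l y)) + real (card {m..n}) * ?h)
      \<le> (w / H) * (P + (real n + 1) * ?h)"
      using w0 H(1) by (intro mult_left_mono add_mono 2 cn) simp
    also have "\<dots> = w * P / H + (w * (real n + 1)) * ?h / H" by (simp add: distrib_left add_divide_distrib mult.assoc)
    also have "(w * (real n + 1)) * ?h / H \<le> \<eta> / 4"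
    proof -
      have "(w * (real n + 1)) * ?h \<le> (w * (real n + 1) + 1) * ?h"
        by (intro mult_right_mono) (auto intro: less_imp_le[OF mesh_pos])
      also have "\<dots> \<le> H * \<eta> / 4"
      proof -
        have "0 < 4 * (w * (real n + 1) + 1)" using w0 by (simp add: add_nonneg_pos)
        then have "?h * (4 * (w * (real n + 1) + 1)) < H * \<eta>" using r2 by (simp only: pos_less_divide_eq)
        then show ?thesis by (simp add: algebra_simps)
      qed
      finally show ?thesis using H(1) by (simp add: field_simps)
    qed
    finally show ?thesis using 1 m H \<eta> by linarith
  qed
  have pos1: "0 < 1 / ((real n)\<^sup>2 * w + 1)" using w0 by (simp add: add_nonneg_pos)
  have pos2: "0 < H * \<eta> / (4 * (w * (real n + 1) + 1))"
    using w0 H(1) \<eta> by (intro divide_pos_pos mult_pos_pos add_nonneg_pos mult_nonneg_nonneg) auto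
  have ev: "eventually (\<lambda>r. mean_sum (mesh r) (T * Suc r) (\<lambda>y. F (?l y) * (?v \<bullet> b y)) \<le> \<eta>) sequentially"
    using eventually_mesh_less[OF pos1] eventually_mesh_less[OF pos2] by eventually_elim (rule main)
  have "0 < 1 / real n" using n m by simp
  from that[OF this F_meas F0 F1 F2 F3 ev] show ?thesis .
qed

section \<open>Repulsion near the faces of the chamber\<close>

definition near_face :: "real \<Rightarrow> 'i set \<Rightarrow> 'v \<Rightarrow> real" where
  "near_face \<epsilon> S y = (if \<forall>i\<in>S. X i y \<le> \<epsilon> then g y else 0)"

lemma adm_near_face: "S \<subseteq> I \<Longrightarrow> adm (near_face \<epsilon> S)"
proof -
  assume "S \<subseteq> I"
  then have "finite S" using finite_I finite_subset by blast
  then have [measurable]: "Measurable.pred borel (\<lambda>y. \<forall>i\<in>S. X i y \<le> \<epsilon>)" by measurable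
  show ?thesis unfolding near_face_def[abs_def] by (intro adm_indicator adm_g) measurable
qed

lemma near_face_nonneg: "y \<in> D \<Longrightarrow> 0 \<le> near_face \<epsilon> S y"
  by (simp add: near_face_def g_nonneg)

lemma near_face_mono: "y \<in> D \<Longrightarrow> \<epsilon> \<le> \<epsilon>' \<Longrightarrow> near_face \<epsilon> S y \<le> near_face \<epsilon>' S y"
  unfolding near_face_def using g_nonneg[of y] by (auto intro: order_trans)

text \<open>
  By compactness, forms without a common zero on the closed chamber are not simultaneously small.
\<close>

lemma near_face_estimate_empty:
  assumes S: "S \<subseteq> I" "S \<noteq> {}" and empty: "\<not> (\<exists>y\<in>Dc. \<forall>i\<in>S. X i y = 0)"
  obtains \<epsilon> where "0 < \<epsilon>" "\<And>y. y \<in> D \<Longrightarrow> near_face \<epsilon> S y = 0"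
proof -
  have fS: "finite S" using S finite_I finite_subset by blast
  have "continuous_on Dc (\<lambda>y. \<Sum>i\<in>S. X i y)" by (intro continuous_intros)
  moreover have "Dc \<noteq> {}" using x0_in_D D_subset_Dc by auto
  ultimately have "\<exists>y\<in>Dc. \<forall>z\<in>Dc. (\<Sum>i\<in>S. X i y) \<le> (\<Sum>i\<in>S. X i z)"
    by (intro continuous_attains_inf compact_Dc)
  then obtain y where y: "y \<in> Dc" "\<And>z. z \<in> Dc \<Longrightarrow> (\<Sum>i\<in>S. X i y) \<le> (\<Sum>i\<in>S. X i z)" by blast
  have nn: "0 \<le> X i y" if "i \<in> S" for i using y(1) S that by (auto simp: Dc_def)
  have m: "0 < (\<Sum>i\<in>S. X i y)"
  proof (rule ccontr)
    assume "\<not> ?thesis"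
    then have "(\<Sum>i\<in>S. X i y) = 0" using sum_nonneg[of S "\<lambda>i. X i y"] nn by force
    then have "\<forall>i\<in>S. X i y = 0" using fS nn by (subst (asm) sum_nonneg_eq_0_iff) auto
    then show False using empty y(1) by blast
  qed
  define \<epsilon> where "\<epsilon> = (\<Sum>i\<in>S. X i y) / (2 * real (card S))"
  have cS: "0 < real (card S)" using fS S by (simp add: card_gt_0_iff)
  have e: "0 < \<epsilon>" using m cS by (simp add: \<epsilon>_def)
  show ?thesis
  proof (rule that[OF e])
    fix z assume z: "z \<in> D"
    have "\<not> (\<forall>i\<in>S. X i z \<le> \<epsilon>)"
    proof
      assume "\<forall>i\<in>S. X i z \<le> \<epsilon>"
      then have "(\<Sum>i\<in>S. X i z) \<le> real (card S) * \<epsilon>" by (intro sum_bounded_above) auto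
      also have "\<dots> = (\<Sum>i\<in>S. X i y) / 2" using cS by (simp add: \<epsilon>_def)
      also have "\<dots> < (\<Sum>i\<in>S. X i y)" using m by simp
      finally show False using y(2)[of z] z D_subset_Dc by auto
    qed
    then show "near_face \<epsilon> S z = 0" unfolding near_face_def by (rule if_not_P)
  qed
qed

text \<open>
  Induction on the number of forms outside \<open>S\<close>. Let \<open>F\<close> be the test function for a direction \<open>v\<close> in the
  interior of the dual cone of \<open>S\<close>. Near the face, \<open>F\<close> is at least \<open>1/4\<close>, and \<open>\<kappa>\<close> times the repulsion
  from the walls in \<open>S\<close> is at most \<open>v \<bullet> b\<close> plus a multiple of the repulsion from the other walls. The
  latter, weighted with \<open>F\<close>, is handled by three cases: close to all walls of \<open>insert i S\<close>
  the induction hypothesis applies; away from a wall in \<open>S\<close> the bound \<open>F x \<le> \<eta>1/x\<close> makes \<open>F\<close> small; away from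
  the \<open>i\<close>-th wall its cotangent is bounded and \<open>F\<close> has small mean.
\<close>

lemma near_face_estimate:
  fixes T :: nat
  assumes "S \<subseteq> I" "S \<noteq> {}" "0 < \<eta>"
  shows "\<exists>\<epsilon>>0. eventually (\<lambda>n. mean_sum (mesh n) (T * Suc n) (near_face \<epsilon> S) \<le> \<eta>) sequentially"
  using assms
proof (induction "card (I - S)" arbitrary: S \<eta> rule: less_induct)
  case less
  note S = less.prems(1,2) and \<eta> = less.prems(3)
  have fS: "finite S" using S finite_I finite_subset by blast
  show ?case
  proof (cases "\<exists>y\<in>Dc. \<forall>i\<in>S. X i y = 0")
    case False
    obtain \<epsilon> where \<epsilon>: "0 < \<epsilon>" "\<And>y. y \<in> D \<Longrightarrow> near_face \<epsilon> S y = 0"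
      using near_face_estimate_empty[OF S False] by blast
    have "mean_sum (mesh n) (T * Suc n) (near_face \<epsilon> S) \<le> mean_sum (mesh n) (T * Suc n) (\<lambda>_. 0)" for n
      using \<epsilon>(2) by (intro mean_sum_mono adm_near_face adm_const S mesh_pos) simp
    then have "mean_sum (mesh n) (T * Suc n) (near_face \<epsilon> S) \<le> \<eta>" for n
      using \<eta> by (simp only: mean_sum_const mult_zero_left) (rule order_trans[OF _ less_imp_le])
    then show ?thesis using \<epsilon>(1) by auto
  next
    case True
    then obtain y where y: "y \<in> Dc" "\<And>i. i \<in> S \<Longrightarrow> X i y = 0" by blast
    have "0 < a i \<bullet> (x0 - y)" if "i \<in> S" for i
      using D_X(1)[OF x0_in_D, of i] y(2)[OF that] S that X_diff[of i x0 y] by auto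
    then obtain q where q: "\<And>i. i \<in> S \<Longrightarrow> 0 < q i" "\<And>j. j \<in> S \<Longrightarrow> 0 < grad q S \<bullet> a j"
      using positive_combination_in_dual[OF fS S(2), of a "x0 - y"] unfolding grad_def by blast
    let ?v = "grad q S" and ?l = "lin q S" and ?R = "I - S"
    have fR: "finite ?R" using finite_I by simp
    define \<kappa> where "\<kappa> = Min ((\<lambda>i. ?v \<bullet> a i) ` S)"
    have \<kappa>: "0 < \<kappa>" "\<And>i. i \<in> S \<Longrightarrow> \<kappa> \<le> ?v \<bullet> a i"
      unfolding \<kappa>_def using fS S q(2) by (auto simp: Min_gr_iff)
    define qm where "qm = Min (q ` S)"
    have qm: "0 < qm" "\<And>i. i \<in> S \<Longrightarrow> qm \<le> q i"
      unfolding qm_def using fS S q(1) by (auto simp: Min_gr_iff)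
    define B where "B = norm ?v * A"
    have B: "0 \<le> B" "\<And>i. i \<in> I \<Longrightarrow> \<bar>?v \<bullet> a i\<bar> \<le> B"
    proof -
      show "0 \<le> B" using A_pos by (simp add: B_def)
      fix i assume "i \<in> I"
      then have "norm ?v * norm (a i) \<le> B" unfolding B_def by (intro mult_left_mono norm_a_le) auto
      then show "\<bar>?v \<bullet> a i\<bar> \<le> B" using Cauchy_Schwarz_ineq2[of ?v "a i"] by linarith
    qed
    define Bc where "Bc = B / \<kappa> + 1"
    have Bc: "0 < Bc" using B \<kappa> by (simp add: Bc_def add_nonneg_pos)
    define \<eta>2 where "\<eta>2 = \<eta> / (8 * Bc * (real (card ?R) + 1))"
    have \<eta>2: "0 < \<eta>2" "4 * Bc * (real (card ?R) * \<eta>2) \<le> \<eta> / 2"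
    proof -
      show "0 < \<eta>2" using \<eta> Bc by (simp add: \<eta>2_def add_nonneg_pos)
      then have "4 * Bc * (real (card ?R) * \<eta>2) \<le> 4 * Bc * ((real (card ?R) + 1) * \<eta>2)"
        using Bc by (intro mult_left_mono mult_right_mono) auto
      also have "\<dots> = \<eta> / 2"
      proof -
        have "4 * Bc * (r * (\<eta> / (8 * Bc * r))) = \<eta> / 2" if "0 < r" for r using Bc that by simp
        from this[of "real (card ?R) + 1"] show ?thesis unfolding \<eta>2_def by simp
      qed
      finally show "4 * Bc * (real (card ?R) * \<eta>2) \<le> \<eta> / 2" .
    qed
    have "\<exists>\<epsilon>>0. eventually (\<lambda>n. mean_sum (mesh n) (T * Suc n) (near_face \<epsilon> (insert i S)) \<le> \<eta>2) sequentially" if i: "i \<in> ?R" for i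
    proof (rule less.hyps)
      have "I - insert i S \<subset> I - S" using i by auto
      then show "card (I - insert i S) < card (I - S)" by (rule psubset_card_mono[OF fR])
    qed (use i S \<eta>2 in auto)
    then have "\<forall>i\<in>?R. \<exists>\<epsilon>. 0 < \<epsilon> \<and> eventually (\<lambda>n. mean_sum (mesh n) (T * Suc n) (near_face \<epsilon> (insert i S)) \<le> \<eta>2) sequentially"
      by blast
    from bchoice[OF this] obtain d where d: "\<And>i. i \<in> ?R \<Longrightarrow> 0 < d i"
      "\<And>i. i \<in> ?R \<Longrightarrow> eventually (\<lambda>n. mean_sum (mesh n) (T * Suc n) (near_face (d i) (insert i S)) \<le> \<eta>2) sequentially"
      by blast
    \<comment> \<open>The \<open>1\<close> covers the case that \<open>S\<close> already contains all forms.\<close>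
    define \<delta> where "\<delta> = Min (insert 1 (d ` ?R))"
    have \<delta>: "0 < \<delta>" "\<And>i. i \<in> ?R \<Longrightarrow> \<delta> \<le> d i"
      unfolding \<delta>_def using fR d(1) by (auto simp: Min_gr_iff)
    have "eventually (\<lambda>n. mean_sum (mesh n) (T * Suc n) (near_face \<delta> (insert i S)) \<le> \<eta>2) sequentially" if i: "i \<in> ?R" for i
      using d(2)[OF i]
    proof eventually_elim
      case (elim n)
      have "mean_sum (mesh n) (T * Suc n) (near_face \<delta> (insert i S)) \<le> mean_sum (mesh n) (T * Suc n) (near_face (d i) (insert i S))"
        using i S by (intro mean_sum_mono adm_near_face near_face_mono \<delta> mesh_pos) auto
      then show ?case using elim by linarith
    qed
    then have evR: "eventually (\<lambda>n. \<forall>i\<in>?R. mean_sum (mesh n) (T * Suc n) (near_face \<delta> (insert i S)) \<le> \<eta>2) sequentially"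
      using fR by (intro eventually_ball_finite) auto
    obtain K where K: "0 < K" "\<And>y. y \<in> D \<Longrightarrow> 1 / ?l y \<le> K * (1 + g y)"
      using inverse_lin_le[where q = q, OF S q(1)] by blast
    define Q where "Q = (\<Sum>i\<in>?R. 1 / (qm * \<delta>) + k i / \<delta> * K)"
    have Q: "0 \<le> Q" unfolding Q_def
    proof (rule sum_nonneg)
      fix i assume "i \<in> ?R"
      then have "0 < k i" using k_pos by simp
      then show "0 \<le> 1 / (qm * \<delta>) + k i / \<delta> * K" using qm(1) \<delta>(1) K(1) by simp
    qed
    obtain P where P: "0 \<le> P" "\<And>n. mean_sum (mesh n) (T * Suc n) (\<lambda>y. 1 + g y) \<le> P"
      using mean_sum_one_plus_g by blast
    define Z where "Z = 4 / \<kappa> + 4 * Bc * Q * P"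
    have Z: "0 < Z" using \<kappa> Bc Q P by (simp add: Z_def add_pos_nonneg)
    \<comment> \<open>The constant \<open>Z\<close> does not depend on the test function, so the latter can now be chosen.\<close>
    define \<eta>1 where "\<eta>1 = \<eta> / (2 * Z)"
    have \<eta>1: "0 < \<eta>1" "Z * \<eta>1 = \<eta> / 2" using \<eta> Z by (auto simp: \<eta>1_def)
    obtain F \<rho> where F: "0 < \<rho>" "F \<in> borel_measurable borel"
      "\<And>x. 0 < x \<Longrightarrow> 0 \<le> F x" "\<And>x. 0 < x \<Longrightarrow> F x \<le> 1" "\<And>x. 0 < x \<Longrightarrow> F x \<le> \<eta>1 / x"
      "\<And>x. 0 < x \<Longrightarrow> x \<le> \<rho> \<Longrightarrow> 1 / 4 \<le> F x"
      "eventually (\<lambda>n. mean_sum (mesh n) (T * Suc n) (\<lambda>y. F (?l y) * (?v \<bullet> b y)) \<le> \<eta>1) sequentially"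
      by (rule test_function[where q = q and T = T, OF S q(1) \<eta>1(1)]) (assumption | rule that)+
    have qs: "0 < (\<Sum>i\<in>S. q i)" using fS S q(1) by (intro sum_pos) auto
    define \<epsilon> where "\<epsilon> = \<rho> / (\<Sum>i\<in>S. q i)"
    have \<epsilon>: "0 < \<epsilon>" using F(1) qs by (simp add: \<epsilon>_def)
    have lpos: "0 < ?l y" if "y \<in> D" for y using lin_ge(2)[where q = q, OF S(1) q(1) that] S(2) by blast
    have cross: "F (?l y) * (k i * cot (X i y)) \<le> near_face \<delta> (insert i S) y + \<eta>1 * (1 / (qm * \<delta>) + k i / \<delta> * K) * (1 + g y)"
      if y: "y \<in> D" and i: "i \<in> ?R" for y i
    proof -
      have iI: "i \<in> I" using i by simp
      note kp = k_pos[OF iI] and gp = g_nonneg[OF y] and lp = lpos[OF y]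
      note t0 = g_term_nonneg[OF y iI] and t1 = g_term_le[OF y iI]
      have FK: "F (?l y) \<le> \<eta>1 * K * (1 + g y)"
      proof -
        have "F (?l y) \<le> \<eta>1 * (1 / ?l y)" using F(5)[OF lp] by simp
        also have "\<dots> \<le> \<eta>1 * (K * (1 + g y))" using K(2)[OF y] \<eta>1 by (intro mult_left_mono) auto
        finally show ?thesis by (simp add: mult.assoc)
      qed
      have p1: "0 \<le> \<eta>1 * (1 / (qm * \<delta>)) * (1 + g y)" using \<eta>1 qm \<delta> gp by (intro mult_nonneg_nonneg) auto
      have p2: "0 \<le> \<eta>1 * (k i / \<delta> * K) * (1 + g y)" using \<eta>1 kp K \<delta> gp by (intro mult_nonneg_nonneg) auto
      have p3: "0 \<le> near_face \<delta> (insert i S) y" by (rule near_face_nonneg[OF y])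
      have split: "\<eta>1 * (1 / (qm * \<delta>) + k i / \<delta> * K) * (1 + g y) = \<eta>1 * (1 / (qm * \<delta>)) * (1 + g y) + \<eta>1 * (k i / \<delta> * K) * (1 + g y)"
        by (simp only: distrib_left distrib_right)
      consider (near) "\<forall>j\<in>insert i S. X j y \<le> \<delta>" | (off) j where "j \<in> S" "\<delta> < X j y" | (far) "\<delta> < X i y"
        by (cases "\<forall>j\<in>insert i S. X j y \<le> \<delta>") (auto simp: not_le)
      then show ?thesis
      proof cases
        case near
        have "F (?l y) * (k i * cot (X i y)) \<le> 1 * g y" using F(3,4)[OF lp] t0 t1 by (intro mult_mono) auto
        also have "\<dots> = near_face \<delta> (insert i S) y" using near unfolding near_face_def by simp
        finally show ?thesis unfolding split using p1 p2 by linarith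
      next
        case off
        have "qm * \<delta> \<le> q j * X j y" using qm(2)[OF off(1)] q(1)[OF off(1)] \<delta>(1) off(2) by (intro mult_mono) auto
        also have "\<dots> \<le> ?l y" by (rule lin_ge(1)[where q = q, OF S(1) q(1) y off(1)])
        finally have "\<eta>1 / ?l y \<le> \<eta>1 / (qm * \<delta>)"
          using \<eta>1 qm \<delta> lp by (intro divide_left_mono) auto
        then have "F (?l y) \<le> \<eta>1 * (1 / (qm * \<delta>))" using F(5)[OF lp] by simp
        then have "F (?l y) * (k i * cot (X i y)) \<le> \<eta>1 * (1 / (qm * \<delta>)) * (1 + g y)"
          using t0 t1 F(3)[OF lp] \<eta>1 qm \<delta> by (intro mult_mono) auto
        then show ?thesis unfolding split using p2 p3 by linarith
      next
        case far
        have "cot (X i y) \<le> 1 / X i y" using D_X[OF y iI] by (intro cot_le_inverse) auto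
        also have "\<dots> \<le> 1 / \<delta>" using far \<delta> by (intro divide_left_mono) auto
        finally have "k i * cot (X i y) \<le> k i / \<delta>" using kp mult_left_mono[of "cot (X i y)" "1 / \<delta>" "k i"] by simp
        then have "F (?l y) * (k i * cot (X i y)) \<le> (\<eta>1 * K * (1 + g y)) * (k i / \<delta>)"
          using FK t0 F(3)[OF lp] \<eta>1 K gp by (intro mult_mono) auto
        also have "\<dots> = \<eta>1 * (k i / \<delta> * K) * (1 + g y)" by (simp only: ac_simps)
        finally show ?thesis unfolding split using p1 p3 by linarith
      qed
    qed
    \<comment> \<open>The factor \<open>4\<close> compensates the lower bound \<open>1/4\<close> of the test function near the face.\<close>
    define rhs where "rhs y = 4 / \<kappa> * (F (?l y) * (?v \<bullet> b y))
      + (4 * Bc * (\<Sum>i\<in>?R. near_face \<delta> (insert i S) y) + 4 * Bc * \<eta>1 * Q * (1 + g y))" for y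
    have pw: "near_face \<epsilon> S y \<le> rhs y" if y: "y \<in> D" for y
    proof -
      note lp = lpos[OF y]
      define GS where "GS = (\<Sum>i\<in>S. k i * cot (X i y))"
      define GR where "GR = (\<Sum>i\<in>?R. k i * cot (X i y))"
      have gsplit: "g y = GS + GR"
        unfolding g_def GS_def GR_def using sum.subset_diff[OF S(1) finite_I, of "\<lambda>i. k i * cot (X i y)"] by simp
      have "?v \<bullet> b y = (\<Sum>i\<in>S. k i * cot (X i y) * (a i \<bullet> ?v)) + (\<Sum>i\<in>?R. k i * cot (X i y) * (a i \<bullet> ?v))"
        using inner_b[of y ?v] sum.subset_diff[OF S(1) finite_I, of "\<lambda>i. k i * cot (X i y) * (a i \<bullet> ?v)"]
        by (simp add: inner_commute)
      moreover have "\<kappa> * GS \<le> (\<Sum>i\<in>S. k i * cot (X i y) * (a i \<bullet> ?v))"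
        unfolding GS_def sum_distrib_left
      proof (rule sum_mono)
        fix i assume i: "i \<in> S"
        have "k i * cot (X i y) * \<kappa> \<le> k i * cot (X i y) * (?v \<bullet> a i)"
          using \<kappa>(2)[OF i] g_term_nonneg[OF y, of i] i S by (intro mult_left_mono) auto
        then show "\<kappa> * (k i * cot (X i y)) \<le> k i * cot (X i y) * (a i \<bullet> ?v)" by (simp add: inner_commute mult.commute)
      qed
      moreover have "- (B * GR) \<le> (\<Sum>i\<in>?R. k i * cot (X i y) * (a i \<bullet> ?v))"
        unfolding GR_def sum_distrib_left sum_negf[symmetric]
      proof (rule sum_mono)
        fix i assume i: "i \<in> ?R"
        have "k i * cot (X i y) * (- B) \<le> k i * cot (X i y) * (?v \<bullet> a i)"
          using B(2)[of i] g_term_nonneg[OF y, of i] i by (intro mult_left_mono) auto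
        then show "- (B * (k i * cot (X i y))) \<le> k i * cot (X i y) * (a i \<bullet> ?v)" by (simp add: inner_commute mult.commute)
      qed
      ultimately have "\<kappa> * GS \<le> ?v \<bullet> b y + B * GR" by linarith
      then have "GS \<le> 1 / \<kappa> * (?v \<bullet> b y) + B / \<kappa> * GR" using \<kappa>(1) by (simp add: field_simps)
      then have "g y \<le> 1 / \<kappa> * (?v \<bullet> b y) + Bc * GR" unfolding gsplit Bc_def by (simp add: distrib_right)
      then have "F (?l y) * g y \<le> F (?l y) * (1 / \<kappa> * (?v \<bullet> b y) + Bc * GR)"
        using F(3)[OF lp] by (intro mult_left_mono) auto
      also have "\<dots> = 1 / \<kappa> * (F (?l y) * (?v \<bullet> b y)) + Bc * (F (?l y) * GR)"
        by (simp add: distrib_left mult.left_commute)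
      finally have 1: "F (?l y) * g y \<le> 1 / \<kappa> * (F (?l y) * (?v \<bullet> b y)) + Bc * (F (?l y) * GR)" .
      have "F (?l y) * GR \<le> (\<Sum>i\<in>?R. near_face \<delta> (insert i S) y + \<eta>1 * (1 / (qm * \<delta>) + k i / \<delta> * K) * (1 + g y))"
        unfolding GR_def sum_distrib_left by (intro sum_mono cross y)
      also have "\<dots> = (\<Sum>i\<in>?R. near_face \<delta> (insert i S) y) + \<eta>1 * Q * (1 + g y)"
      proof -
        have "(\<Sum>i\<in>?R. n i + e * t i * r) = (\<Sum>i\<in>?R. n i) + e * (\<Sum>i\<in>?R. t i) * r" for n t and e r :: real
          by (simp add: sum.distrib sum_distrib_left sum_distrib_right)
        then show ?thesis unfolding Q_def .
      qed
      finally have "Bc * (F (?l y) * GR) \<le> Bc * ((\<Sum>i\<in>?R. near_face \<delta> (insert i S) y) + \<eta>1 * Q * (1 + g y))"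
        using Bc by (intro mult_left_mono) auto
      then have 2: "4 * (F (?l y) * g y) \<le> rhs y"
        using 1 unfolding rhs_def by (simp add: distrib_left)
      show ?thesis
      proof (cases "\<forall>i\<in>S. X i y \<le> \<epsilon>")
        case True
        have "?l y \<le> (\<Sum>i\<in>S. q i * \<epsilon>)"
          unfolding lin_def using True q(1) by (intro sum_mono mult_left_mono) (auto intro: less_imp_le)
        also have "\<dots> = \<rho>" unfolding sum_distrib_right[symmetric] \<epsilon>_def using qs by simp
        finally have "1 / 4 \<le> F (?l y)" by (rule F(6)[OF lp])
        then have "1 / 4 * g y \<le> F (?l y) * g y" using g_nonneg[OF y] by (intro mult_right_mono)
        then show ?thesis using 2 True unfolding near_face_def by simp
      next
        case False
        have "0 \<le> 4 * (F (?l y) * g y)" using F(3)[OF lp] g_nonneg[OF y] by simp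
        then show ?thesis using 2 unfolding near_face_def if_not_P[OF False] by linarith
      qed
    qed
    have adm1: "adm (\<lambda>y. F (?l y) * (?v \<bullet> b y))"
    proof (rule adm_mult_bounded[OF _ _ adm_inner_b])
      show "(\<lambda>y. F (?l y)) \<in> borel_measurable borel" by (rule measurable_compose[OF lin_measurable F(2)])
      show "\<bar>F (?l y)\<bar> \<le> 1" if "y \<in> D" for y using F(3,4)[OF lpos[OF that]] by simp
    qed
    have adm2: "adm (\<lambda>y. \<Sum>i\<in>?R. near_face \<delta> (insert i S) y)" using S by (intro adm_sum adm_near_face) auto
    have adm3: "adm (\<lambda>y. 1 + g y)" by (intro adm_add adm_const adm_g)
    have adm23: "adm (\<lambda>y. 4 * Bc * (\<Sum>i\<in>?R. near_face \<delta> (insert i S) y) + 4 * Bc * \<eta>1 * Q * (1 + g y))"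
      by (intro adm_add adm_cmult adm2 adm3)
    have adm_rhs: "adm rhs" unfolding rhs_def[abs_def] by (rule adm_add[OF adm_cmult[OF adm1] adm23])
    have "eventually (\<lambda>n. mean_sum (mesh n) (T * Suc n) (near_face \<epsilon> S) \<le> \<eta>) sequentially"
      using F(7) evR
    proof eventually_elim
      case (elim n)
      let ?\<mu> = "mean_sum (mesh n) (T * Suc n)"
      have "?\<mu> (near_face \<epsilon> S) \<le> ?\<mu> rhs" by (intro mean_sum_mono adm_near_face S adm_rhs mesh_pos pw)
      also have "?\<mu> rhs = 4 / \<kappa> * ?\<mu> (\<lambda>y. F (?l y) * (?v \<bullet> b y))
        + (4 * Bc * ?\<mu> (\<lambda>y. \<Sum>i\<in>?R. near_face \<delta> (insert i S) y) + 4 * Bc * \<eta>1 * Q * ?\<mu> (\<lambda>y. 1 + g y))"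
        unfolding rhs_def[abs_def]
        by (subst mean_sum_add[OF adm_cmult[OF adm1] adm23 mesh_pos], subst mean_sum_add[OF adm_cmult[OF adm2] adm_cmult[OF adm3] mesh_pos])
          (simp only: mean_sum_cmult)
      also have "?\<mu> (\<lambda>y. \<Sum>i\<in>?R. near_face \<delta> (insert i S) y) = (\<Sum>i\<in>?R. ?\<mu> (near_face \<delta> (insert i S)))"
        using S by (intro mean_sum_sum fR mesh_pos adm_near_face) auto
      also have "4 / \<kappa> * ?\<mu> (\<lambda>y. F (?l y) * (?v \<bullet> b y))
          + (4 * Bc * (\<Sum>i\<in>?R. ?\<mu> (near_face \<delta> (insert i S))) + 4 * Bc * \<eta>1 * Q * ?\<mu> (\<lambda>y. 1 + g y))
        \<le> 4 / \<kappa> * \<eta>1 + (4 * Bc * (real (card ?R) * \<eta>2) + 4 * Bc * \<eta>1 * Q * P)"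
      proof (intro add_mono mult_left_mono)
        show "?\<mu> (\<lambda>y. F (?l y) * (?v \<bullet> b y)) \<le> \<eta>1" by (rule elim(1))
        show "(\<Sum>i\<in>?R. ?\<mu> (near_face \<delta> (insert i S))) \<le> real (card ?R) * \<eta>2"
          using elim(2) by (intro sum_bounded_above) auto
        show "?\<mu> (\<lambda>y. 1 + g y) \<le> P" by (rule P(2))
      qed (use \<kappa> Bc \<eta>1 Q in auto)
      also have "\<dots> = Z * \<eta>1 + 4 * Bc * (real (card ?R) * \<eta>2)" by (simp add: Z_def algebra_simps)
      also have "\<dots> \<le> \<eta>" using \<eta>1(2) \<eta>2(2) by linarith
      finally show ?case .
    qed
    then show ?thesis using \<epsilon> by blast
  qed
qed

text \<open>
  Truncation at level \<open>1/\<epsilon>\<close> changes the cotangent of a form only where the form is below \<open>\<epsilon>\<close>, and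
  there the error is part of the repulsion near a wall.
\<close>

lemma truncation_error_small:
  fixes T :: nat
  assumes \<eta>: "0 < \<eta>"
  shows "\<exists>L\<ge>0. eventually (\<lambda>n. mean_sum (mesh n) (T * Suc n) (\<lambda>y. g y - gL L y) \<le> \<eta>) sequentially"
proof -
  define \<eta>' where "\<eta>' = \<eta> / (real (card I) + 1)"
  have \<eta>': "0 < \<eta>'" "real (card I) * \<eta>' \<le> \<eta>" using \<eta> by (auto simp: \<eta>'_def field_simps add_nonneg_pos)
  have "\<forall>i\<in>I. \<exists>\<epsilon>. 0 < \<epsilon> \<and> eventually (\<lambda>n. mean_sum (mesh n) (T * Suc n) (near_face \<epsilon> {i}) \<le> \<eta>') sequentially"
    using \<eta>' by (intro ballI near_face_estimate) auto
  from bchoice[OF this] obtain d where d: "\<And>i. i \<in> I \<Longrightarrow> 0 < d i"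
    "\<And>i. i \<in> I \<Longrightarrow> eventually (\<lambda>n. mean_sum (mesh n) (T * Suc n) (near_face (d i) {i}) \<le> \<eta>') sequentially"
    by blast
  define \<epsilon> where "\<epsilon> = Min (insert 1 (d ` I))"
  have \<epsilon>: "0 < \<epsilon>" "\<And>i. i \<in> I \<Longrightarrow> \<epsilon> \<le> d i"
    unfolding \<epsilon>_def using finite_I d(1) by (auto simp: Min_gr_iff)
  have L: "0 \<le> 1 / \<epsilon>" using \<epsilon> by simp
  have pw: "g y - gL (1 / \<epsilon>) y \<le> (\<Sum>i\<in>I. near_face (d i) {i} y)" if y: "y \<in> D" for y
    unfolding g_def[of y] gL_def sum_subtractf[symmetric]
  proof (rule sum_mono)
    fix i assume i: "i \<in> I"
    note X = D_X[OF y i]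
    show "k i * cot (X i y) - k i * tcot (1 / \<epsilon>) (X i y) \<le> near_face (d i) {i} y"
    proof (cases "cot (X i y) \<le> 1 / \<epsilon>")
      case True
      then have "tcot (1 / \<epsilon>) (X i y) = cot (X i y)" using X by (simp add: tcot_def)
      then show ?thesis using near_face_nonneg[OF y] by simp
    next
      case False
      have "1 / \<epsilon> < 1 / X i y" using False cot_le_inverse[OF X(1,3)] by linarith
      then have "X i y < \<epsilon>" using X \<epsilon> by (simp add: field_simps)
      then have "near_face (d i) {i} y = g y" using \<epsilon>(2)[OF i] by (simp add: near_face_def)
      moreover have "0 \<le> k i * tcot (1 / \<epsilon>) (X i y)"
        using k_pos[OF i] X L cot_X_nonneg[OF y i] by (simp add: tcot_def)
      ultimately show ?thesis using g_term_le[OF y i] by linarith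
    qed
  qed
  have "eventually (\<lambda>n. \<forall>i\<in>I. mean_sum (mesh n) (T * Suc n) (near_face (d i) {i}) \<le> \<eta>') sequentially"
    using finite_I d(2) by (intro eventually_ball_finite) auto
  then have "eventually (\<lambda>n. mean_sum (mesh n) (T * Suc n) (\<lambda>y. g y - gL (1 / \<epsilon>) y) \<le> \<eta>) sequentially"
  proof eventually_elim
    case (elim n)
    let ?\<mu> = "mean_sum (mesh n) (T * Suc n)"
    have "?\<mu> (\<lambda>y. g y - gL (1 / \<epsilon>) y) \<le> ?\<mu> (\<lambda>y. \<Sum>i\<in>I. near_face (d i) {i} y)"
      by (intro mean_sum_mono pw adm_diff adm_g adm_gL L adm_sum adm_near_face mesh_pos) auto
    also have "\<dots> = (\<Sum>i\<in>I. ?\<mu> (near_face (d i) {i}))"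
      by (intro mean_sum_sum finite_I mesh_pos adm_near_face) auto
    also have "\<dots> \<le> real (card I) * \<eta>'" using elim by (intro sum_bounded_above) auto
    also have "\<dots> \<le> \<eta>" by (rule \<eta>')
    finally show ?case .
  qed
  then show ?thesis using L by blast
qed

text \<open>
  Fatou's lemma turns small means into small lower limits: if \<open>q m\<close> is the lower limit, as the step size
  tends to \<open>0\<close>, of the error at a level \<open>L m\<close> with mean at most \<open>1/(m + 1)\<close>, then the infimum of the
  \<open>q m\<close> has integral \<open>0\<close>.
\<close>

lemma AE_truncation_error:
  fixes T :: nat
  shows "AE \<omega> in M. \<forall>\<eta>>0. \<exists>L\<ge>0. \<exists>\<^sub>F n in sequentially.
    (\<Sum>j<T * Suc n. mesh n * (g (V (mesh n) (Suc j) \<omega>) - gL L (V (mesh n) (Suc j) \<omega>))) < \<eta>"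
proof -
  define r where "r L n \<omega> = (\<Sum>j<T * Suc n. mesh n * (g (V (mesh n) (Suc j) \<omega>) - gL L (V (mesh n) (Suc j) \<omega>)))" for L n \<omega>
  have r_nonneg: "0 \<le> r L n \<omega>" for L n \<omega>
    unfolding r_def using gL_le_g[OF Y_in_D[OF mesh_pos]] by (intro sum_nonneg mult_nonneg_nonneg) (auto intro: less_imp_le)
  have "\<forall>m. \<exists>L. 0 \<le> L \<and> eventually (\<lambda>n. mean_sum (mesh n) (T * Suc n) (\<lambda>y. g y - gL L y) \<le> 1 / real (Suc m)) sequentially"
    by (intro allI truncation_error_small) simp
  from choice[OF this] obtain L where L: "\<And>m. 0 \<le> L m"
    "\<And>m. eventually (\<lambda>n. mean_sum (mesh n) (T * Suc n) (\<lambda>y. g y - gL (L m) y) \<le> 1 / real (Suc m)) sequentially"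
    by blast
  have int: "integrable M (\<lambda>\<omega>. g (V (mesh n) (Suc j) \<omega>) - gL (L m) (V (mesh n) (Suc j) \<omega>))" for n j m
    using adm_integrable[OF adm_diff[OF adm_g adm_gL[OF L(1)]] mesh_pos] .
  have r_int: "integrable M (r (L m) n)" for m n
    unfolding r_def[abs_def] using int by (intro Bochner_Integration.integrable_sum integrable_mult_right) auto
  have r_exp: "expectation (r (L m) n) = mean_sum (mesh n) (T * Suc n) (\<lambda>y. g y - gL (L m) y)" for m n
    unfolding r_def[abs_def] mean_sum_def using int by (subst Bochner_Integration.integral_sum) auto
  have r_meas [measurable]: "r (L m) n \<in> borel_measurable M" for m n using r_int by (rule borel_measurable_integrable)
  define q where "q m \<omega> = liminf (\<lambda>n. ennreal (r (L m) n \<omega>))" for m \<omega>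
  have q_meas [measurable]: "q m \<in> borel_measurable M" for m unfolding q_def by measurable
  have q_int: "(\<integral>\<^sup>+\<omega>. q m \<omega> \<partial>M) \<le> ennreal (1 / real (Suc m))" for m
  proof -
    have "(\<integral>\<^sup>+\<omega>. q m \<omega> \<partial>M) \<le> liminf (\<lambda>n. \<integral>\<^sup>+\<omega>. ennreal (r (L m) n \<omega>) \<partial>M)"
      unfolding q_def by (rule nn_integral_liminf) measurable
    also have "\<dots> \<le> limsup (\<lambda>n. \<integral>\<^sup>+\<omega>. ennreal (r (L m) n \<omega>) \<partial>M)" by (rule Liminf_le_Limsup) simp
    also have "\<dots> \<le> ennreal (1 / real (Suc m))"
    proof (rule Limsup_bounded)
      show "eventually (\<lambda>n. (\<integral>\<^sup>+\<omega>. ennreal (r (L m) n \<omega>) \<partial>M) \<le> ennreal (1 / real (Suc m))) sequentially"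
        using L(2)[of m]
      proof eventually_elim
        case (elim n)
        have "(\<integral>\<^sup>+\<omega>. ennreal (r (L m) n \<omega>) \<partial>M) = ennreal (expectation (r (L m) n))"
          using r_int r_nonneg by (intro nn_integral_eq_integral) auto
        then show ?case using elim by (simp only: r_exp ennreal_leI)
      qed
    qed
    finally show ?thesis .
  qed
  have "(\<integral>\<^sup>+\<omega>. (INF m. q m \<omega>) \<partial>M) \<le> 0"
  proof (rule ennreal_le_epsilon)
    fix e :: real assume e: "0 < e"
    then obtain m where m: "1 / real (Suc m) < e" by (metis nat_approx_posE)
    have "(\<integral>\<^sup>+\<omega>. (INF m. q m \<omega>) \<partial>M) \<le> (\<integral>\<^sup>+\<omega>. q m \<omega> \<partial>M)"
      by (intro nn_integral_mono INF_lower) auto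
    also have "\<dots> \<le> ennreal (1 / real (Suc m))" by (rule q_int)
    also have "\<dots> \<le> 0 + ennreal e" using m by (simp add: ennreal_leI)
    finally show "(\<integral>\<^sup>+\<omega>. (INF m. q m \<omega>) \<partial>M) \<le> 0 + ennreal e" .
  qed
  then have "AE \<omega> in M. (INF m. q m \<omega>) = 0"
    by (subst nn_integral_0_iff_AE[symmetric]) auto
  then show ?thesis
  proof eventually_elim
    case (elim \<omega>)
    show ?case
    proof (intro allI impI)
      fix \<eta> :: real assume \<eta>: "0 < \<eta>"
      then have "(INF m. q m \<omega>) < ennreal \<eta>" using elim by simp
      then obtain m where m: "q m \<omega> < ennreal \<eta>" by (auto simp: INF_less_iff)
      have "\<exists>\<^sub>F n in sequentially. r (L m) n \<omega> < \<eta>"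
      proof (rule ccontr)
        assume "\<not> ?thesis"
        then have "eventually (\<lambda>n. ennreal \<eta> \<le> ennreal (r (L m) n \<omega>)) sequentially"
          by (simp add: not_frequently not_less) (erule eventually_mono, rule ennreal_leI)
        then have "ennreal \<eta> \<le> q m \<omega>" unfolding q_def by (rule Liminf_bounded)
        then show False using m by simp
      qed
      then show "\<exists>L\<ge>0. \<exists>\<^sub>F n in sequentially.
          (\<Sum>j<T * Suc n. mesh n * (g (V (mesh n) (Suc j) \<omega>) - gL L (V (mesh n) (Suc j) \<omega>))) < \<eta>"
        using L(1)[of m] unfolding r_def by blast
    qed
  qed
qed

end

section \<open>Uniqueness, and the solution of the random equation\<close>

text \<open>
  The two solutions are driven by the same \<open>w\<close>, so their difference is the integral of the difference of
  the drifts, and \<open>square_norm_integral\<close> writes its square as an integral of a nonpositive function.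
\<close>

lemma integral_equation_unique:
  fixes d :: "'v::euclidean_space \<Rightarrow> 'v" and u v :: "real \<Rightarrow> 'v"
  assumes mono: "\<And>x y. x \<in> D \<Longrightarrow> y \<in> D \<Longrightarrow> (d x - d y) \<bullet> (x - y) \<le> 0"
    and D: "AE s in lborel. 0 \<le> s \<longrightarrow> u s \<in> D" "AE s in lborel. 0 \<le> s \<longrightarrow> v s \<in> D"
    and int: "\<And>t. 0 \<le> t \<Longrightarrow> set_integrable lborel {0..t} (\<lambda>s. d (u s))" "\<And>t. 0 \<le> t \<Longrightarrow> set_integrable lborel {0..t} (\<lambda>s. d (v s))"
    and eq: "\<And>t. 0 \<le> t \<Longrightarrow> u t = w t + (LINT s:{0..t}|lborel. d (u s))" "\<And>t. 0 \<le> t \<Longrightarrow> v t = w t + (LINT s:{0..t}|lborel. d (v s))"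
    and t: "0 \<le> t"
  shows "u t = v t"
proof -
  let ?f = "\<lambda>s. d (u s) - d (v s)"
  have f: "set_integrable lborel {0..s} ?f" if "0 \<le> s" for s
    using int[OF that] by (rule set_integral_diff(1))
  have diff: "(LINT r:{0..s}|lborel. ?f r) = u s - v s" if "0 \<le> s" for s
    using set_integral_diff(2)[OF int[OF that]] eq[OF that] by simp
  have "0 \<le> (\<integral>s. - (indicator {0..t} s *\<^sub>R (?f s \<bullet> (LINT r:{0..s}|lborel. ?f r))) \<partial>lborel)"
  proof (rule integral_nonneg_AE)
    show "AE s in lborel. 0 \<le> - (indicator {0..t} s *\<^sub>R (?f s \<bullet> (LINT r:{0..s}|lborel. ?f r)))"
      using D
    proof eventually_elim
      case (elim s)
      show ?case
      proof (cases "s \<in> {0..t}")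
        case True
        then have "?f s \<bullet> (LINT r:{0..s}|lborel. ?f r) = ?f s \<bullet> (u s - v s)" using diff[of s] by simp
        also have "\<dots> \<le> 0" using elim True by (intro mono) auto
        finally show ?thesis using True by simp
      qed simp
    qed
  qed
  then have "(LINT s:{0..t}|lborel. ?f s \<bullet> (LINT r:{0..s}|lborel. ?f r)) \<le> 0"
    by (simp only: set_lebesgue_integral_def[of lborel "{0..t}"] Bochner_Integration.integral_minus)
  then have "(norm (u t - v t))\<^sup>2 \<le> 0"
    using square_norm_integral(2)[OF f[OF t]] diff[OF t] by simp
  then show ?thesis by simp
qed

context noisy_chamber
begin

definition solution :: "real \<Rightarrow> 'w \<Rightarrow> 'v" where
  "solution t \<omega> = limit_path (\<lambda>s. \<nu> s \<omega>) (\<xi> \<omega>) t"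

lemma solution_adapted:
  assumes t: "0 \<le> t"
  shows "solution t \<in> borel_measurable (G t)"
  unfolding solution_def[abs_def] limit_path_def
proof (rule borel_measurable_lim_metric)
  fix n
  have le: "mesh n * real (nat \<lfloor>t / mesh n\<rfloor>) \<le> t" by (rule floor_cell(1)[OF mesh_pos t])
  have nn: "0 \<le> mesh n * real (nat \<lfloor>t / mesh n\<rfloor>)" by (intro mult_nonneg_nonneg) (auto intro: less_imp_le)
  show "(\<lambda>\<omega>. V (mesh n) (nat \<lfloor>t / mesh n\<rfloor>) \<omega>) \<in> borel_measurable (G t)"
    by (rule measurable_from_subalg[OF G_mono[OF nn le] V_measurable_G[OF mesh_pos]])
qed

lemma solution_equation:
  assumes cont: "AE \<omega> in M. continuous_on {0..} (\<lambda>t. \<nu> t \<omega>)"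
  shows "AE \<omega> in M. continuous_on {0..} (\<lambda>t. solution t \<omega>) \<and> (\<forall>t\<ge>0. solution t \<omega> \<in> Dc) \<and>
    (AE s in lborel. 0 \<le> s \<longrightarrow> solution s \<omega> \<in> D) \<and>
    (\<forall>t\<ge>0. set_integrable lborel {0..t} (\<lambda>s. b (solution s \<omega>)) \<and>
      solution t \<omega> = \<xi> \<omega> + (\<nu> t \<omega> - \<nu> 0 \<omega>) + (LINT s:{0..t}|lborel. b (solution s \<omega>)))"
proof -
  have "AE \<omega> in M. \<forall>T::nat. \<forall>\<eta>>0. \<exists>L\<ge>0. \<exists>\<^sub>F n in sequentially.
    (\<Sum>j<T * Suc n. mesh n * (g (V (mesh n) (Suc j) \<omega>) - gL L (V (mesh n) (Suc j) \<omega>))) < \<eta>"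
    unfolding AE_all_countable by (intro allI AE_truncation_error)
  with cont show ?thesis
  proof eventually_elim
    case (elim \<omega>)
    note w = elim(1) and x = xi_in_Dc[of \<omega>]
    have eq: "solution t \<omega> = \<xi> \<omega> + (\<nu> t \<omega> - \<nu> 0 \<omega>) + (LINT s:{0..t}|lborel. b (solution s \<omega>))" if t: "0 \<le> t" for t
    proof -
      obtain T :: nat where "t \<le> real T" using real_arch_simple by blast
      then have tT: "t \<in> {0..real T}" using t by simp
      show ?thesis unfolding solution_def
        using elim(2) by (intro limit_path_equation[OF w x _ tT]) blast
    qed
    have "AE s in lborel. \<forall>T::nat. s \<in> {0..real T} \<longrightarrow> solution s \<omega> \<in> D"
      unfolding AE_all_countable solution_def by (intro allI limit_path_interior(1)[OF w x])
    then have "AE s in lborel. 0 \<le> s \<longrightarrow> solution s \<omega> \<in> D"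
    proof eventually_elim
      case (elim s)
      obtain T :: nat where "s \<le> real T" using real_arch_simple by blast
      then show ?case using elim by auto
    qed
    moreover have "continuous_on {0..} (\<lambda>t. solution t \<omega>)"
      unfolding solution_def by (rule continuous_limit_path[OF w x])
    moreover have "solution t \<omega> \<in> Dc" if "0 \<le> t" for t
      unfolding solution_def by (rule limit_path_in_Dc[OF w x that])
    moreover have "set_integrable lborel {0..t} (\<lambda>s. b (solution s \<omega>))" for t
      unfolding solution_def by (rule limit_path_b_integrable[OF w x])
    ultimately show ?case using eq by blast
  qed
qed

end

section \<open>Moments of Gaussian vectors\<close>

text \<open>
  Lebesgue measure on the vector space is the image of a product measure indexed by the basis
  vectors. The functions \<open>F\<close> re-index the factors by these vectors.
\<close>

lemma has_bochner_integral_prod_vec: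
  fixes f :: "'m::finite \<Rightarrow> real \<Rightarrow> real"
  assumes f: "\<And>i. has_bochner_integral lborel (f i) (r i)"
  shows "has_bochner_integral lborel (\<lambda>x::real^'m. \<Prod>i\<in>UNIV. f i (x $ i)) (\<Prod>i\<in>UNIV. r i)"
proof -
  interpret product_sigma_finite "\<lambda>_. lborel :: real measure" ..
  let ?e = "\<lambda>i. axis i (1::real) :: real^'m"
  let ?P = "\<Pi>\<^sub>M b\<in>(Basis :: (real^'m) set). (lborel :: real measure)"
  let ?T = "\<lambda>p. \<Sum>b\<in>(Basis :: (real^'m) set). p b *\<^sub>R b"
  define F where "F b = f (inv ?e b)" for b :: "real^'m"
  have inj: "inj ?e" by (auto simp: inj_on_def axis_eq_axis)
  have Fe: "F (?e i) = f i" for i by (simp add: F_def inv_f_f[OF inj])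
  have B: "(Basis :: (real^'m) set) = ?e ` UNIV" by (auto simp: Basis_vec_def)
  have intf: "integrable lborel (f i)" and val: "integral\<^sup>L lborel (f i) = r i" for i
    using f[of i] by (auto simp: has_bochner_integral_iff)
  have [measurable]: "f i \<in> borel_measurable borel" for i
    using borel_measurable_integrable[OF intf[of i]] by simp
  have comp: "?T p $ i = p (?e i)" for p i
  proof -
    have "?T p $ i = (\<Sum>b\<in>Basis. p b *\<^sub>R b) \<bullet> ?e i" by (simp add: inner_axis)
    also have "\<dots> = p (?e i)" by (subst inner_sum_left_Basis) (auto simp: B)
    finally show ?thesis .
  qed
  have prodF: "(\<Prod>b\<in>Basis. F b (p b)) = (\<Prod>i\<in>UNIV. f i (?T p $ i))" for p
  proof -
    have "(\<Prod>b\<in>Basis. F b (p b)) = (\<Prod>i\<in>UNIV. F (?e i) (p (?e i)))"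
      unfolding B by (simp only: prod.reindex[OF inj] o_def)
    then show ?thesis by (simp only: Fe comp)
  qed
  have Fint: "integrable lborel (F b)" if "b \<in> Basis" for b using intf by (simp add: F_def)
  have meas: "(\<lambda>x::real^'m. \<Prod>i\<in>UNIV. f i (x $ i)) \<in> borel_measurable borel" by measurable
  have T: "?T \<in> measurable ?P borel" by measurable
  have "integrable ?P (\<lambda>p. \<Prod>b\<in>Basis. F b (p b))" by (rule product_integrable_prod) (auto intro: Fint)
  then have i: "integrable lborel (\<lambda>x::real^'m. \<Prod>i\<in>UNIV. f i (x $ i))"
    unfolding lborel_eq[where 'a = "real^'m"] by (subst integrable_distr_eq[OF T meas]) (simp only: prodF)
  have "(\<integral>x. (\<Prod>i\<in>UNIV. f i (x $ i)) \<partial>(lborel :: (real^'m) measure)) = (\<integral>p. (\<Prod>b\<in>Basis. F b (p b)) \<partial>?P)"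
    unfolding lborel_eq[where 'a = "real^'m"] by (subst integral_distr[OF T meas]) (simp only: prodF)
  also have "\<dots> = (\<Prod>b\<in>Basis. integral\<^sup>L lborel (F b))" by (rule product_integral_prod) (auto intro: Fint)
  also have "\<dots> = (\<Prod>i\<in>UNIV. r i)"
    unfolding B by (subst prod.reindex[OF inj]) (simp add: Fe val)
  finally show ?thesis using i by (simp add: has_bochner_integral_iff)
qed

lemma norm_vec_square: "(norm (x::real^'m::finite))\<^sup>2 = (\<Sum>i\<in>UNIV. (x $ i)\<^sup>2)"
  unfolding power2_norm_eq_inner inner_vec_def by (simp add: power2_eq_square)

context
  fixes \<sigma> :: real
  assumes \<sigma>: "0 < \<sigma>"
begin

abbreviation (input) gauss :: "real^'m::finite \<Rightarrow> real" where
  "gauss x \<equiv> \<Prod>i\<in>UNIV. normal_density 0 \<sigma> (x $ i)"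

lemma gauss_exp:
  fixes u :: "real^'m::finite"
  shows "has_bochner_integral lborel (\<lambda>x. gauss x * exp (u \<bullet> x)) (exp ((norm u)\<^sup>2 * \<sigma>\<^sup>2 / 2))"
proof -
  have one: "has_bochner_integral lborel (\<lambda>x. normal_density 0 \<sigma> x * exp (c * x)) (exp (c\<^sup>2 * \<sigma>\<^sup>2 / 2))" for c
  proof -
    have "normal_density 0 \<sigma> x * exp (c * x) = exp (c\<^sup>2 * \<sigma>\<^sup>2 / 2) * normal_density (c * \<sigma>\<^sup>2) \<sigma> x" for x
    proof -
      have "- x\<^sup>2 / (2 * \<sigma>\<^sup>2) + c * x = c\<^sup>2 * \<sigma>\<^sup>2 / 2 + - (x - c * \<sigma>\<^sup>2)\<^sup>2 / (2 * \<sigma>\<^sup>2)"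
        using \<sigma> by (simp add: field_simps power2_eq_square)
      then have "exp (- x\<^sup>2 / (2 * \<sigma>\<^sup>2)) * exp (c * x) = exp (c\<^sup>2 * \<sigma>\<^sup>2 / 2) * exp (- (x - c * \<sigma>\<^sup>2)\<^sup>2 / (2 * \<sigma>\<^sup>2))"
        by (simp only: exp_add[symmetric])
      then show ?thesis by (simp add: normal_density_def)
    qed
    moreover have "has_bochner_integral lborel (normal_density (c * \<sigma>\<^sup>2) \<sigma>) 1"
      using \<sigma> by (simp add: has_bochner_integral_iff)
    ultimately show ?thesis
      using has_bochner_integral_mult_right[of "exp (c\<^sup>2 * \<sigma>\<^sup>2 / 2)" lborel "normal_density (c * \<sigma>\<^sup>2) \<sigma>" 1] by simp
  qed
  have "(\<Prod>i\<in>UNIV. normal_density 0 \<sigma> (x $ i) * exp (u $ i * x $ i)) = gauss x * exp (u \<bullet> x)" for x :: "real^'m"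
    by (simp add: prod.distrib exp_sum[symmetric] inner_vec_def)
  moreover have "(\<Prod>i\<in>UNIV. exp ((u $ i)\<^sup>2 * \<sigma>\<^sup>2 / 2)) = exp ((norm u)\<^sup>2 * \<sigma>\<^sup>2 / 2)"
    by (simp add: exp_sum[symmetric] norm_vec_square sum_distrib_right sum_divide_distrib)
  ultimately show ?thesis
    using has_bochner_integral_prod_vec[of "\<lambda>i x. normal_density 0 \<sigma> x * exp (u $ i * x)" "\<lambda>i. exp ((u $ i)\<^sup>2 * \<sigma>\<^sup>2 / 2)"] one
    by simp
qed

text \<open>
  The factors of the remaining coordinates integrate to \<open>1\<close>.
\<close>

lemma gauss_coordinate:
  fixes j :: "'m::finite"
  assumes "has_bochner_integral lborel (\<lambda>x. normal_density 0 \<sigma> x * f x) r"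
  shows "has_bochner_integral lborel (\<lambda>x::real^'m. gauss x * f (x $ j)) r"
proof -
  have n: "has_bochner_integral lborel (normal_density 0 \<sigma>) 1" using \<sigma> by (simp add: has_bochner_integral_iff)
  have h: "has_bochner_integral lborel (\<lambda>x. normal_density 0 \<sigma> x * (if i = j then f x else 1)) (if i = j then r else 1)" for i
    using assms n by simp
  have "(\<Prod>i\<in>UNIV. normal_density 0 \<sigma> (x $ i) * (if i = j then f (x $ i) else 1)) = gauss x * f (x $ j)" for x :: "real^'m"
    by (simp add: prod.distrib)
  moreover have "has_bochner_integral lborel
      (\<lambda>x::real^'m. \<Prod>i\<in>UNIV. normal_density 0 \<sigma> (x $ i) * (if i = j then f (x $ i) else 1))
      (\<Prod>i\<in>UNIV. if i = j then r else 1)"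
    by (rule has_bochner_integral_prod_vec[of "\<lambda>i x. normal_density 0 \<sigma> x * (if i = j then f x else 1)"]) (rule h)
  ultimately show ?thesis by simp
qed

lemma gauss_mean:
  fixes u :: "real^'m::finite"
  shows "has_bochner_integral lborel (\<lambda>x. gauss x * (u \<bullet> x)) 0"
proof -
  have "has_bochner_integral lborel (\<lambda>x::real^'m. \<Sum>j\<in>UNIV. u $ j * (gauss x * (x $ j))) (\<Sum>j\<in>(UNIV::'m set). u $ j * 0)"
    using normal_moment_odd[OF \<sigma>, of 0 0]
    by (intro has_bochner_integral_sum has_bochner_integral_mult_right gauss_coordinate) simp
  then show ?thesis by (simp add: inner_vec_def sum_distrib_left mult.left_commute)
qed

lemma gauss_square:
  "has_bochner_integral lborel (\<lambda>x::real^'m::finite. gauss x * (norm x)\<^sup>2) (real CARD('m) * \<sigma>\<^sup>2)"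
proof -
  have "has_bochner_integral lborel (\<lambda>x::real^'m. \<Sum>j\<in>UNIV. gauss x * (x $ j)\<^sup>2) (\<Sum>j\<in>(UNIV::'m set). \<sigma>\<^sup>2)"
    using normal_moment_even[OF \<sigma>, of 0 1] \<sigma>
    by (intro has_bochner_integral_sum gauss_coordinate) (simp add: fact_numeral)
  then show ?thesis by (simp add: norm_vec_square sum_distrib_left)
qed

end

lemma distributed_has_bochner_integral:
  fixes f g :: "'b \<Rightarrow> real"
  assumes d: "distributed M N X (\<lambda>x. ennreal (f x))" and f: "\<And>x. 0 \<le> f x" and g: "g \<in> borel_measurable N"
    and h: "has_bochner_integral N (\<lambda>x. f x * g x) r"
  shows "has_bochner_integral M (\<lambda>\<omega>. g (X \<omega>)) r"
  using distributed_integrable[OF d g f] distributed_integral[OF d g f] h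
  by (simp add: has_bochner_integral_iff)

section \<open>The forms of the BC chamber\<close>

text \<open>
  The affine forms of the chamber. \<open>High\<close> and \<open>CoPlus\<close> are the complements to \<open>\<pi>/2\<close> of \<open>Low\<close> and
  \<open>Plus\<close>; they come from the second term of \<open>2 cot (2y) = cot y - cot (\<pi>/2 - y)\<close>, with \<open>y = x\<^sub>i\<close> and
  with \<open>y = (x\<^sub>i + x\<^sub>j)/2\<close> respectively.
\<close>

datatype 'm root = Low 'm | High 'm | Diff 'm 'm | Plus 'm 'm | CoPlus 'm 'm

fun root_dir :: "'m root \<Rightarrow> real ^ 'm::finite" where
  "root_dir (Low i) = axis i 1"
| "root_dir (High i) = - axis i 1"
| "root_dir (Diff i j) = axis i 1 - axis j 1"
| "root_dir (Plus i j) = (1 / 2) *\<^sub>R (axis i 1 + axis j 1)"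
| "root_dir (CoPlus i j) = - (1 / 2) *\<^sub>R (axis i 1 + axis j 1)"

fun root_offset :: "'m root \<Rightarrow> real" where
  "root_offset (High i) = pi / 2"
| "root_offset (CoPlus i j) = pi / 2"
| "root_offset _ = 0"

text \<open>
  The half in the direction of \<open>Plus\<close> and \<open>CoPlus\<close> is the one of the half-angle identity, so
  these forms have the same weight as \<open>Diff\<close>.
\<close>

fun root_weight :: "real \<Rightarrow> real \<Rightarrow> real \<Rightarrow> 'm root \<Rightarrow> real" where
  "root_weight \<alpha> \<gamma> k2 (Low i) = \<alpha>"
| "root_weight \<alpha> \<gamma> k2 (High i) = \<gamma>"
| "root_weight \<alpha> \<gamma> k2 _ = k2"

abbreviation (input) pairs :: "('m::linorder \<times> 'm) set" where
  "pairs \<equiv> {p. fst p < snd p}"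

definition roots :: "'m::{finite,linorder} root set" where
  "roots = range Low \<union> (range High \<union> (case_prod Diff ` pairs \<union> (case_prod Plus ` pairs \<union> case_prod CoPlus ` pairs)))"

lemma sum_roots:
  fixes f :: "'m::{finite,linorder} root \<Rightarrow> 'b::comm_monoid_add"
  shows "(\<Sum>r\<in>roots. f r) = (\<Sum>i\<in>UNIV. f (Low i)) + ((\<Sum>i\<in>UNIV. f (High i)) +
    ((\<Sum>p\<in>pairs. f (Diff (fst p) (snd p))) + ((\<Sum>p\<in>pairs. f (Plus (fst p) (snd p))) + (\<Sum>p\<in>pairs. f (CoPlus (fst p) (snd p))))))"
proof -
  have inj: "inj (Low :: 'm \<Rightarrow> _)" "inj (High :: 'm \<Rightarrow> _)" "inj_on (case_prod Diff) (pairs :: ('m \<times> 'm) set)"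
    "inj_on (case_prod Plus) (pairs :: ('m \<times> 'm) set)" "inj_on (case_prod CoPlus) (pairs :: ('m \<times> 'm) set)"
    by (auto simp: inj_on_def)
  show ?thesis
    unfolding roots_def
    by (subst sum.union_disjoint, (auto simp: image_iff)[3])+
      (simp only: sum.reindex[OF inj(1)] sum.reindex[OF inj(2)] sum.reindex[OF inj(3)] sum.reindex[OF inj(4)] sum.reindex[OF inj(5)],
        simp only: comp_def case_prod_beta')
qed

lemma ball_roots:
  "(\<forall>r\<in>roots. P r) \<longleftrightarrow> (\<forall>i. P (Low i)) \<and> (\<forall>i. P (High i)) \<and>
    (\<forall>i j. i < j \<longrightarrow> P (Diff i j) \<and> P (Plus i j) \<and> P (CoPlus i j))"
  unfolding roots_def by (auto simp: image_iff)

lemma root_value: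
  "root_dir (Low i) \<bullet> x + root_offset (Low i) = x $ i"
  "root_dir (High i) \<bullet> x + root_offset (High i) = pi / 2 - x $ i"
  "root_dir (Diff i j) \<bullet> x + root_offset (Diff i j) = x $ i - x $ j"
  "root_dir (Plus i j) \<bullet> x + root_offset (Plus i j) = (x $ i + x $ j) / 2"
  "root_dir (CoPlus i j) \<bullet> x + root_offset (CoPlus i j) = pi / 2 - (x $ i + x $ j) / 2"
  by (simp_all add: inner_diff_left inner_add_left inner_axis' algebra_simps)

lemma closed_chamber_eq: "{x. \<forall>r\<in>roots. 0 \<le> root_dir r \<bullet> x + root_offset r} = closed_chamber"
proof -
  have "(\<forall>r\<in>roots. 0 \<le> root_dir r \<bullet> x + root_offset r) \<longleftrightarrow> x \<in> closed_chamber" for x :: "(real, 'a) vec"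
  proof -
    have "0 \<le> (x $ i + x $ j) / 2 \<and> 0 \<le> pi / 2 - (x $ i + x $ j) / 2" if "\<forall>i. 0 \<le> x $ i \<and> x $ i \<le> pi / 2" for i j
      using that[rule_format, of i] that[rule_format, of j] by simp
    then show ?thesis
      unfolding ball_roots root_value closed_chamber_def diff_ge_0_iff_ge mem_Collect_eq by blast
  qed
  then show ?thesis by auto
qed

lemma open_chamber_iff:
  fixes x :: "real ^ 'm::{finite,linorder}"
  shows "(\<forall>r\<in>roots. 0 < root_dir r \<bullet> x + root_offset r) \<longleftrightarrow> x \<in> (*\<^sub>R) pi ` alcove"
proof -
  have "x \<in> (*\<^sub>R) pi ` alcove \<longleftrightarrow> (1 / pi) *\<^sub>R x \<in> alcove"
  proof
    assume "(1 / pi) *\<^sub>R x \<in> alcove"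
    then have "pi *\<^sub>R (1 / pi) *\<^sub>R x \<in> (*\<^sub>R) pi ` alcove" by (rule imageI)
    then show "x \<in> (*\<^sub>R) pi ` alcove" by simp
  qed auto
  also have "\<dots> \<longleftrightarrow> (\<forall>i. 0 < x $ i \<and> x $ i < pi / 2) \<and> (\<forall>i j. i < j \<longrightarrow> x $ j < x $ i)"
    by (simp add: alcove_def field_simps)
  also have "\<dots> \<longleftrightarrow> (\<forall>r\<in>roots. 0 < root_dir r \<bullet> x + root_offset r)"
  proof -
    have "0 < (x $ i + x $ j) / 2 \<and> 0 < pi / 2 - (x $ i + x $ j) / 2" if "\<forall>i. 0 < x $ i \<and> x $ i < pi / 2" for i j
      using that[rule_format, of i] that[rule_format, of j] by simp
    then show ?thesis unfolding ball_roots root_value diff_gt_0_iff_gt by blast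
  qed
  finally show ?thesis by simp
qed

text \<open>
  Equally spaced coordinates. The number of indices above \<open>i\<close> is used because the coordinates decrease
  along the index order.
\<close>

definition inner_point :: "real ^ 'm::{finite,linorder}" where
  "inner_point = (\<chi> i. pi / 2 * (real (Suc (card {j. i < j})) / real (CARD('m) + 1)))"

lemma inner_point: "(inner_point :: real ^ 'm::{finite,linorder}) \<in> (*\<^sub>R) pi ` alcove"
proof -
  let ?c = "\<lambda>i::'m. card {j. i < j}"
  define u where "u i = real (Suc (?c i)) / real (CARD('m) + 1)" for i
  let ?x = "(\<chi> i. 1 / 2 * u i) :: (real, 'm) vec"
  have lt: "?c i < CARD('m)" for i
    by (intro psubset_card_mono) auto
  \<comment> \<open>Indices above \<open>j\<close> are above \<open>i\<close>, and \<open>j\<close> itself is above \<open>i\<close> only.\<close>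
  have mono: "?c j < ?c i" if "i < j" for i j
    using that by (intro psubset_card_mono) auto
  have u: "0 < u i" "u i < 1" for i using lt[of i] by (simp_all add: u_def)
  have "u j < u i" if "i < j" for i j
    unfolding u_def using mono[OF that] by (intro divide_strict_right_mono) simp_all
  then have "?x \<in> alcove" unfolding alcove_def using u by simp
  moreover have "inner_point = pi *\<^sub>R ?x" by (simp add: inner_point_def u_def vec_eq_iff)
  ultimately show ?thesis by (rule_tac x = ?x in image_eqI) auto
qed

lemma roots_cot_chamber:
  assumes "0 < \<alpha>" "0 < \<gamma>" "0 < k2"
  shows "cot_chamber (roots :: 'm::{finite,linorder} root set) root_dir root_offset (root_weight \<alpha> \<gamma> k2) inner_point"
proof
  show "finite (roots :: 'm root set)" unfolding roots_def by auto
  show "0 < root_weight \<alpha> \<gamma> k2 r" for r :: "'m root" using assms by (cases r) auto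
  show "0 < root_dir r \<bullet> inner_point + root_offset r" if "r \<in> roots" for r :: "'m root"
    using inner_point open_chamber_iff that by blast
  have "closed_chamber \<subseteq> cbox (0 :: (real, 'm) vec) (\<chi> i. pi / 2)"
    by (auto simp: closed_chamber_def mem_box_cart)
  then show "bounded {x :: (real, 'm) vec. \<forall>r\<in>roots. 0 \<le> root_dir r \<bullet> x + root_offset r}"
    unfolding closed_chamber_eq by (rule bounded_subset[OF bounded_cbox])
  show "root_dir r \<bullet> x + root_offset r \<le> pi / 2"
    if "\<And>r. r \<in> roots \<Longrightarrow> 0 \<le> root_dir r \<bullet> x + root_offset r" "r \<in> roots" for x and r :: "'m root"
  proof -
    have "x \<in> closed_chamber" using that(1) closed_chamber_eq by blast
    then have c: "0 \<le> x $ i" "x $ i \<le> pi / 2" for i by (auto simp: closed_chamber_def)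
    have c2: "0 \<le> x $ i + x $ j" "x $ i + x $ j \<le> pi" for i j using c[of i] c[of j] by linarith+
    show ?thesis
    proof (cases r)
      case (Low i) then show ?thesis using c[of i] unfolding Low root_value by linarith
    next
      case (High i) then show ?thesis using c[of i] unfolding High root_value by linarith
    next
      case (Diff i j) then show ?thesis using c[of i] c[of j] unfolding Diff root_value by linarith
    next
      case (Plus i j) then show ?thesis using c2[of i j] unfolding Plus root_value by simp
    next
      case (CoPlus i j) then show ?thesis using c2[of i j] unfolding CoPlus root_value by simp
    qed
  qed
qed

lemma cot_double_eq:
  fixes y :: real
  assumes "0 < y" "y < pi / 2"
  shows "cot (2 * y) = (cot y - cot (pi / 2 - y)) / 2"
proof -
  have pos: "sin y > 0" "cos y > 0" using assms by (auto intro: sin_gt_zero2 cos_gt_zero)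
  have e1: "cot (pi / 2 - y) = sin y / cos y"
  proof -
    have "cot (pi / 2 - y) = inverse (inverse (tan y))" by (simp only: cot_altdef tan_cot)
    then show ?thesis by (simp add: tan_def)
  qed
  have e2: "cot (2 * y) = ((cos y)\<^sup>2 - (sin y)\<^sup>2) / (2 * sin y * cos y)"
    by (simp only: cot_def sin_double cos_double)
  show ?thesis
    unfolding e1 e2 using pos by (simp add: cot_def field_simps power2_eq_square)
qed

text \<open>
  An ordered pair contributes to the coordinate \<open>l\<close> of the drift through its smaller or through its
  larger index; together these are all indices different from \<open>l\<close>.
\<close>

lemma sum_pairs_delta:
  fixes F G :: "'m::{finite,linorder} \<Rightarrow> 'm \<Rightarrow> real"
  shows "(\<Sum>p\<in>pairs. (if fst p = l then F (fst p) (snd p) else 0) + (if snd p = l then F (snd p) (fst p) else 0))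
    = (\<Sum>j\<in>UNIV - {l}. F l j)"
proof -
  have "(\<Sum>p\<in>pairs. if fst p = l then F (fst p) (snd p) else 0) = (\<Sum>p\<in>{p\<in>pairs. fst p = l}. F (fst p) (snd p))"
    by (rule sum.inter_filter[symmetric]) simp
  also have "\<dots> = (\<Sum>j\<in>{j. l < j}. F l j)"
    by (rule sum.reindex_bij_witness[of _ "\<lambda>j. (l, j)" snd]) auto
  finally have 1: "(\<Sum>p\<in>pairs. if fst p = l then F (fst p) (snd p) else 0) = (\<Sum>j\<in>{j. l < j}. F l j)" .
  have "(\<Sum>p\<in>pairs. if snd p = l then F (snd p) (fst p) else 0) = (\<Sum>p\<in>{p\<in>pairs. snd p = l}. F (snd p) (fst p))"
    by (rule sum.inter_filter[symmetric]) simp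
  also have "\<dots> = (\<Sum>j\<in>{j. j < l}. F l j)"
    by (rule sum.reindex_bij_witness[of _ "\<lambda>j. (j, l)" fst]) auto
  finally have 2: "(\<Sum>p\<in>pairs. if snd p = l then F (snd p) (fst p) else 0) = (\<Sum>j\<in>{j. j < l}. F l j)" .
  have U: "UNIV - {l} = {j. l < j} \<union> {j. j < l}" by auto
  have "(\<Sum>j\<in>UNIV - {l}. F l j) = (\<Sum>j\<in>{j. l < j}. F l j) + (\<Sum>j\<in>{j. j < l}. F l j)"
    unfolding U by (rule sum.union_disjoint) auto
  then show ?thesis unfolding sum.distrib 1 2 by (rule sym)
qed

text \<open>
  The half-angle identity expresses \<open>cot (2 x\<^sub>i)\<close> and \<open>cot (x\<^sub>i + x\<^sub>j)\<close> by the one-sided forms, and the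
  oddness of the cotangent combines the terms \<open>cot (x\<^sub>i - x\<^sub>j)\<close> and \<open>cot (x\<^sub>j - x\<^sub>i)\<close> in the form \<open>Diff\<close>.
\<close>

lemma drift_eq_root_sum:
  fixes x :: "real ^ 'm::{finite,linorder}"
  assumes x: "x \<in> (*\<^sub>R) pi ` alcove"
  shows "drift k0 k1 k2 x = (\<Sum>r\<in>roots. (root_weight (k0 + k1 / 2) (k1 / 2) k2 r * cot (root_dir r \<bullet> x + root_offset r)) *\<^sub>R root_dir r)"
proof -
  have c: "0 < x $ i" "x $ i < pi / 2" for i
    using x[folded open_chamber_iff] unfolding ball_roots root_value by auto
  have dbl: "cot (2 * x $ i) = (cot (x $ i) - cot (pi / 2 - x $ i)) / 2" for i
    using cot_double_eq[OF c] .
  have dbl2: "cot (x $ i + x $ j) = cot ((x $ i + x $ j) / 2) / 2 - cot (pi / 2 - (x $ i + x $ j) / 2) / 2" for i j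
  proof -
    have "cot (2 * ((x $ i + x $ j) / 2)) = (cot ((x $ i + x $ j) / 2) - cot (pi / 2 - (x $ i + x $ j) / 2)) / 2"
    proof (rule cot_double_eq)
      show "0 < (x $ i + x $ j) / 2" using c(1)[of i] c(1)[of j] by simp
      show "(x $ i + x $ j) / 2 < pi / 2" using c(2)[of i] c(2)[of j] by simp
    qed
    moreover have "2 * ((x $ i + x $ j) / 2) = x $ i + x $ j" by simp
    ultimately show ?thesis by (simp only: diff_divide_distrib)
  qed
  define F where "F i j = k2 * (cot (x $ i + x $ j) + cot (x $ i - x $ j))" for i j
  have "drift k0 k1 k2 x $ l = (\<Sum>r\<in>roots. (root_weight (k0 + k1 / 2) (k1 / 2) k2 r * cot (root_dir r \<bullet> x + root_offset r)) *\<^sub>R root_dir r) $ l" for l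
  proof -
    have ax: "axis i (1::real) $ l = (if i = l then 1 else 0)" for i by (simp add: axis_def)
    have neg: "cot (x $ j - x $ i) = - cot (x $ i - x $ j)" for i j
      using cot_minus[of "x $ i - x $ j"] by simp
    let ?t = "\<lambda>r. (root_weight (k0 + k1 / 2) (k1 / 2) k2 r * cot (root_dir r \<bullet> x + root_offset r)) * root_dir r $ l"
    have pair: "?t (Diff (fst p) (snd p)) + (?t (Plus (fst p) (snd p)) + ?t (CoPlus (fst p) (snd p)))
      = (if fst p = l then F (fst p) (snd p) else 0) + (if snd p = l then F (snd p) (fst p) else 0)" if "p \<in> pairs" for p
    proof -
      define i j where "i = fst p" and "j = snd p"
      then have p: "p = (i, j)" "i < j" using that by auto
      have F1: "F i j = k2 * (cot ((x $ i + x $ j) / 2) / 2 - cot (pi / 2 - (x $ i + x $ j) / 2) / 2 + cot (x $ i - x $ j))"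
        unfolding F_def dbl2 ..
      have F2: "F j i = k2 * (cot ((x $ i + x $ j) / 2) / 2 - cot (pi / 2 - (x $ i + x $ j) / 2) / 2 - cot (x $ i - x $ j))"
        unfolding F_def dbl2 neg[of j i] by (simp add: add.commute)
      consider "i = l" "j \<noteq> l" | "j = l" "i \<noteq> l" | "i \<noteq> l" "j \<noteq> l" using p(2) by auto
      then show ?thesis
        unfolding p(1) fst_conv snd_conv root_value F1 F2
        by cases (simp_all add: ax algebra_simps)
    qed
    have "(\<Sum>r\<in>roots. (root_weight (k0 + k1 / 2) (k1 / 2) k2 r * cot (root_dir r \<bullet> x + root_offset r)) *\<^sub>R root_dir r) $ l = (\<Sum>r\<in>roots. ?t r)"
      by (simp add: sum_component)
    also have "\<dots> = (\<Sum>i\<in>UNIV. ?t (Low i)) + ((\<Sum>i\<in>UNIV. ?t (High i)) + (\<Sum>p\<in>pairs. ?t (Diff (fst p) (snd p)) + (?t (Plus (fst p) (snd p)) + ?t (CoPlus (fst p) (snd p)))))"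
      unfolding sum_roots by (simp only: sum.distrib)
    also have "(\<Sum>p\<in>pairs. ?t (Diff (fst p) (snd p)) + (?t (Plus (fst p) (snd p)) + ?t (CoPlus (fst p) (snd p)))) = (\<Sum>j\<in>UNIV - {l}. F l j)"
      unfolding sum_pairs_delta[symmetric] by (intro sum.cong refl pair)
    also have "(\<Sum>i\<in>UNIV. ?t (Low i)) = (k0 + k1 / 2) * cot (x $ l)"
      unfolding root_value by (simp add: ax if_distrib cong: if_cong)
    also have "(\<Sum>i\<in>UNIV. ?t (High i)) = - (k1 / 2 * cot (pi / 2 - x $ l))"
      unfolding root_value by (simp add: ax if_distrib cong: if_cong)
    finally have eq: "(\<Sum>r\<in>roots. (root_weight (k0 + k1 / 2) (k1 / 2) k2 r * cot (root_dir r \<bullet> x + root_offset r)) *\<^sub>R root_dir r) $ l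
      = (k0 + k1 / 2) * cot (x $ l) + (- (k1 / 2 * cot (pi / 2 - x $ l)) + (\<Sum>j\<in>UNIV - {l}. F l j))" .
    have "drift k0 k1 k2 x $ l = k0 * cot (x $ l) + k1 * cot (2 * x $ l) + (\<Sum>j\<in>UNIV - {l}. F l j)"
      unfolding drift_def F_def by (simp add: sum_distrib_left)
    then show ?thesis unfolding eq dbl by (simp add: field_simps)
  qed
  then show ?thesis by (simp add: vec_eq_iff)
qed

section \<open>Brownian filtrations and the equation\<close>

lemma drift_measurable: "drift k0 k1 k2 \<in> borel_measurable (borel :: (real, 'm::finite) vec measure)"
proof -
  have comp: "(\<lambda>x. drift k0 k1 k2 x $ i) \<in> borel_measurable borel" for i :: 'm
    unfolding drift_def cot_def vec_lambda_beta by measurable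
  have "(\<lambda>x. drift k0 k1 k2 x \<bullet> e) \<in> borel_measurable borel" if e: "e \<in> Basis" for e :: "(real, 'm) vec"
  proof -
    obtain i where "e = axis i 1" using e unfolding Basis_vec_def by auto
    then show ?thesis using comp[of i] by (simp add: inner_axis)
  qed
  then show ?thesis by (rule iffD2[OF borel_measurable_euclidean_space, OF ballI])
qed

lemma space_generated_filtration: "space (generated_filtration M \<nu> \<xi> t) = space M"
  unfolding generated_filtration_def by (rule space_measure_of) auto

lemma sets_generated_filtration:
  "sets (generated_filtration M \<nu> \<xi> t) = sigma_sets (space M)
    ({\<xi> -` B \<inter> space M | B. B \<in> sets borel} \<union> {\<nu> s -` B \<inter> space M | s B. 0 \<le> s \<and> s \<le> t \<and> B \<in> sets borel})"
  unfolding generated_filtration_def by (rule sets_measure_of) auto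

lemma generated_filtration_mono:
  assumes "s \<le> t"
  shows "subalgebra (generated_filtration M \<nu> \<xi> t) (generated_filtration M \<nu> \<xi> s)"
proof -
  have "{\<nu> r -` B \<inter> space M | r B. 0 \<le> r \<and> r \<le> s \<and> B \<in> sets borel}
      \<subseteq> {\<nu> r -` B \<inter> space M | r B. 0 \<le> r \<and> r \<le> t \<and> B \<in> sets borel}"
  proof
    fix A assume "A \<in> {\<nu> r -` B \<inter> space M | r B. 0 \<le> r \<and> r \<le> s \<and> B \<in> sets borel}"
    then obtain r B where r: "A = \<nu> r -` B \<inter> space M" "0 \<le> r" "r \<le> s" "B \<in> sets borel" by blast
    moreover have "r \<le> t" using r(3) assms by linarith
    ultimately show "A \<in> {\<nu> r -` B \<inter> space M | r B. 0 \<le> r \<and> r \<le> t \<and> B \<in> sets borel}" by blast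
  qed
  then show ?thesis
    unfolding subalgebra_def space_generated_filtration sets_generated_filtration
    by (intro conjI refl sigma_sets_subseteq Un_mono subset_refl)
qed

lemma generated_filtration_measurable:
  fixes \<nu> :: "real \<Rightarrow> 'a \<Rightarrow> real ^ 'b::finite"
  shows "\<xi> \<in> borel_measurable (generated_filtration M \<nu> \<xi> t)"
    and "0 \<le> t \<Longrightarrow> \<nu> t \<in> borel_measurable (generated_filtration M \<nu> \<xi> t)"
proof -
  show "\<xi> \<in> borel_measurable (generated_filtration M \<nu> \<xi> t)"
    by (rule measurableI) (auto simp: space_generated_filtration sets_generated_filtration intro!: sigma_sets.Basic)
  assume t: "0 \<le> t"
  show "\<nu> t \<in> borel_measurable (generated_filtration M \<nu> \<xi> t)"
  proof (rule measurableI)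
    fix B :: "(real, 'b) vec set" assume "B \<in> sets borel"
    then have "\<nu> t -` B \<inter> space M \<in> {\<nu> s -` B \<inter> space M | s B. 0 \<le> s \<and> s \<le> t \<and> B \<in> sets borel}"
      using t by blast
    then show "\<nu> t -` B \<inter> space (generated_filtration M \<nu> \<xi> t) \<in> sets (generated_filtration M \<nu> \<xi> t)"
      unfolding space_generated_filtration sets_generated_filtration by (intro sigma_sets.Basic UnI2)
  qed simp
qed

lemma generated_filtration_subalgebra:
  assumes sp: "space N = space M" and \<xi>: "\<xi> \<in> borel_measurable N"
    and \<nu>: "\<And>s. 0 \<le> s \<Longrightarrow> s \<le> t \<Longrightarrow> \<nu> s \<in> borel_measurable N"
  shows "subalgebra N (generated_filtration M \<nu> \<xi> t)"
  unfolding subalgebra_def space_generated_filtration sets_generated_filtration sp[symmetric]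
  using measurable_sets[OF \<xi>] measurable_sets[OF \<nu>]
  by (intro conjI refl sets.sigma_sets_subset) auto

lemma subalgebra_augment:
  assumes "subalgebra M N"
  shows "subalgebra (augment M N) N"
proof -
  have "sets N \<union> null_sets (completion M) \<subseteq> Pow (space M)"
    using assms sets.sets_into_space[of _ M] sets.sets_into_space[of _ "completion M"]
    by (auto simp: subalgebra_def null_sets_def)
  then have eq: "space (augment M N) = space M" "sets (augment M N) = sigma_sets (space M) (sets N \<union> null_sets (completion M))"
    unfolding augment_def by (rule space_measure_of, rule sets_measure_of)
  show ?thesis
    using assms unfolding subalgebra_def eq by (blast intro: sigma_sets.Basic)
qed

text \<open>
  The increments are independent of \<open>F s\<close>, which contains the information generated by the initial value
  and the noise. Working with this smaller filtration is what makes the solution strong.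
\<close>

lemma brownian_noisy_chamber:
  fixes \<nu> :: "real \<Rightarrow> 'a \<Rightarrow> real ^ 'm::finite"
  assumes chamber: "cot_chamber I a c k x0" and filt: "filtered_prob_space M F" and bm: "brownian_motion M F \<nu>"
    and \<xi>: "\<xi> \<in> borel_measurable (F 0)" and \<xi>': "\<xi>' \<in> borel_measurable (generated_filtration M \<nu> \<xi> 0)"
    and in_Dc: "\<And>\<omega> i. i \<in> I \<Longrightarrow> 0 \<le> a i \<bullet> \<xi>' \<omega> + c i"
  shows "noisy_chamber I a c k x0 M (generated_filtration M \<nu> \<xi>) \<nu> \<xi>'"
proof -
  interpret cot_chamber I a c k x0 by (rule chamber)
  interpret prob_space M using filt by (simp add: filtered_prob_space_def)
  have F: "space (F t) = space M" "sets (F t) \<subseteq> sets M" "s \<le> t \<Longrightarrow> subalgebra (F t) (F s)" for s t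
    using filt unfolding filtered_prob_space_def filtration_def subalgebra_def by auto
  have \<nu>: "\<nu> s \<in> borel_measurable (F t)" if "0 \<le> s" "s \<le> t" for s t
    using bm measurable_from_subalg[OF F(3)[OF that(2)]] that(1) unfolding brownian_motion_def by blast
  have \<xi>_t: "\<xi> \<in> borel_measurable (F t)" if "0 \<le> t" for t
    by (rule measurable_from_subalg[OF F(3)[OF that] \<xi>])
  have GF: "subalgebra (F t) (generated_filtration M \<nu> \<xi> t)" if "0 \<le> t" for t
    using \<nu> \<xi>_t[OF that] by (intro generated_filtration_subalgebra F(1)) auto
  have FM: "subalgebra M (F t)" for t using F by (simp add: subalgebra_def)
  have dist: "distributed M lborel (\<lambda>\<omega>. \<nu> t \<omega> - \<nu> s \<omega>) (\<lambda>x. ennreal (\<Prod>i\<in>UNIV. normal_density 0 (sqrt (t - s)) (x $ i)))"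
    if "0 \<le> s" "s < t" for s t
    using bm that unfolding brownian_motion_def by blast
  have nn: "0 \<le> (\<Prod>i\<in>UNIV. normal_density 0 (sqrt (t - s)) (x $ i))" for s t and x :: "(real, 'm) vec"
    by (intro prod_nonneg) auto
  show ?thesis
  proof
    show "subalgebra M (generated_filtration M \<nu> \<xi> t)" for t
      using measurable_from_subalg[OF FM \<xi>] measurable_from_subalg[OF FM \<nu>[OF _ order_refl]]
      by (intro generated_filtration_subalgebra) auto
    show "subalgebra (generated_filtration M \<nu> \<xi> t) (generated_filtration M \<nu> \<xi> s)" if "s \<le> t" for s t
      using that by (rule generated_filtration_mono)
    show "\<nu> t \<in> borel_measurable (generated_filtration M \<nu> \<xi> t)" if "0 \<le> t" for t
      using that by (rule generated_filtration_measurable)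
    show "\<xi>' \<in> borel_measurable (generated_filtration M \<nu> \<xi> 0)" by (rule \<xi>')
    show "\<xi>' \<omega> \<in> Dc" for \<omega> using in_Dc by (simp add: Dc_def X_def)
    fix s t :: real assume st: "0 \<le> s" "s < t"
    have \<sigma>: "0 < sqrt (t - s)" "(sqrt (t - s))\<^sup>2 = t - s" using st by auto
    have "indep_set (sets (F s)) (sets (vimage_algebra (space M) (\<lambda>\<omega>. \<nu> t \<omega> - \<nu> s \<omega>) borel))"
      using bm st unfolding brownian_motion_def by blast
    then show "indep_set (sets (generated_filtration M \<nu> \<xi> s)) (sets (vimage_algebra (space M) (\<lambda>\<omega>. \<nu> t \<omega> - \<nu> s \<omega>) borel))"
      unfolding indep_set_def using GF[OF st(1)]
      by (elim indep_sets_mono_sets) (auto simp: subalgebra_def split: bool.split)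
    show "has_bochner_integral M (\<lambda>\<omega>. exp (u \<bullet> (\<nu> t \<omega> - \<nu> s \<omega>))) (exp ((norm u)\<^sup>2 * (t - s) / 2))" for u
      using gauss_exp[OF \<sigma>(1), of u] unfolding \<sigma>(2)
      by (intro distributed_has_bochner_integral[OF dist[OF st] nn, of "\<lambda>x. exp (u \<bullet> x)"]) measurable
    show "has_bochner_integral M (\<lambda>\<omega>. u \<bullet> (\<nu> t \<omega> - \<nu> s \<omega>)) 0" for u
      using gauss_mean[OF \<sigma>(1), of u]
      by (intro distributed_has_bochner_integral[OF dist[OF st] nn, of "\<lambda>x. u \<bullet> x"]) measurable
    show "has_bochner_integral M (\<lambda>\<omega>. (norm (\<nu> t \<omega> - \<nu> s \<omega>))\<^sup>2) (real DIM((real, 'm) vec) * (t - s))"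
      using gauss_square[OF \<sigma>(1), where 'm = 'm] unfolding \<sigma>(2)
      by (intro distributed_has_bochner_integral[OF dist[OF st] nn, of "\<lambda>x. (norm x)\<^sup>2"]) simp_all
  qed
qed

theorem corollary2p1:
  fixes m :: nat and \<beta> p q k0 k1 k2 :: real
    and M :: "'a measure" and F :: "real \<Rightarrow> 'a measure"
    and \<nu> :: "real \<Rightarrow> 'a \<Rightarrow> real ^ 'm::{finite,linorder}"
    and \<xi> :: "'a \<Rightarrow> (real, 'm) vec"
  assumes "m = CARD('m)"
    and "\<beta> > 0"
    and "min p q > (real m - 1) + 1 / \<beta>"
    and "k0 = \<beta> * (p - q) / 2"
    and "k1 = \<beta> * (q - (real m - 1)) - 1"
    and "k2 = \<beta> / 2"
    and "filtered_prob_space M F"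
    and "brownian_motion M F \<nu>"
    and "\<xi> \<in> borel_measurable (F 0)"
    and "AE \<omega> in M. \<xi> \<omega> \<in> closed_chamber"
  shows "unique_strong_solution M F (drift k0 k1 k2) \<nu> \<xi>"
proof -
  let ?G = "generated_filtration M \<nu> \<xi>" and ?b = "drift k0 k1 k2 :: (real, 'm) vec \<Rightarrow> _"
  have gt: "1 < \<beta> * (r - (real m - 1))" if "(real m - 1) + 1 / \<beta> < r" for r
  proof -
    have "1 / \<beta> < r - (real m - 1)" using that by linarith
    then have "\<beta> * (1 / \<beta>) < \<beta> * (r - (real m - 1))" using assms(2) by (rule mult_strict_left_mono)
    then show ?thesis using assms(2) by simp
  qed
  have p: "1 < \<beta> * (p - (real m - 1))" and q: "1 < \<beta> * (q - (real m - 1))"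
    using assms(3) by (intro gt; simp)+
  have "2 * k0 + k1 = \<beta> * (p - (real m - 1)) - 1"
  proof -
    have "2 * k0 = \<beta> * (p - q)" by (simp add: assms(4))
    then show ?thesis unfolding assms(5) by (simp add: algebra_simps)
  qed
  \<comment> \<open>The weights of \<open>Low\<close> and \<open>High\<close> are half of \<open>\<beta> (r - (m - 1)) - 1\<close> for \<open>r = p\<close> and \<open>r = q\<close>.\<close>
  with p have pos0: "0 < k0 + k1 / 2" by simp
  have pos1: "0 < k1 / 2" using q unfolding assms(5) by simp
  have pos2: "0 < k2" unfolding assms(6) using assms(2) by simp
  have chamber: "cot_chamber (roots :: 'm root set) root_dir root_offset (root_weight (k0 + k1 / 2) (k1 / 2) k2) inner_point"
    by (rule roots_cot_chamber[OF pos0 pos1 pos2])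
  interpret cot_chamber "roots :: 'm root set" root_dir root_offset "root_weight (k0 + k1 / 2) (k1 / 2) k2" inner_point
    by (rule chamber)
  have Dc: "Dc = closed_chamber" unfolding Dc_def X_def by (rule closed_chamber_eq)
  have D: "D = (*\<^sub>R) pi ` alcove" unfolding D_def X_def using open_chamber_iff by blast
  have b: "b x = ?b x" if "x \<in> D" for x
    unfolding b_def X_def using drift_eq_root_sum[of x k0 k1 k2] that D by simp
  \<comment> \<open>On the exceptional null set the initial value is moved into the chamber; \<open>inner_point\<close> is an arbitrary
    point of it.\<close>
  define \<xi>' where "\<xi>' \<omega> = (if \<xi> \<omega> \<in> closed_chamber then \<xi> \<omega> else inner_point)" for \<omega>
  have cm: "closed_chamber \<in> sets (borel :: (real, 'm) vec measure)"
    using closed_Dc unfolding Dc by (rule borel_closed)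
  have "\<xi>' \<in> borel_measurable (?G 0)"
    using generated_filtration_measurable(1)[of \<xi> M \<nu> 0] cm unfolding \<xi>'_def[abs_def] by measurable
  moreover have "0 \<le> root_dir r \<bullet> \<xi>' \<omega> + root_offset r" if "r \<in> roots" for \<omega> r
  proof -
    have "\<xi>' \<omega> \<in> Dc" unfolding \<xi>'_def using x0_in_D D_subset_Dc Dc by auto
    then show ?thesis using that by (simp add: Dc_def X_def)
  qed
  ultimately interpret noisy_chamber "roots :: 'm root set" root_dir root_offset "root_weight (k0 + k1 / 2) (k1 / 2) k2" inner_point M ?G \<nu> \<xi>'
    using assms(7,8,9) by (intro brownian_noisy_chamber cot_chamber_axioms)
  have bm: "AE \<omega> in M. \<nu> 0 \<omega> = 0 \<and> continuous_on {0..} (\<lambda>t. \<nu> t \<omega>)"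
    using assms(8) unfolding brownian_motion_def by blast
  then have "AE \<omega> in M. continuous_on {0..} (\<lambda>t. \<nu> t \<omega>)" by eventually_elim simp
  from solution_equation[OF this]
  have sol: "AE \<omega> in M. continuous_on {0..} (\<lambda>t. solution t \<omega>) \<and> (\<forall>t\<ge>0. solution t \<omega> \<in> closed_chamber) \<and>
      (AE s in lborel. 0 \<le> s \<longrightarrow> solution s \<omega> \<in> (*\<^sub>R) pi ` alcove) \<and>
      (\<forall>t\<ge>0. set_integrable lborel {0..t} (\<lambda>s. ?b (solution s \<omega>)) \<and>
        solution t \<omega> = \<xi> \<omega> + \<nu> t \<omega> + (LINT s:{0..t}|lborel. ?b (solution s \<omega>)))"
    using bm assms(10)
  proof eventually_elim
    case (elim \<omega>)
    have \<xi>'_eq: "\<xi>' \<omega> = \<xi> \<omega>" using elim(3) by (simp add: \<xi>'_def)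
    have cont: "continuous_on {0..} (\<lambda>t. solution t \<omega>)"
      and inD: "AE s in lborel. 0 \<le> s \<longrightarrow> solution s \<omega> \<in> D"
      and int: "\<And>t. 0 \<le> t \<Longrightarrow> set_integrable lborel {0..t} (\<lambda>s. b (solution s \<omega>))"
      and eq: "\<And>t. 0 \<le> t \<Longrightarrow> solution t \<omega> = \<xi>' \<omega> + (\<nu> t \<omega> - \<nu> 0 \<omega>) + (LINT s:{0..t}|lborel. b (solution s \<omega>))"
      using elim(1) by blast+
    have ae: "AE s in lborel. indicator {0..t} s *\<^sub>R b (solution s \<omega>) = indicator {0..t} s *\<^sub>R ?b (solution s \<omega>)" for t
      using inD by eventually_elim (auto simp: indicator_def b)
    have m: "(\<lambda>s. indicator {0..t} s *\<^sub>R ?b (solution s \<omega>)) \<in> borel_measurable lborel" for t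
    proof -
      have "continuous_on {0..} (\<lambda>t. \<nu> t \<omega>)" using elim(2) by simp
      from limit_path_compose_measurable[OF this xi_in_Dc drift_measurable] show ?thesis
        unfolding solution_def .
    qed
    have int': "set_integrable lborel {0..t} (\<lambda>s. ?b (solution s \<omega>))" if "0 \<le> t" for t
      using int[OF that] m ae unfolding set_integrable_def by (rule integrable_cong_AE_imp)
    have "(LINT s:{0..t}|lborel. b (solution s \<omega>)) = (LINT s:{0..t}|lborel. ?b (solution s \<omega>))" if "0 \<le> t" for t
      unfolding set_lebesgue_integral_def
    proof (rule integral_cong_AE[OF _ m ae])
      show "(\<lambda>s. indicator {0..t} s *\<^sub>R b (solution s \<omega>)) \<in> borel_measurable lborel"
        using int[OF that] unfolding set_integrable_def by (rule borel_measurable_integrable)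
    qed
    moreover have "\<forall>t\<ge>0. solution t \<omega> \<in> closed_chamber" using elim(1) unfolding Dc by blast
    ultimately show ?case using elim(2) cont inD int' eq \<xi>'_eq unfolding D by simp
  qed
  \<comment> \<open>The solution is measurable without the null sets; augmenting only enlarges the filtration.\<close>
  have adapted: "solution t \<in> borel_measurable (augment M (?G t))" if "0 \<le> t" for t
    by (rule measurable_from_subalg[OF subalgebra_augment[OF subalg] solution_adapted[OF that]])
  show ?thesis
    unfolding unique_strong_solution_def
  proof (intro exI conjI allI impI)
    show "sde_solution M (\<lambda>t. augment M (?G t)) ?b \<nu> \<xi> solution"
      unfolding sde_solution_def using adapted sol by blast
    fix \<psi> assume "sde_solution M (\<lambda>t. augment M (F t)) ?b \<nu> \<xi> \<psi>"
    then have "AE \<omega> in M. (AE s in lborel. 0 \<le> s \<longrightarrow> \<psi> s \<omega> \<in> (*\<^sub>R) pi ` alcove) \<and>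
      (\<forall>t\<ge>0. set_integrable lborel {0..t} (\<lambda>s. ?b (\<psi> s \<omega>)) \<and>
        \<psi> t \<omega> = \<xi> \<omega> + \<nu> t \<omega> + (LINT s:{0..t}|lborel. ?b (\<psi> s \<omega>)))"
      unfolding sde_solution_def by (elim conjE eventually_mono) simp
    then show "AE \<omega> in M. \<forall>t\<ge>0. \<psi> t \<omega> = solution t \<omega>"
      using sol
    proof eventually_elim
      case (elim \<omega>)
      have mono: "(?b x - ?b y) \<bullet> (x - y) \<le> 0" if "x \<in> D" "y \<in> D" for x y
        using b_monotone[OF that] b[OF that(1)] b[OF that(2)] by simp
      show ?case
      proof (intro allI impI)
        fix t :: real assume t: "0 \<le> t"
        show "\<psi> t \<omega> = solution t \<omega>"
        proof (rule integral_equation_unique[where D = D and d = ?b and w = "\<lambda>t. \<xi> \<omega> + \<nu> t \<omega>"])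
          show "AE s in lborel. 0 \<le> s \<longrightarrow> \<psi> s \<omega> \<in> D" "AE s in lborel. 0 \<le> s \<longrightarrow> solution s \<omega> \<in> D"
            unfolding D using elim by blast+
        qed (use elim mono t in blast)+
      qed
    qed
  qed
qed

end
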